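(* Let $n\ge 3$, $N\ge 2$, and let $F:\mathbb{R}^n\times\mathbb{R}^{N\times n}\to\mathbb{R}^N$ be a Carathéodory map which is strictly elliptic, i.e. there exists a linear map $A:\mathbb{R}^{N\times n}\to\mathbb{R}^N$ such that $$\operatorname*{ess\,sup}_{x\in\mathbb{R}^n}\ \sup_{P,Q\in\mathbb{R}^{N\times n},\,Q\neq0}\left|\frac{F(x,P+Q)-F(x,P)-A:Q}{|Q|}\right|\ <\ \min_{|\eta|=|a|=1}|A:\eta\otimes a|,$$ where the minimum is over $\eta\in\mathbb{R}^N$, $a\in\mathbb{R}^n$. Then there is a constant $C>0$, depending only on $F$, such that for any two maps $w,v\in W^{1;2^*,2}(\mathbb{R}^n)^N$, $$\|w-v\|_{L^{2^*}(\mathbb{R}^n)}+\|Dw-Dv\|_{L^2(\mathbb{R}^n)}\le C\,\big\|F(\cdot,Dw)-F(\cdot,Dv)\big\|_{L^2(\mathbb{R}^n)}.$$ In particular, for any $f\in L^2(\mathbb{R}^n)^N$, any two global strong a.e. solutions in $W^{1;2^*,2}(\mathbb{R}^n)^N$ of the PDE system $F(\cdot,Du)=f$ on $\mathbb{R}^n$ coincide.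
   Context: $F$ is Carathéodory if $x\mapsto F(x,P)$ is measurable for every $P\in\mathbb{R}^{N\times n}$ and $P\mapsto F(x,P)$ is continuous for a.e. $x\in\mathbb{R}^n$. $|\cdot|$ denotes the Euclidean norm on $\mathbb{R}^n$, $\mathbb{R}^N$ and $\mathbb{R}^{N\times n}$. $2^*=\frac{2n}{n-2}$ and $$W^{1;2^*,2}(\mathbb{R}^n)^N:=\{u\in L^{2^*}(\mathbb{R}^n)^N : Du\in L^2(\mathbb{R}^n)^{Nn}\},$$ where $Du=(D_iu_\alpha)\in\mathbb{R}^{N\times n}$ is the weak gradient matrix of $u:\mathbb{R}^n\to\mathbb{R}^N$. A global strong a.e. solution of $F(\cdot,Du)=f$ is a weakly differentiable map $u$ with $F(x,Du(x))=f(x)$ for a.e. $x\in\mathbb{R}^n$. A linear map $A:\mathbb{R}^{N\times n}\to\mathbb{R}^N$ is identified with its components $A_{\alpha\beta j}$ via $(A:Q)_\alpha=\sum_{\beta,j}A_{\alpha\beta j}Q_{\beta j}$; $\eta\otimes a\in\mathbb{R}^{N\times n}$ has entries $\eta_\beta a_j$. *)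

theory Defs
  imports "HOL-Analysis.Analysis" "HOL-Probability.Essential_Supremum"
begin

text \<open>
  Euclidean space of dimension \<open>n\<close> is \<open>real ^ 'n\<close> with \<open>n = CARD('n)\<close>. The \<open>N \<times> n\<close> matrices are
  \<open>real ^ 'n ^ 'm\<close> with \<open>N = CARD('m)\<close>: the entry in row \<open>\<alpha>\<close> and column \<open>i\<close> is \<open>P $ \<alpha> $ i\<close>. The
  library norm on this type is the Euclidean (Frobenius) norm. Functions are actual functions, not
  classes modulo null sets, and measurability refers to the Lebesgue sigma-algebra.
\<close>


subsection \<open>Lebesgue spaces\<close>

text \<open>The norm is extended: it takes the value \<open>\<infinity>\<close> for functions outside the Lebesgue space.\<close>

definition Lp_norm :: "real \<Rightarrow> ('a::euclidean_space \<Rightarrow> 'b::euclidean_space) \<Rightarrow> ennreal" where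
  "Lp_norm p f =
     (let I = (\<integral>\<^sup>+ x. ennreal (norm (f x) powr p) \<partial>lebesgue)
      in if I = \<infinity> then \<infinity> else ennreal (enn2real I powr (1 / p)))"

definition Lp_space :: "real \<Rightarrow> ('a::euclidean_space \<Rightarrow> 'b::euclidean_space) set" where
  "Lp_space p = {f. f \<in> borel_measurable lebesgue \<and> Lp_norm p f < \<infinity>}"

definition locally_integrable :: "('a::euclidean_space \<Rightarrow> 'b::euclidean_space) \<Rightarrow> bool" where
  "locally_integrable f \<longleftrightarrow> (\<forall>K. compact K \<longrightarrow> set_integrable lebesgue K f)"


subsection \<open>Weak gradients\<close>

definition partial_deriv :: "'n \<Rightarrow> (real ^ 'n::finite \<Rightarrow> real) \<Rightarrow> real ^ 'n \<Rightarrow> real" where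
  "partial_deriv i \<phi> x = frechet_derivative \<phi> (at x) (axis i 1)"

primrec Ck :: "nat \<Rightarrow> (real ^ 'n::finite \<Rightarrow> real) \<Rightarrow> bool" where
  "Ck 0 \<phi> \<longleftrightarrow> continuous_on UNIV \<phi>"
| "Ck (Suc k) \<phi> \<longleftrightarrow> (\<forall>x. \<phi> differentiable (at x)) \<and> (\<forall>i. Ck k (partial_deriv i \<phi>))"

definition test_function :: "(real ^ 'n::finite \<Rightarrow> real) \<Rightarrow> bool" where
  "test_function \<phi> \<longleftrightarrow> (\<forall>k. Ck k \<phi>) \<and> compact (closure {x. \<phi> x \<noteq> 0})"

text \<open>
  A weak gradient is determined only up to null sets, so it is a relation; \<open>u\<close> is weakly
  differentiable if it has some weak gradient.
\<close>

definition has_weak_gradient ::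
    "(real ^ 'n::finite \<Rightarrow> real ^ 'm::finite) \<Rightarrow> (real ^ 'n \<Rightarrow> real ^ 'n ^ 'm) \<Rightarrow> bool" where
  "has_weak_gradient u Du \<longleftrightarrow>
     locally_integrable u \<and> locally_integrable Du \<and>
     (\<forall>\<phi>. test_function \<phi> \<longrightarrow>
       (\<forall>\<alpha> i. (\<integral>x. u x $ \<alpha> * partial_deriv i \<phi> x \<partial>lebesgue) =
              - (\<integral>x. Du x $ \<alpha> $ i * \<phi> x \<partial>lebesgue)))"

text \<open>The space of \<open>L\<^sup>p\<close> maps with weak gradient in \<open>L\<^sup>q\<close>.\<close>

definition sobolev_space ::
    "real \<Rightarrow> real \<Rightarrow> (real ^ 'n::finite \<Rightarrow> real ^ 'm::finite) set" where
  "sobolev_space p q = {u \<in> Lp_space p. \<exists>Du \<in> Lp_space q. has_weak_gradient u Du}"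

definition sobolev_exponent :: "nat \<Rightarrow> real" where
  "sobolev_exponent n = 2 * real n / (real n - 2)"


subsection \<open>Strictly elliptic systems\<close>

definition caratheodory ::
    "(real ^ 'n::finite \<Rightarrow> real ^ 'n ^ 'm::finite \<Rightarrow> real ^ 'm) \<Rightarrow> bool" where
  "caratheodory F \<longleftrightarrow>
     (\<forall>P. (\<lambda>x. F x P) \<in> borel_measurable lebesgue) \<and>
     (AE x in lebesgue. continuous_on UNIV (F x))"

definition tensor :: "real ^ 'm::finite \<Rightarrow> real ^ 'n::finite \<Rightarrow> real ^ 'n ^ 'm" where
  "tensor \<eta> a = (\<chi> \<beta> j. \<eta> $ \<beta> * a $ j)"

definition ellipticity_const :: "(real ^ 'n::finite ^ 'm::finite \<Rightarrow> real ^ 'm) \<Rightarrow> real" where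
  "ellipticity_const A = (INF (\<eta>, a) \<in> sphere 0 1 \<times> sphere 0 1. norm (A (tensor \<eta> a)))"

lemma ellipticity_const_is_minimum:
  fixes A :: "real ^ 'n::finite ^ 'm::finite \<Rightarrow> real ^ 'm"
  assumes "linear A"
  shows "\<exists>\<eta> a. norm \<eta> = 1 \<and> norm a = 1 \<and> ellipticity_const A = norm (A (tensor \<eta> a))"
    and "norm \<eta> = 1 \<Longrightarrow> norm a = 1 \<Longrightarrow> ellipticity_const A \<le> norm (A (tensor \<eta> a))"
proof -
  let ?S = "sphere 0 1 \<times> sphere 0 1 :: ((real ^ 'm) \<times> (real ^ 'n)) set"
  let ?f = "\<lambda>p. norm (A (tensor (fst p) (snd p)))"
  have ne: "?S \<noteq> {}" by simp
  have c: "continuous_on ?S ?f"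
    unfolding tensor_def
    by (intro continuous_intros linear_continuous_on_compose[OF _ assms])
  obtain z where z: "z \<in> ?S" "\<And>y. y \<in> ?S \<Longrightarrow> ?f z \<le> ?f y"
    using continuous_attains_inf[OF _ ne c] by (auto simp: compact_Times)
  have eq: "ellipticity_const A = ?f z"
    unfolding ellipticity_const_def case_prod_beta
    by (rule cInf_eq_minimum) (use z in auto)
  show "\<exists>\<eta> a. norm \<eta> = 1 \<and> norm a = 1 \<and> ellipticity_const A = norm (A (tensor \<eta> a))"
    using eq z(1) by (intro exI[of _ "fst z"] exI[of _ "snd z"]) auto
  show "ellipticity_const A \<le> norm (A (tensor \<eta> a))" if "norm \<eta> = 1" "norm a = 1"
    using z(2)[of "(\<eta>, a)"] that eq by auto
qed

definition ellipticity_deviation ::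
    "(real ^ 'n::finite \<Rightarrow> real ^ 'n ^ 'm::finite \<Rightarrow> real ^ 'm) \<Rightarrow>
     (real ^ 'n ^ 'm \<Rightarrow> real ^ 'm) \<Rightarrow> real ^ 'n \<Rightarrow> ennreal" where
  "ellipticity_deviation F A x =
     (SUP (P, Q) \<in> UNIV \<times> (- {0}). ennreal (norm (F x (P + Q) - F x P - A Q) / norm Q))"

text \<open>
  The library's \<open>esssup\<close> is \<open>\<infinity>\<close> on non-measurable functions; this convention is never used for
  Caratheodory maps.
\<close>

lemma measurable_ellipticity_deviation:
  fixes F :: "real ^ 'n::finite \<Rightarrow> real ^ 'n ^ 'm::finite \<Rightarrow> real ^ 'm"
  assumes F: "caratheodory F" and A: "linear A"
  shows "ellipticity_deviation F A \<in> borel_measurable lebesgue"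
proof -
  let ?q = "\<lambda>x p. ennreal (norm (F x (fst p + snd p) - F x (fst p) - A (snd p)) / norm (snd p))"
  let ?S = "UNIV \<times> (- {0}) :: ((real ^ 'n ^ 'm) \<times> (real ^ 'n ^ 'm)) set"
  obtain D :: "((real ^ 'n ^ 'm) \<times> (real ^ 'n ^ 'm)) set"
    where D: "countable D" "\<And>X. open X \<Longrightarrow> X \<noteq> {} \<Longrightarrow> \<exists>d\<in>D. d \<in> X"
    using countable_dense_setE by metis
  let ?T = "D \<inter> ?S"
  have [measurable]: "(\<lambda>x. F x P) \<in> borel_measurable lebesgue" for P
    using F by (auto simp: caratheodory_def)
  have m: "(\<lambda>x. SUP p\<in>?T. ?q x p) \<in> borel_measurable lebesgue"
    by (intro borel_measurable_SUP) (use D(1) in auto)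
  have S: "open ?S" by (intro open_Times) auto
  have eq: "ellipticity_deviation F A x = (SUP p\<in>?T. ?q x p)" if "continuous_on UNIV (F x)" for x
  proof (rule antisym)
    have cq: "continuous_on ?S (?q x)"
      by (intro continuous_on_ennreal continuous_intros linear_continuous_on_compose[OF _ A]
          continuous_on_compose2[OF that]) auto
    show "ellipticity_deviation F A x \<le> (SUP p\<in>?T. ?q x p)"
      unfolding ellipticity_deviation_def case_prod_beta
    proof (rule SUP_least, rule ccontr)
      fix p assume p: "p \<in> ?S" and "\<not> ?q x p \<le> (SUP p\<in>?T. ?q x p)"
      then have lt: "(SUP p\<in>?T. ?q x p) < ?q x p" by simp
      let ?U = "?S \<inter> ?q x -` {(SUP p\<in>?T. ?q x p)<..}"
      have "open ?U" by (rule continuous_open_preimage[OF cq S]) auto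
      moreover have "p \<in> ?U" using p lt by blast
      ultimately obtain d where d: "d \<in> D" "d \<in> ?U" using D(2)[of ?U] by blast
      have "?q x d \<le> (SUP p\<in>?T. ?q x p)" by (rule SUP_upper) (use d in auto)
      with d show False by auto
    qed
    show "(SUP p\<in>?T. ?q x p) \<le> ellipticity_deviation F A x"
      unfolding ellipticity_deviation_def case_prod_beta by (rule SUP_subset_mono) auto
  qed
  have ae: "AE x in lebesgue. ellipticity_deviation F A x = (SUP p\<in>?T. ?q x p)"
    using F eq by (auto simp: caratheodory_def elim: eventually_mono)
  show ?thesis
  proof (rule measurableI)
    fix B :: "ennreal set" assume "B \<in> sets borel"
    then have "(\<lambda>x. SUP p\<in>?T. ?q x p) -` B \<inter> space lebesgue \<in> sets lebesgue"
      using m by (rule measurable_sets[rotated])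
    then show "ellipticity_deviation F A -` B \<inter> space lebesgue \<in> sets lebesgue"
      by (rule completion.in_sets_AE[rotated]) (use ae in \<open>auto elim: eventually_mono\<close>)
  qed auto
qed

definition strictly_elliptic ::
    "(real ^ 'n::finite \<Rightarrow> real ^ 'n ^ 'm::finite \<Rightarrow> real ^ 'm) \<Rightarrow> bool" where
  "strictly_elliptic F \<longleftrightarrow>
     (\<exists>A. linear A \<and> esssup lebesgue (ellipticity_deviation F A) < ennreal (ellipticity_const A))"

definition strong_solution ::
    "(real ^ 'n::finite \<Rightarrow> real ^ 'n ^ 'm::finite \<Rightarrow> real ^ 'm) \<Rightarrow>
     (real ^ 'n \<Rightarrow> real ^ 'm) \<Rightarrow> (real ^ 'n \<Rightarrow> real ^ 'm) \<Rightarrow> bool" where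
  "strong_solution F f u \<longleftrightarrow>
     (\<exists>Du. has_weak_gradient u Du \<and> (AE x in lebesgue. F x (Du x) = f x))"

end

theory Submission
  imports Defs "HOL-Probability.Probability_Measure"
begin

text \<open>
  Write \<open>\<nu>\<close> for the minimum of $|A:\eta\otimes a|$ and \<open>K < \<nu>\<close> for the essential supremum in the
  ellipticity condition, and let $u = w - v$. Pointwise, $|A:Du|$ is at most
  $|F(\cdot,Dw) - F(\cdot,Dv)| + K|Du|$. On the Fourier side a gradient is a rank-one matrix at every frequency, so
  Plancherel gives $\nu\|Du\|_2 \le \|A:Du\|_2$, and the term with \<open>K\<close> can be absorbed. This bounds
  $\|Du\|_2$, and the Sobolev inequality bounds $\|u\|_{2^*}$. Uniqueness is the special case of a
  vanishing right-hand side.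

  Both analytic ingredients are derived from one fact about weak gradients, \<open>weak_gradient_segment\<close>: a difference
  $u(x+y)-u(x)$ is the average of $Du\cdot y$ along the segment. Smooth approximation of \<open>u\<close> is thereby avoided.

  The Plancherel estimate \<open>rank_one_bound_weak_gradient\<close> is first proved for central difference quotients. On each
  coset of the lattice $h\mathbb{Z}^n$ it is a statement about finite trigonometric sums
  (\<open>rank_one_bound_lattice\<close>), and integrating over one cell of the lattice gives it for every Borel map of bounded
  support. It then passes to \<open>L\<^sup>2\<close> maps by cutting off, to maps in \<open>L\<^sup>p\<close> by shrinking the values towards
  \<open>0\<close>, which is compatible with differences, and to the gradient by letting \<open>h\<close> tend to \<open>0\<close>.

  The Sobolev inequality \<open>Sobolev_inequality\<close> is obtained from a Faber--Krahn inequality for translation energies,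
  applied to the layers of \<open>|u|\<close> between consecutive dyadic levels; the energies of the layers add up to at most the
  energy of \<open>u\<close>.
\<close>


section \<open>Smooth bumps and the fundamental lemma\<close>

text \<open>
  The functions $t^{-p} e^{-1/t}$. The power in the denominator is there because the family is then closed,
  up to linear combinations, under differentiation, which makes smoothness an induction on the order.
\<close>

definition inv_exp :: "nat \<Rightarrow> real \<Rightarrow> real" where
  "inv_exp p t = (if t > 0 then exp (- 1 / t) / t ^ p else 0)"

lemma inv_exp_tendsto_0: "(inv_exp p \<longlongrightarrow> 0) (at_right 0)"
proof -
  have "((\<lambda>t. (inverse t) ^ p / exp (inverse t)) \<longlongrightarrow> (0::real)) (at_right 0)"
    by (rule filterlim_compose[OF tendsto_power_div_exp_0 filterlim_inverse_at_top_right])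
  moreover have "\<forall>\<^sub>F t in at_right (0::real). (inverse t) ^ p / exp (inverse t) = inv_exp p t"
    unfolding eventually_at_right_field
    by (auto intro!: exI[of _ 1] simp: inv_exp_def exp_minus field_simps)
  ultimately show ?thesis
    by (rule Lim_transform_eventually)
qed

text \<open>
  At \<open>0\<close> the difference quotient of one member of the family is, on the right, the next member, so it
  tends to \<open>0\<close>.
\<close>

lemma DERIV_inv_exp:
  "(inv_exp p has_real_derivative inv_exp (p + 2) t - real p * inv_exp (p + 1) t) (at t)"
proof -
  consider "t > 0" | "t < 0" | "t = 0" by linarith
  then show ?thesis
  proof cases
    case 1
    have "((\<lambda>t. exp (- 1 / t) / t ^ p) has_real_derivative
        inv_exp (p + 2) t - real p * inv_exp (p + 1) t) (at t)"
      using 1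
      apply (auto intro!: derivative_eq_intros simp: inv_exp_def)
      apply (cases p)
       apply (auto simp: field_simps power2_eq_square)
      done
    then show ?thesis
      by (rule DERIV_cong_ev[THEN iffD1, OF refl _ refl, rotated])
         (use eventually_gt_at_top[of 0] 1 in \<open>auto simp: inv_exp_def eventually_nhds intro!: exI[of _ "{0<..}"]\<close>)
  next
    case 2
    have "((\<lambda>t. 0) has_real_derivative inv_exp (p + 2) t - real p * inv_exp (p + 1) t) (at t)"
      using 2 by (simp add: inv_exp_def)
    then show ?thesis
      by (rule DERIV_cong_ev[THEN iffD1, OF refl _ refl, rotated])
         (use 2 in \<open>auto simp: inv_exp_def eventually_nhds intro!: exI[of _ "{..<0}"]\<close>)
  next
    case 3
    have R: "((\<lambda>h. (inv_exp p h - inv_exp p 0) / (h - 0)) \<longlongrightarrow> 0) (at_right 0)"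
    proof (rule Lim_transform_eventually[OF inv_exp_tendsto_0[of "p+1"]])
      show "\<forall>\<^sub>F h in at_right 0. inv_exp (p + 1) h = (inv_exp p h - inv_exp p 0) / (h - 0)"
        unfolding eventually_at_right_field
        by (auto intro!: exI[of _ 1] simp: inv_exp_def field_simps)
    qed
    have L: "((\<lambda>h. (inv_exp p h - inv_exp p 0) / (h - 0)) \<longlongrightarrow> 0) (at_left 0)"
    proof (rule Lim_transform_eventually[OF tendsto_const])
      show "\<forall>\<^sub>F h in at_left 0. 0 = (inv_exp p h - inv_exp p 0) / (h - 0)"
        unfolding eventually_at_left_field
        by (auto intro!: exI[of _ "-1"] simp: inv_exp_def field_simps)
    qed
    have "((\<lambda>h. (inv_exp p h - inv_exp p 0) / (h - 0)) \<longlongrightarrow> 0) (at 0)"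
      using L R by (rule filterlim_split_at)
    then show ?thesis
      using 3 by (simp add: has_field_derivative_iff inv_exp_def)
  qed
qed

lemma partial_deriv_eq: "(f has_derivative D) (at x) \<Longrightarrow> partial_deriv i f x = D (axis i 1)"
  unfolding partial_deriv_def by (metis frechet_derivative_at)

lemma Ck_SucI:
  assumes "\<And>x. (f has_derivative D x) (at x)" "\<And>i. Ck k (\<lambda>x. D x (axis i 1))"
  shows "Ck (Suc k) f"
proof -
  have "partial_deriv i f = (\<lambda>x. D x (axis i 1))" for i
    using partial_deriv_eq[OF assms(1)] by auto
  with assms show ?thesis by (auto simp: differentiable_def)
qed

lemma Ck_Suc_imp_Ck: "Ck (Suc k) f \<Longrightarrow> Ck k f"
proof (induction k arbitrary: f)
  case 0
  then show ?case by (auto intro!: continuous_at_imp_continuous_on differentiable_imp_continuous_within)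
next
  case (Suc k)
  show ?case
    using Suc.prems Suc.IH by (simp only: Ck.simps) blast
qed

lemma Ck_imp_continuous_on: "Ck k f \<Longrightarrow> continuous_on UNIV f"
proof (induction k)
  case (Suc k) then show ?case using Ck_Suc_imp_Ck by blast
qed simp

lemma Ck_Suc_has_derivative: "Ck (Suc k) f \<Longrightarrow> (f has_derivative frechet_derivative f (at x)) (at x)"
  by (simp add: frechet_derivative_works)

lemma Ck_const: "Ck k (\<lambda>x. c)"
proof (induction k arbitrary: c)
  case (Suc k)
  show ?case by (rule Ck_SucI[where D="\<lambda>_ _. 0"]) (auto intro: Suc)
qed simp

lemma Ck_add: "Ck k f \<Longrightarrow> Ck k g \<Longrightarrow> Ck k (\<lambda>x. f x + g x)"
proof (induction k arbitrary: f g)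
  case (Suc k)
  show ?case
  proof (rule Ck_SucI)
    show "((\<lambda>x. f x + g x) has_derivative
      (\<lambda>h. frechet_derivative f (at x) h + frechet_derivative g (at x) h)) (at x)" for x
      by (intro has_derivative_add Ck_Suc_has_derivative[OF Suc.prems(1)] Ck_Suc_has_derivative[OF Suc.prems(2)])
    show "Ck k (\<lambda>x. frechet_derivative f (at x) (axis i 1) + frechet_derivative g (at x) (axis i 1))" for i
      using Suc.IH[of "partial_deriv i f" "partial_deriv i g"] Suc.prems by (simp add: partial_deriv_def[abs_def])
  qed
qed (simp add: continuous_on_add)

lemma Ck_mult: "Ck k f \<Longrightarrow> Ck k g \<Longrightarrow> Ck k (\<lambda>x. f x * g x)"
proof (induction k arbitrary: f g)
  case (Suc k)
  show ?case
  proof (rule Ck_SucI)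
    show "((\<lambda>x. f x * g x) has_derivative
      (\<lambda>h. f x * frechet_derivative g (at x) h + frechet_derivative f (at x) h * g x)) (at x)" for x
      by (intro has_derivative_mult Ck_Suc_has_derivative[OF Suc.prems(1)] Ck_Suc_has_derivative[OF Suc.prems(2)])
    show "Ck k (\<lambda>x. f x * frechet_derivative g (at x) (axis i 1) + frechet_derivative f (at x) (axis i 1) * g x)" for i
      using Suc.IH[of f "partial_deriv i g"] Suc.IH[of "partial_deriv i f" g] Suc.prems
         Ck_Suc_imp_Ck[OF Suc.prems(1)]  Ck_Suc_imp_Ck[OF Suc.prems(2)]
      by (intro Ck_add) (auto simp: partial_deriv_def[abs_def])
  qed
qed (simp add: continuous_on_mult)

lemma Ck_prod: "(\<And>i. i \<in> I \<Longrightarrow> Ck k (f i)) \<Longrightarrow> Ck k (\<lambda>x. \<Prod>i\<in>I. f i x)"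
  by (induction I rule: infinite_finite_induct) (auto intro: Ck_mult Ck_const)

text \<open>
  The exponent \<open>p\<close> has to vary in the induction, since a derivative involves \<open>p + 1\<close> and \<open>p + 2\<close>.
\<close>

lemma Ck_inv_exp_affine: "Ck k (\<lambda>x. inv_exp p (c * x $ i + d))"
proof (induction k arbitrary: p)
  case 0
  have "continuous_on UNIV (inv_exp p)"
    by (rule continuous_at_imp_continuous_on) (use DERIV_inv_exp DERIV_isCont in blast)
  then show ?case
    by (auto intro!: continuous_on_compose2[of UNIV "inv_exp p"] continuous_intros)
next
  case (Suc k)
  let ?e = "\<lambda>q x. inv_exp q (c * x $ i + d)"
  show ?case
  proof (rule Ck_SucI)
    show "((\<lambda>x. ?e p x) has_derivative (\<lambda>h. (c * h $ i) * (?e (p + 2) x - real p * ?e (p + 1) x))) (at x)" for x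
    proof -
      have "((\<lambda>x. c * x $ i + d) has_derivative (\<lambda>h. c * h $ i)) (at x)"
        by (auto intro!: derivative_eq_intros bounded_linear_imp_has_derivative[OF bounded_linear_vec_nth])
      then have "((\<lambda>x. inv_exp p (c * x $ i + d)) has_derivative
          (\<lambda>h. (?e (p + 2) x - real p * ?e (p + 1) x) * (c * h $ i))) (at x)"
        using DERIV_inv_exp[of p "c * x $ i + d"]
        unfolding has_field_derivative_def by (rule has_derivative_compose)
      then show ?thesis by (simp add: mult.commute)
    qed
    show "Ck k (\<lambda>x. (c * axis j 1 $ i) * (?e (p + 2) x - real p * ?e (p + 1) x))" for j
    proof -
      have "Ck k (\<lambda>x. (c * axis j 1 $ i) * (?e (p + 2) x + (- real p) * ?e (p + 1) x))"
        by (intro Ck_mult Ck_add Ck_const Suc)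
      then show ?thesis by simp
    qed
  qed
qed

lemma Ck_translate:
  "Ck k f \<Longrightarrow> Ck k (\<lambda>x. f (x + y)) \<and>
    (k > 0 \<longrightarrow> (\<forall>i. partial_deriv i (\<lambda>x. f (x + y)) = (\<lambda>x. partial_deriv i f (x + y))))"
proof (induction k arbitrary: f)
  case (Suc k)
  have d: "((\<lambda>x. f (x + y)) has_derivative frechet_derivative f (at (x + y))) (at x)" for x
  proof -
    have "((\<lambda>x. x + y) has_derivative (\<lambda>h. h)) (at x)"
      by (auto intro!: derivative_eq_intros)
    from has_derivative_compose[OF this Ck_Suc_has_derivative[OF Suc.prems]] show ?thesis by simp
  qed
  have "Ck (Suc k) (\<lambda>x. f (x + y))"
  proof (rule Ck_SucI[OF d])
    show "Ck k (\<lambda>x. frechet_derivative f (at (x + y)) (axis i 1))" for i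
    proof -
      have "Ck k (partial_deriv i f)" using Suc.prems by simp
      from Suc.IH[OF this] show ?thesis by (simp add: partial_deriv_def)
    qed
  qed
  moreover have "partial_deriv i (\<lambda>x. f (x + y)) = (\<lambda>x. partial_deriv i f (x + y))" for i
    using partial_deriv_eq[OF d] by (auto simp: partial_deriv_def)
  ultimately show ?case by blast
next
  case 0
  then show ?case
    by (simp add: continuous_on_compose2[where g=f and f="\<lambda>x. x + y"] continuous_on_add)
qed

lemma partial_deriv_translate:
  "test_function f \<Longrightarrow> partial_deriv i (\<lambda>x. f (x + y)) = (\<lambda>x. partial_deriv i f (x + y))"
  using Ck_translate[of 1 f y] by (auto simp: test_function_def)

lemma support_translate: "{x::'a::real_normed_vector. f (x + y) \<noteq> 0} = (\<lambda>x. x - y) ` {x. f x \<noteq> 0}"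
  by (auto simp: image_iff) (metis add_diff_cancel)

lemma test_function_translate: "test_function f \<Longrightarrow> test_function (\<lambda>x. f (x + y))"
  unfolding test_function_def support_translate
proof safe
  fix k assume "\<forall>k. Ck k f" then show "Ck k (\<lambda>x. f (x + y))" using Ck_translate by blast
next
  assume "compact (closure {x. f x \<noteq> 0})"
  then show "compact (closure ((\<lambda>x. x - y) ` {x. f x \<noteq> 0}))"
    using bounded_translation[of _ "-y"] compact_closure by (metis (no_types, lifting) diff_conv_add_uminus image_cong add.commute)
qed

text \<open>
  For \<open>t > 0\<close> the value \<open>inv_exp 0 (k * t)\<close> is $e^{-1/(kt)}$, which increases to \<open>1\<close>
  with \<open>k\<close>; so these products approximate the indicator of the open box from below.
\<close>

definition box_bump :: "nat \<Rightarrow> real ^ 'n::finite \<Rightarrow> real ^ 'n \<Rightarrow> real ^ 'n \<Rightarrow> real" where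
  "box_bump k a b x =
     (\<Prod>i\<in>UNIV. inv_exp 0 (real (Suc k) * (x $ i - a $ i)) * inv_exp 0 (real (Suc k) * (b $ i - x $ i)))"

lemma inv_exp_0_bounds: "0 \<le> inv_exp 0 t" "inv_exp 0 t \<le> 1"
  by (auto simp: inv_exp_def)

lemma test_function_box_bump: "test_function (box_bump k a b)"
proof -
  have "Ck m (\<lambda>x. \<Prod>i\<in>UNIV. inv_exp 0 (real (Suc k) * x $ i + (- real (Suc k) * a $ i)) *
      inv_exp 0 ((- real (Suc k)) * x $ i + real (Suc k) * b $ i))" for m
    by (intro Ck_prod Ck_mult Ck_inv_exp_affine)
  also have "(\<lambda>x. \<Prod>i\<in>UNIV. inv_exp 0 (real (Suc k) * x $ i + (- real (Suc k) * a $ i)) *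
      inv_exp 0 ((- real (Suc k)) * x $ i + real (Suc k) * b $ i)) = box_bump k a b"
    by (auto simp: box_bump_def fun_eq_iff algebra_simps)
  finally have 1: "Ck m (box_bump k a b)" for m .
  have "{x. box_bump k a b x \<noteq> 0} \<subseteq> cbox a b"
  proof
    fix x assume x: "x \<in> {x. box_bump k a b x \<noteq> 0}"
    have "a $ i < x $ i \<and> x $ i < b $ i" for i
      using x by (auto simp: box_bump_def inv_exp_def zero_less_mult_iff split: if_splits)
    then show "x \<in> cbox a b" by (auto simp: mem_box_cart intro: less_imp_le)
  qed
  then have "bounded {x. box_bump k a b x \<noteq> 0}"
    using bounded_cbox bounded_subset by blast
  then show ?thesis using 1 by (auto simp: test_function_def compact_closure)
qed

lemma box_bump_bounds: "0 \<le> box_bump k a b x" "box_bump k a b x \<le> indicator (box a b) x"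
proof -
  show "0 \<le> box_bump k a b x"
    unfolding box_bump_def by (intro prod_nonneg) (auto simp: inv_exp_0_bounds)
  show "box_bump k a b x \<le> indicator (box a b) x"
  proof (cases "x \<in> box a b")
    case True
    have "box_bump k a b x \<le> 1"
      unfolding box_bump_def by (intro prod_le_1) (auto simp: inv_exp_0_bounds intro!: mult_le_one)
    with True show ?thesis by simp
  next
    case False
    then obtain i where "\<not> (a $ i < x $ i \<and> x $ i < b $ i)" by (auto simp: mem_box_cart)
    then have "inv_exp 0 (real (Suc k) * (x $ i - a $ i)) * inv_exp 0 (real (Suc k) * (b $ i - x $ i)) = 0"
      by (auto simp: inv_exp_def zero_less_mult_iff)
    then have "box_bump k a b x = 0"
      unfolding box_bump_def by (meson UNIV_I finite_class.finite_UNIV prod_zero)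
    then show ?thesis by simp
  qed
qed

lemma inv_exp_0_tendsto_1:
  assumes "t > 0" shows "(\<lambda>k. inv_exp 0 (real (Suc k) * t)) \<longlonglongrightarrow> 1"
proof -
  have "(\<lambda>k. exp (- (1 / t) * inverse (real (Suc k)))) \<longlonglongrightarrow> exp (- (1 / t) * 0)"
    by (intro tendsto_intros LIMSEQ_inverse_real_of_nat)
  moreover have "exp (- (1 / t) * inverse (real (Suc k))) = inv_exp 0 (real (Suc k) * t)" for k
    using assms by (simp add: inv_exp_def divide_inverse mult.commute)
  ultimately show ?thesis by simp
qed

lemma box_bump_tendsto: "(\<lambda>k. box_bump k a b x) \<longlonglongrightarrow> indicator (box a b) x"
proof (cases "x \<in> box a b")
  case True
  then have "(\<lambda>k. box_bump k a b x) \<longlonglongrightarrow> (\<Prod>i\<in>(UNIV::'a set). 1 * 1)"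
    unfolding box_bump_def
    by (intro tendsto_prod tendsto_mult inv_exp_0_tendsto_1) (auto simp: mem_box_cart)
  then show ?thesis using True by simp
next
  case False
  then have "box_bump k a b x = 0" for k
    using box_bump_bounds[of k a b x] by simp
  then show ?thesis using False by simp
qed


text \<open>
  Open boxes form an intersection-stable generator, so the measures with densities $g^+$ and $g^-$ coincide
  as soon as they coincide on boxes.
\<close>

lemma AE_eq_0_if_box_integrals_eq_0:
  fixes g :: "'a::euclidean_space \<Rightarrow> real"
  assumes [measurable]: "g \<in> borel_measurable borel"
    and int: "\<And>a b. integrable lborel (\<lambda>x. g x * indicator (box a b) x)"
    and zero: "\<And>a b. (LBINT x. g x * indicator (box a b) x) = 0"
  shows "AE x in lborel. g x = 0"
proof -
  let ?M = "density lborel (\<lambda>x. ennreal (g x))" and ?N = "density lborel (\<lambda>x. ennreal (- g x))"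
  let ?E = "range (\<lambda>(a, b). box a b :: 'a set)"
  have M: "emeasure ?M (box a b) = (\<integral>\<^sup>+x. ennreal (g x * indicator (box a b) x) \<partial>lborel)" for a b :: 'a
    by (auto simp: emeasure_density intro!: nn_integral_cong split: split_indicator)
  have N: "emeasure ?N (box a b) = (\<integral>\<^sup>+x. ennreal (- (g x * indicator (box a b) x)) \<partial>lborel)" for a b :: 'a
    by (auto simp: emeasure_density intro!: nn_integral_cong split: split_indicator)
  have fin: "emeasure ?M (box a b) \<noteq> \<infinity>" "emeasure ?N (box a b) \<noteq> \<infinity>" for a b :: 'a
    unfolding M N using int[of a b] by (auto simp: real_integrable_def)
  have eq: "emeasure ?M (box a b) = emeasure ?N (box a b)" for a b :: 'a
  proof -
    have "enn2real (emeasure ?M (box a b)) = enn2real (emeasure ?N (box a b))"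
      unfolding M N using zero[of a b] by (simp add: real_lebesgue_integral_def[OF int])
    then show ?thesis
      using fin[of a b] by (metis ennreal_enn2real infinity_ennreal_def less_top)
  qed
  have "?M = ?N"
  proof (rule measure_eqI_generator_eq[where E="?E" and \<Omega>=UNIV and A="\<lambda>n. box (- (real n *\<^sub>R One)) (real n *\<^sub>R One)"])
    show "Int_stable ?E"
      by (auto simp: Int_stable_def box_Int_box)
    show "sets ?M = sigma_sets UNIV ?E" "sets ?N = sigma_sets UNIV ?E"
      by (simp_all add: borel_eq_box)
    show "(\<Union>i. box (- (real i *\<^sub>R One)) (real i *\<^sub>R One)) = (UNIV :: 'a set)"
      unfolding UN_box_eq_UNIV by auto
  qed (use eq fin in auto)
  then have "AE x in lborel. ennreal (g x) = ennreal (- g x)"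
    by (intro sigma_finite_measure.density_unique[OF sigma_finite_lborel]) auto
  then show ?thesis
  proof eventually_elim
    case (elim x)
    then show ?case
      by (cases "g x \<ge> 0") (auto simp: ennreal_neg ennreal_eq_0_iff dest: sym)
  qed
qed

text \<open>
  The fundamental lemma of the calculus of variations, obtained by approximating box indicators with
  \<^const>\<open>box_bump\<close>.
\<close>

lemma AE_eq_0_if_test_integrals_eq_0:
  fixes g :: "real ^ 'n::finite \<Rightarrow> real"
  assumes [measurable]: "g \<in> borel_measurable borel"
    and int: "\<And>K. compact K \<Longrightarrow> integrable lborel (\<lambda>x. g x * indicator K x)"
    and zero: "\<And>\<phi>. test_function \<phi> \<Longrightarrow> (LBINT x. g x * \<phi> x) = 0"
  shows "AE x in lborel. g x = 0"
proof (rule AE_eq_0_if_box_integrals_eq_0)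
  fix a b :: "real ^ 'n"
  have int': "integrable lborel (\<lambda>x. g x * indicator (cbox a b) x)" by (rule int) simp
  show i: "integrable lborel (\<lambda>x. g x * indicator (box a b) x)"
    by (rule Bochner_Integration.integrable_bound[OF int'])
       (use box_subset_cbox[of a b] in \<open>auto split: split_indicator\<close>)
  have [measurable]: "box_bump k a b \<in> borel_measurable borel" for k
    using test_function_box_bump Ck_imp_continuous_on borel_measurable_continuous_onI
    unfolding test_function_def by blast
  have "(\<lambda>k. \<integral>x. g x * box_bump k a b x \<partial>lborel) \<longlonglongrightarrow> (LBINT x. g x * indicator (box a b) x)"
  proof (rule integral_dominated_convergence[where w="\<lambda>x. \<bar>g x * indicator (box a b) x\<bar>"])
    show "AE x in lborel. (\<lambda>k. g x * box_bump k a b x) \<longlonglongrightarrow> g x * indicator (box a b) x"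
      by (intro AE_I2 tendsto_intros box_bump_tendsto)
    show "AE x in lborel. norm (g x * box_bump k a b x) \<le> \<bar>g x * indicator (box a b) x\<bar>" for k
      using box_bump_bounds[of k a b] by (intro AE_I2) (auto simp: abs_mult intro!: mult_left_mono)
  qed (use i in auto)
  moreover have "(LBINT x. g x * box_bump k a b x) = 0" for k
    by (rule zero[OF test_function_box_bump])
  ultimately show "(LBINT x. g x * indicator (box a b) x) = 0"
    by (simp add: LIMSEQ_const_iff)
qed simp


section \<open>Weak gradients along segments\<close>

lemma nn_integral_lborel_translate:
  fixes f :: "'a::euclidean_space \<Rightarrow> ennreal"
  assumes [measurable]: "f \<in> borel_measurable borel"
  shows "(\<integral>\<^sup>+x. f (x + y) \<partial>lborel) = (\<integral>\<^sup>+x. f x \<partial>lborel)"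
proof -
  have "(\<integral>\<^sup>+x. f x \<partial>lborel) = (\<integral>\<^sup>+x. f x \<partial>distr lborel borel ((+) y))"
    by (simp add: lborel_distr_plus)
  also have "\<dots> = (\<integral>\<^sup>+x. f (x + y) \<partial>lborel)"
    by (subst nn_integral_distr) (auto simp: add.commute)
  finally show ?thesis by simp
qed

lemma integrable_lborel_translate:
  fixes f :: "'a::euclidean_space \<Rightarrow> real"
  shows "integrable lborel f \<Longrightarrow> integrable lborel (\<lambda>x. f (x + y))"
  using integrable_distr[of "(+) y" lborel borel f] by (simp add: lborel_distr_plus add.commute)

lemma integral_lborel_translate:
  fixes f :: "'a::euclidean_space \<Rightarrow> real"
  assumes [measurable]: "f \<in> borel_measurable borel"
  shows "(LBINT x. f (x + y)) = (LBINT x. f x)"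
  using integral_distr[of "(+) y" lborel borel f] by (simp add: lborel_distr_plus add.commute)

text \<open>
  The uniform distribution on \<open>[0, 1]\<close>, used for averages along segments. As a density it keeps all Borel sets
  measurable, so that no restricted sigma-algebra appears in the product measures below.
\<close>

definition unit_interval :: "real measure" where
  "unit_interval = density lborel (\<lambda>t. ennreal (indicator {0..1} t))"

lemma sets_unit_interval [simp, measurable_cong]: "sets unit_interval = sets borel"
  by (simp add: unit_interval_def)

lemma prob_space_unit_interval: "prob_space unit_interval"
proof
  have "emeasure unit_interval UNIV = (\<integral>\<^sup>+t. ennreal (indicator {0..1} (t::real)) \<partial>lborel)"
    by (simp add: unit_interval_def emeasure_density)
  also have "\<dots> = 1" by (simp add: ennreal_indicator)
  finally show "emeasure unit_interval (space unit_interval) = 1"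
    by (simp add: unit_interval_def)
qed

lemma AE_unit_interval: "AE t in unit_interval. 0 \<le> t \<and> t \<le> 1"
  unfolding unit_interval_def by (subst AE_density) (auto simp: indicator_def)

interpretation unit_interval: prob_space unit_interval by (rule prob_space_unit_interval)
interpretation lborel_unit: pair_sigma_finite "lborel :: 'a::euclidean_space measure" unit_interval ..

lemma FTC_unit_interval:
  fixes F :: "real \<Rightarrow> real"
  assumes "\<And>t. (F has_real_derivative f t) (at t)" and f: "continuous_on UNIV f"
  shows "(\<integral>t. f t \<partial>unit_interval) = F 1 - F 0"
proof -
  have [measurable]: "f \<in> borel_measurable borel" by (rule borel_measurable_continuous_onI[OF f])
  have "(\<integral>t. f t \<partial>unit_interval) = (\<integral>t. indicator {0..1} t *\<^sub>R f t \<partial>lborel)"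
    unfolding unit_interval_def by (intro integral_density) auto
  also have "\<dots> = F 1 - F 0"
    using assms by (intro integral_FTC_atLeastAtMost)
      (auto simp: has_real_derivative_iff_has_vector_derivative intro: continuous_on_subset has_vector_derivative_at_within)
  finally show ?thesis .
qed

text \<open>
  How local integrability is used everywhere: against a bounded weight vanishing outside a compact set.
\<close>

lemma integrable_mult_bounded_support:
  fixes f g :: "'a \<Rightarrow> real"
  assumes "integrable M (\<lambda>x. f x * indicator K x)" and [measurable]: "f \<in> borel_measurable M" "g \<in> borel_measurable M"
    and "\<And>x. \<bar>g x\<bar> \<le> B" "\<And>x. x \<notin> K \<Longrightarrow> g x = 0"
  shows "integrable M (\<lambda>x. f x * g x)"
proof (rule Bochner_Integration.integrable_bound)
  show "integrable M (\<lambda>x. B * (f x * indicator K x))" using assms(1) by simp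
  have "0 \<le> B" using assms(4)[of undefined] by linarith
  then show "AE x in M. norm (f x * g x) \<le> norm (B * (f x * indicator K x))"
    using assms(4,5) by (intro AE_I2) (auto simp: abs_mult indicator_def mult.commute[of B] intro!: mult_left_mono)
qed simp

lemma test_function_continuous:
  assumes "test_function \<phi>"
  shows "continuous_on UNIV \<phi>" "continuous_on UNIV (partial_deriv i \<phi>)"
  using assms Ck_imp_continuous_on[of "Suc 0"] unfolding test_function_def
  by (blast, metis Ck.simps(2) Ck_imp_continuous_on)

lemma test_function_bounds:
  assumes "test_function \<phi>"
  obtains R B where "R > 0" "\<And>x. norm x > R \<Longrightarrow> \<phi> x = 0"
    "\<And>x i. norm x > R \<Longrightarrow> partial_deriv i \<phi> x = 0"
    "\<And>x. \<bar>\<phi> x\<bar> \<le> B" "\<And>x i. \<bar>partial_deriv i \<phi> x\<bar> \<le> B"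
proof -
  have c: "continuous_on UNIV \<phi>" and c': "continuous_on UNIV (partial_deriv i \<phi>)" for i
    using test_function_continuous[OF assms] by auto
  have "bounded {x. \<phi> x \<noteq> 0}"
    using assms bounded_subset[OF compact_imp_bounded closure_subset] unfolding test_function_def by blast
  then obtain R where R: "R > 0" "\<And>x. \<phi> x \<noteq> 0 \<Longrightarrow> norm x \<le> R"
    by (auto simp: bounded_pos)
  have z: "\<phi> x = 0" if "norm x > R" for x using R(2)[of x] that by force
  have z': "partial_deriv i \<phi> x = 0" if x: "norm x > R" for x i
  proof -
    have "(\<phi> has_derivative (\<lambda>_. 0)) (at x)"
    proof (rule has_derivative_transform_within_open[where s="{x. norm x > R}" and f="\<lambda>_. 0"])
      show "open {x::real^'a. norm x > R}"
        by (intro open_Collect_less continuous_intros)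
    qed (use x z in auto)
    from partial_deriv_eq[OF this] show ?thesis by simp
  qed
  have bd: "\<exists>B. \<forall>x. \<bar>f x\<bar> \<le> B" if f: "continuous_on UNIV f" and f0: "\<And>x. norm x > R \<Longrightarrow> f x = 0"
    for f :: "real ^ 'a \<Rightarrow> real"
  proof -
    have "compact (f ` cball 0 R)"
      by (intro compact_continuous_image continuous_on_subset[OF f]) auto
    then obtain B where B: "\<And>x. x \<in> cball 0 R \<Longrightarrow> \<bar>f x\<bar> \<le> B"
      using compact_imp_bounded bounded_iff by (metis imageI real_norm_def)
    have "\<bar>f x\<bar> \<le> max B 0" for x
      using B[of x] f0[of x] by (cases "norm x \<le> R") auto
    then show ?thesis by blast
  qed
  obtain B0 where B0: "\<And>x. \<bar>\<phi> x\<bar> \<le> B0" using bd[OF c z] by auto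
  have "\<forall>i. \<exists>B. \<forall>x. \<bar>partial_deriv i \<phi> x\<bar> \<le> B" using bd[OF c' z'] by blast
  then obtain B where B: "\<And>i x. \<bar>partial_deriv i \<phi> x\<bar> \<le> B i" by metis
  have "B i \<le> (\<Sum>i\<in>UNIV. \<bar>B i\<bar>)" for i
    using member_le_sum[of i UNIV "\<lambda>i. \<bar>B i\<bar>"] by force
  then have "\<bar>partial_deriv i \<phi> x\<bar> \<le> \<bar>B0\<bar> + (\<Sum>i\<in>UNIV. \<bar>B i\<bar>)" for i x
    using B[of i x] by (smt (verit))
  moreover have "\<bar>\<phi> x\<bar> \<le> \<bar>B0\<bar> + (\<Sum>i\<in>UNIV. \<bar>B i\<bar>)" for x
    using B0[of x] sum_nonneg[of UNIV "\<lambda>i. \<bar>B i\<bar>"] by (smt (verit))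
  ultimately show thesis using that[of R] R(1) z z' by blast
qed

lemma test_function_has_derivative:
  fixes \<phi> :: "real ^ 'n::finite \<Rightarrow> real"
  assumes "test_function \<phi>"
  shows "(\<phi> has_derivative (\<lambda>h. \<Sum>i\<in>UNIV. h $ i * partial_deriv i \<phi> x)) (at x)"
proof -
  have "Ck (Suc 0) \<phi>" using assms by (auto simp: test_function_def)
  then have d: "(\<phi> has_derivative frechet_derivative \<phi> (at x)) (at x)" by (rule Ck_Suc_has_derivative)
  then have lin: "linear (frechet_derivative \<phi> (at x))" by (rule has_derivative_linear)
  have "frechet_derivative \<phi> (at x) h = (\<Sum>i\<in>UNIV. h $ i * partial_deriv i \<phi> x)" for h
  proof -
    have "h = (\<Sum>i\<in>UNIV. h $ i *\<^sub>R axis i 1)"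
      using basis_expansion[of h] by (simp add: scalar_mult_eq_scaleR)
    then have "frechet_derivative \<phi> (at x) h = frechet_derivative \<phi> (at x) (\<Sum>i\<in>UNIV. h $ i *\<^sub>R axis i 1)" by simp
    then show ?thesis by (simp add: linear_sum[OF lin] linear_scale[OF lin] partial_deriv_def)
  qed
  then have "frechet_derivative \<phi> (at x) = (\<lambda>h. \<Sum>i\<in>UNIV. h $ i * partial_deriv i \<phi> x)" by blast
  with d show ?thesis by (rule back_subst)
qed

text \<open>
  By Tonelli and translation invariance, averaging along a segment costs only an enlargement of the ball by
  the length of the segment.
\<close>

lemma integrable_segment:
  fixes f :: "'a::euclidean_space \<Rightarrow> real"
  assumes [measurable]: "f \<in> borel_measurable borel"
    and int: "\<And>K. compact K \<Longrightarrow> integrable lborel (\<lambda>x. f x * indicator K x)"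
  shows "integrable (lborel \<Otimes>\<^sub>M unit_interval) (\<lambda>(x, t). f (x + t *\<^sub>R y) * indicator (cball 0 R) x)"
proof (rule integrableI_bounded)
  let ?K = "cball 0 (R + norm y) :: 'a set"
  have [measurable]: "cball 0 r \<in> sets (borel :: 'a measure)" for r by simp
  have [measurable]: "(\<lambda>z. f (fst z + snd z *\<^sub>R y) * indicator (cball 0 R) (fst z))
      \<in> borel_measurable (lborel \<Otimes>\<^sub>M unit_interval)"
    by measurable
  have "(\<integral>\<^sup>+z. ennreal (norm (case z of (x, t) \<Rightarrow> f (x + t *\<^sub>R y) * indicator (cball 0 R) x)) \<partial>(lborel \<Otimes>\<^sub>M unit_interval))
     = (\<integral>\<^sup>+t. (\<integral>\<^sup>+x. ennreal (norm (f (x + t *\<^sub>R y) * indicator (cball 0 R) x)) \<partial>lborel) \<partial>unit_interval)"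
    by (subst lborel_unit.nn_integral_snd[symmetric]) (auto simp: case_prod_beta')
  also have "\<dots> \<le> (\<integral>\<^sup>+t. (\<integral>\<^sup>+x. ennreal (norm (f x * indicator ?K x)) \<partial>lborel) \<partial>unit_interval)"
  proof (rule nn_integral_mono_AE, use AE_unit_interval in eventually_elim)
    fix t :: real assume t: "0 \<le> t \<and> t \<le> 1"
    have "(\<integral>\<^sup>+x. ennreal (norm (f (x + t *\<^sub>R y) * indicator (cball 0 R) x)) \<partial>lborel)
      \<le> (\<integral>\<^sup>+x. ennreal (norm (f (x + t *\<^sub>R y) * indicator ?K (x + t *\<^sub>R y))) \<partial>lborel)"
    proof (rule nn_integral_mono)
      fix x :: 'a
      have "norm (x + t *\<^sub>R y) \<le> R + norm y" if "norm x \<le> R"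
        using that t norm_triangle_ineq[of x "t *\<^sub>R y"] mult_left_le_one_le[of "norm y" t] by simp
      then show "ennreal (norm (f (x + t *\<^sub>R y) * indicator (cball 0 R) x))
          \<le> ennreal (norm (f (x + t *\<^sub>R y) * indicator ?K (x + t *\<^sub>R y)))"
        by (auto simp: indicator_def)
    qed
    also have "\<dots> = (\<integral>\<^sup>+x. ennreal (norm (f x * indicator ?K x)) \<partial>lborel)"
      by (rule nn_integral_lborel_translate) simp
    finally show "(\<integral>\<^sup>+x. ennreal (norm (f (x + t *\<^sub>R y) * indicator (cball 0 R) x)) \<partial>lborel)
      \<le> (\<integral>\<^sup>+x. ennreal (norm (f x * indicator ?K x)) \<partial>lborel)" .
  qed
  also have "\<dots> = (\<integral>\<^sup>+x. ennreal (norm (f x * indicator ?K x)) \<partial>lborel)"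
    by (simp add: unit_interval.emeasure_space_1)
  also have "\<dots> < \<infinity>" using int[of ?K] by (simp add: integrable_iff_bounded)
  finally show "(\<integral>\<^sup>+z. ennreal (norm (case z of (x, t) \<Rightarrow> f (x + t *\<^sub>R y) * indicator (cball 0 R) x)) \<partial>(lborel \<Otimes>\<^sub>M unit_interval)) < \<infinity>" .
  show "(\<lambda>(x, t). f (x + t *\<^sub>R y) * indicator (cball 0 R) x) \<in> borel_measurable (lborel \<Otimes>\<^sub>M unit_interval)"
    by (simp add: case_prod_beta')
qed

text \<open>
  Weak gradients of one scalar component, stated for Borel representatives and Lebesgue-Borel measure: products of
  measures and compositions such as \<open>G (x + t *\<^sub>R y)\<close> are well behaved for Borel functions only.
\<close>

definition borel_weak_gradient :: "(real ^ 'n::finite \<Rightarrow> real) \<Rightarrow> (real ^ 'n \<Rightarrow> real ^ 'n) \<Rightarrow> bool" where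
  "borel_weak_gradient u G \<longleftrightarrow>
     u \<in> borel_measurable borel \<and> G \<in> borel_measurable borel \<and>
     (\<forall>K. compact K \<longrightarrow> integrable lborel (\<lambda>x. u x * indicator K x)) \<and>
     (\<forall>K i. compact K \<longrightarrow> integrable lborel (\<lambda>x. G x $ i * indicator K x)) \<and>
     (\<forall>\<phi>. test_function \<phi> \<longrightarrow>
       (\<forall>i. (LBINT x. u x * partial_deriv i \<phi> x) = - (LBINT x. G x $ i * \<phi> x)))"

text \<open>
  The fundamental theorem of calculus along a segment, for weak gradients. It is proved by duality: after
  testing with \<open>\<phi>\<close>, the translation is moved to \<open>\<phi>\<close>, where the classical theorem applies;
  Fubini and the definition of the weak gradient (with a translate of \<open>\<phi>\<close> as test function) bring the
  result back, and the fundamental lemma removes \<open>\<phi>\<close>. Every later estimate for weak gradients starts from this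
  identity.
\<close>

lemma weak_gradient_segment:
  assumes "borel_weak_gradient u G"
  shows "AE x in lborel. integrable unit_interval (\<lambda>t. G (x + t *\<^sub>R y) \<bullet> y) \<and>
     u (x + y) - u x = (\<integral>t. G (x + t *\<^sub>R y) \<bullet> y \<partial>unit_interval)"
proof -
  have [measurable]: "u \<in> borel_measurable borel" "G \<in> borel_measurable borel"
    and intu: "\<And>K. compact K \<Longrightarrow> integrable lborel (\<lambda>x. u x * indicator K x)"
    and intG: "\<And>K i. compact K \<Longrightarrow> integrable lborel (\<lambda>x. G x $ i * indicator K x)"
    and weak: "\<And>\<phi> i. test_function \<phi> \<Longrightarrow>
       (LBINT x. u x * partial_deriv i \<phi> x) = - (LBINT x. G x $ i * \<phi> x)"
    using assms by (auto simp: borel_weak_gradient_def)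
  have [measurable]: "(\<lambda>x. G x $ i) \<in> borel_measurable borel" for i
  proof -
    have "(\<lambda>x. G x \<bullet> axis i 1) \<in> borel_measurable borel" by measurable
    then show ?thesis by (simp add: inner_axis)
  qed
  define H where "H x = G x \<bullet> y" for x
  define S where "S x = (\<integral>t. H (x + t *\<^sub>R y) \<partial>unit_interval)" for x
  have H_sum: "H x = (\<Sum>i\<in>UNIV. y $ i * G x $ i)" for x
    by (simp add: H_def inner_vec_def mult.commute)
  have [measurable]: "H \<in> borel_measurable borel" unfolding H_def[abs_def] by measurable
  have [measurable]: "S \<in> borel_measurable borel" unfolding S_def[abs_def] by measurable
  have intH: "integrable lborel (\<lambda>x. H x * indicator K x)" if "compact K" for K
    unfolding H_sum sum_distrib_right mult.assoc using intG[OF that] by simp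
  note segH = integrable_segment[OF _ intH]
  have AEint: "AE x in lborel. integrable unit_interval (\<lambda>t. H (x + t *\<^sub>R y))"
  proof -
    have "AE x in lborel. integrable unit_interval (\<lambda>t. H (x + t *\<^sub>R y) * indicator (cball 0 (real n)) x)" for n
      using lborel_unit.AE_integrable_fst[OF segH] by simp
    then have "AE x in lborel. \<forall>n. integrable unit_interval (\<lambda>t. H (x + t *\<^sub>R y) * indicator (cball 0 (real n)) x)"
      unfolding AE_all_countable by blast
    then show ?thesis
    proof eventually_elim
      case (elim x)
      obtain n where "norm x \<le> real n" using real_arch_simple by blast
      then show ?case using elim[rule_format, of n] by simp
    qed
  qed
  have intS: "integrable lborel (\<lambda>x. S x * indicator (cball 0 R) x)" for R
  proof -
    have "integrable lborel (\<lambda>x. \<integral>t. H (x + t *\<^sub>R y) * indicator (cball 0 R) x \<partial>unit_interval)"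
      using lborel_unit.integrable_fst[OF segH] by simp
    then show ?thesis by (simp add: S_def)
  qed
  have intut: "integrable lborel (\<lambda>x. u (x + y) * indicator (cball 0 R) x)" for R
  proof -
    have "integrable lborel (\<lambda>x. u x * indicator (cball y R) x)" by (rule intu) simp
    from integrable_lborel_translate[OF this, of y] show ?thesis
      by (simp add: indicator_def dist_norm)
  qed
  have "AE x in lborel. u (x + y) - u x - S x = 0"
  proof (rule AE_eq_0_if_test_integrals_eq_0)
    fix K :: "(real ^ 'a) set" assume "compact K"
    then obtain R where "\<forall>x\<in>K. norm x \<le> R"
      using compact_imp_bounded[of K] unfolding bounded_iff by blast
    then have R: "K \<subseteq> cball 0 R" by auto
    have [measurable]: "K \<in> sets borel" using \<open>compact K\<close> by (simp add: borel_compact)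
    have "integrable lborel (\<lambda>x. u (x + y) * indicator (cball 0 R) x - u x * indicator (cball 0 R) x - S x * indicator (cball 0 R) x)"
      using intut intu[of "cball 0 R"] intS by simp
    then show "integrable lborel (\<lambda>x. (u (x + y) - u x - S x) * indicator K x)"
      by (rule Bochner_Integration.integrable_bound)
         (use R in \<open>auto simp: indicator_def intro!: AE_I2\<close>)
  next
    fix \<phi> :: "real ^ 'a \<Rightarrow> real" assume t: "test_function \<phi>"
    obtain R B where RB: "R > 0" "\<And>x. norm x > R \<Longrightarrow> \<phi> x = 0"
      "\<And>x i. norm x > R \<Longrightarrow> partial_deriv i \<phi> x = 0"
      "\<And>x. \<bar>\<phi> x\<bar> \<le> B" "\<And>x i. \<bar>partial_deriv i \<phi> x\<bar> \<le> B"
      using test_function_bounds[OF t] by blast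
    have cont: "continuous_on UNIV \<phi>" "continuous_on UNIV (partial_deriv i \<phi>)" for i
      using test_function_continuous[OF t] by auto
    then have [measurable]: "\<phi> \<in> borel_measurable borel" "partial_deriv i \<phi> \<in> borel_measurable borel" for i
      by (auto intro: borel_measurable_continuous_onI)
    have "0 \<le> B" using RB(4)[of 0] by linarith
    \<comment> \<open>The support of every translate of \<open>\<phi>\<close> along the segment lies in the ball of this radius.\<close>
    let ?R' = "R + norm y"
    define D where "D x t = - (\<Sum>i\<in>UNIV. y $ i * partial_deriv i \<phi> (x - t *\<^sub>R y))" for x t
    have FTC: "\<phi> (x - y) - \<phi> x = (\<integral>t. D x t \<partial>unit_interval)" for x
    proof -
      have "((\<lambda>t. \<phi> (x - t *\<^sub>R y)) has_real_derivative D x t) (at t)" for t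
      proof -
        have "((\<lambda>t. x - t *\<^sub>R y) has_derivative (\<lambda>h. - (h *\<^sub>R y))) (at t)"
          by (auto intro!: derivative_eq_intros)
        from has_derivative_compose[OF this test_function_has_derivative[OF t]]
        show ?thesis
          unfolding has_field_derivative_def
          by (rule has_derivative_eq_rhs)
             (auto simp: fun_eq_iff D_def sum_negf[symmetric] sum_distrib_left sum_distrib_right mult_ac)
      qed
      moreover have "continuous_on UNIV (D x)"
        unfolding D_def by (intro continuous_intros continuous_on_compose2[OF cont(2)]) auto
      ultimately show ?thesis
        using FTC_unit_interval[of "\<lambda>t. \<phi> (x - t *\<^sub>R y)" "D x"] by simp
    qed
    have Dm[measurable]: "(\<lambda>(x, t). D x t) \<in> borel_measurable (lborel \<Otimes>\<^sub>M unit_interval)"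
      unfolding D_def by measurable
    have intuD: "integrable (lborel \<Otimes>\<^sub>M unit_interval) (\<lambda>(x, t). u x * D x t)"
    proof (rule Bochner_Integration.integrable_bound)
      let ?C = "\<Sum>i\<in>UNIV. \<bar>y $ i\<bar> * B"
      show "integrable (lborel \<Otimes>\<^sub>M unit_interval) (\<lambda>(x, t). ?C * (u (x + t *\<^sub>R 0) * indicator (cball 0 ?R') x))"
        using integrable_segment[of u 0 ?R'] intu by (simp add: case_prod_beta')
      have "AE z in lborel \<Otimes>\<^sub>M unit_interval. 0 \<le> snd z \<and> snd (z :: (real ^ 'a) \<times> real) \<le> 1"
      proof (rule lborel_unit.AE_pair_measure)
        show "{z \<in> space (lborel \<Otimes>\<^sub>M unit_interval). 0 \<le> snd z \<and> snd (z :: (real ^ 'a) \<times> real) \<le> 1}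
            \<in> sets (lborel \<Otimes>\<^sub>M unit_interval)" by measurable
      qed (use AE_unit_interval in auto)
      then show "AE z in lborel \<Otimes>\<^sub>M unit_interval. norm (case z of (x, t) \<Rightarrow> u x * D x t)
          \<le> norm (case z of (x, t) \<Rightarrow> ?C * (u (x + t *\<^sub>R 0) * indicator (cball 0 ?R') x))"
      proof eventually_elim
        case (elim z)
        obtain x t where z: "z = (x, t)" by fastforce
        have t: "0 \<le> t \<and> t \<le> 1" using elim z by simp
        have C: "\<bar>D x t\<bar> \<le> ?C"
          unfolding D_def abs_minus_cancel
          by (rule order_trans[OF sum_abs]) (auto simp: abs_mult intro!: sum_mono mult_left_mono RB)
        have z0: "D x t = 0" if "norm x > ?R'"
        proof -
          have "norm x \<le> norm (x - t *\<^sub>R y) + norm (t *\<^sub>R y)"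
            using norm_triangle_ineq[of "x - t *\<^sub>R y" "t *\<^sub>R y"] by simp
          then have "norm (x - t *\<^sub>R y) > R"
            using that t mult_left_le_one_le[of "norm y" t] by simp
          then show ?thesis using RB(3) by (simp add: D_def)
        qed
        have "norm (u x * D x t) \<le> norm (?C * (u x * indicator (cball 0 ?R') x))"
        proof (cases "norm x \<le> ?R'")
          case True
          then show ?thesis using C mult_right_mono[of "\<bar>D x t\<bar>" "\<bar>?C\<bar>" "\<bar>u x\<bar>"]
            by (auto simp: abs_mult mult.commute)
        qed (use z0 in auto)
        then show ?case by (simp add: z)
      qed
    qed simp
    have intHphi: "integrable (lborel \<Otimes>\<^sub>M unit_interval) (\<lambda>(x, t). H (x + t *\<^sub>R y) * \<phi> x)"
    proof (rule Bochner_Integration.integrable_bound)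
      show "integrable (lborel \<Otimes>\<^sub>M unit_interval) (\<lambda>(x, t). B * (H (x + t *\<^sub>R y) * indicator (cball 0 R) x))"
        using segH[of y R] by (simp add: case_prod_beta')
      show "AE z in lborel \<Otimes>\<^sub>M unit_interval. norm (case z of (x, t) \<Rightarrow> H (x + t *\<^sub>R y) * \<phi> x)
          \<le> norm (case z of (x, t) \<Rightarrow> B * (H (x + t *\<^sub>R y) * indicator (cball 0 R) x))"
      proof (rule AE_I2, clarify)
        fix x :: "real ^ 'a" and t :: real
        show "norm (H (x + t *\<^sub>R y) * \<phi> x) \<le> norm (B * (H (x + t *\<^sub>R y) * indicator (cball 0 R) x))"
          using RB(2)[of x] RB(4)[of x] \<open>0 \<le> B\<close> mult_right_mono[of "\<bar>\<phi> x\<bar>" B "\<bar>H (x + t *\<^sub>R y)\<bar>"]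
          by (cases "norm x \<le> R") (auto simp: abs_mult mult.commute)
      qed
    qed simp
    have i1: "integrable lborel (\<lambda>x. u (x + y) * \<phi> x)"
      by (rule integrable_mult_bounded_support[where K="cball 0 R", OF intut]) (use RB in auto)
    have i2: "integrable lborel (\<lambda>x. u x * \<phi> x)"
      by (rule integrable_mult_bounded_support[where K="cball 0 R", OF intu]) (use RB in auto)
    have i3: "integrable lborel (\<lambda>x. S x * \<phi> x)"
      by (rule integrable_mult_bounded_support[where K="cball 0 R", OF intS]) (use RB in auto)
    have i4: "integrable lborel (\<lambda>x. u x * \<phi> (x - y))"
      using integrable_lborel_translate[OF i1, of "-y"] by simp
    have slice: "(LBINT x. u x * D x t) = (LBINT x. H (x + t *\<^sub>R y) * \<phi> x)" for t
    proof -
      let ?\<psi> = "\<lambda>x. \<phi> (x + (- t *\<^sub>R y))"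
      let ?R'' = "R + norm (t *\<^sub>R y)"
      have \<psi>: "test_function ?\<psi>" "\<And>i. partial_deriv i ?\<psi> = (\<lambda>x. partial_deriv i \<phi> (x + (- t *\<^sub>R y)))"
        by (rule test_function_translate[OF t], rule partial_deriv_translate[OF t])
      have z: "norm (x - t *\<^sub>R y) > R" if "norm x > ?R''" for x
        using norm_triangle_ineq[of "x - t *\<^sub>R y" "t *\<^sub>R y"] that by simp
      have j1: "integrable lborel (\<lambda>x. u x * partial_deriv i \<phi> (x - t *\<^sub>R y))" for i
        by (rule integrable_mult_bounded_support[where K="cball 0 ?R''", OF intu]) (use RB z in auto)
      have j2: "integrable lborel (\<lambda>x. G x $ i * \<phi> (x - t *\<^sub>R y))" for i
        by (rule integrable_mult_bounded_support[where K="cball 0 ?R''", OF intG]) (use RB z in auto)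
      have "(LBINT x. u x * D x t) = (LBINT x. (\<Sum>i\<in>UNIV. - y $ i * (u x * partial_deriv i \<phi> (x - t *\<^sub>R y))))"
        by (simp add: D_def sum_distrib_left sum_negf[symmetric] mult_ac)
      also have "\<dots> = (\<Sum>i\<in>UNIV. - y $ i * (LBINT x. u x * partial_deriv i \<phi> (x - t *\<^sub>R y)))"
        using j1 by (subst Bochner_Integration.integral_sum) auto
      also have "\<dots> = (\<Sum>i\<in>UNIV. y $ i * (LBINT x. G x $ i * \<phi> (x - t *\<^sub>R y)))"
        using weak[OF \<psi>(1)] unfolding \<psi>(2) by simp
      also have "\<dots> = (LBINT x. (\<Sum>i\<in>UNIV. y $ i * (G x $ i * \<phi> (x - t *\<^sub>R y))))"
        using j2 by (subst Bochner_Integration.integral_sum) auto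
      also have "\<dots> = (LBINT x. H x * \<phi> (x - t *\<^sub>R y))"
        by (simp add: H_sum sum_distrib_right mult.assoc)
      also have "\<dots> = (LBINT x. H (x + t *\<^sub>R y) * \<phi> (x + t *\<^sub>R y - t *\<^sub>R y))"
        by (rule integral_lborel_translate[symmetric]) simp
      finally show ?thesis by simp
    qed
    have "(LBINT x. u (x + y) * \<phi> x) = (LBINT x. u x * \<phi> (x - y))"
      using integral_lborel_translate[of "\<lambda>x. u x * \<phi> (x - y)" y] by simp
    then have "(LBINT x. u (x + y) * \<phi> x) - (LBINT x. u x * \<phi> x)
        = (LBINT x. u x * (\<phi> (x - y) - \<phi> x))"
      using i4 i2 by (simp add: right_diff_distrib)
    also have "\<dots> = (\<integral>x. (\<integral>t. u x * D x t \<partial>unit_interval) \<partial>lborel)"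
      by (simp add: FTC)
    also have "\<dots> = (\<integral>t. (LBINT x. u x * D x t) \<partial>unit_interval)"
      using lborel_unit.Fubini_integral[OF intuD] by simp
    also have "\<dots> = (\<integral>t. (LBINT x. H (x + t *\<^sub>R y) * \<phi> x) \<partial>unit_interval)"
      by (simp add: slice)
    also have "\<dots> = (\<integral>x. (\<integral>t. H (x + t *\<^sub>R y) * \<phi> x \<partial>unit_interval) \<partial>lborel)"
      using lborel_unit.Fubini_integral[OF intHphi] by simp
    also have "\<dots> = (LBINT x. S x * \<phi> x)"
      by (simp add: S_def)
    finally show "(LBINT x. (u (x + y) - u x - S x) * \<phi> x) = 0"
      using i1 i2 i3 by (simp add: left_diff_distrib)
  qed simp
  with AEint show ?thesis
    by eventually_elim (simp add: S_def H_def)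
qed


section \<open>Square integrals\<close>

lemma cball_borel [measurable]: "cball a r \<in> sets (borel :: 'a::euclidean_space measure)"
  by simp

lemma ennreal_double_add:
  "0 \<le> a \<Longrightarrow> 0 \<le> b \<Longrightarrow> 2 * ennreal a + 2 * ennreal b = ennreal (2 * a + 2 * b)"
  by (simp add: ennreal_mult)

text \<open>
  Squared \<open>L\<^sup>2\<close> norms are kept as extended nonnegative integrals, so that estimates can be chained before
  finiteness is known.
\<close>

definition L2sq :: "('a::euclidean_space \<Rightarrow> 'b::euclidean_space) \<Rightarrow> ennreal" where
  "L2sq f = (\<integral>\<^sup>+x. ennreal ((norm (f x))\<^sup>2) \<partial>lborel)"

lemma L2sq_mono: "(\<And>x. norm (f x) \<le> norm (g x)) \<Longrightarrow> L2sq f \<le> L2sq g"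
  unfolding L2sq_def by (intro nn_integral_mono ennreal_leI power_mono) auto

lemma L2sq_cmult_mono:
  assumes [measurable]: "g \<in> borel_measurable borel" and "\<And>x. norm (f x) \<le> c * norm (g x)" "0 \<le> c"
  shows "L2sq f \<le> ennreal (c\<^sup>2) * L2sq g"
proof -
  have "L2sq f \<le> (\<integral>\<^sup>+x. ennreal (c\<^sup>2) * ennreal ((norm (g x))\<^sup>2) \<partial>lborel)"
    unfolding L2sq_def
    using assms power_mono[OF assms(2), of _ 2]
    by (intro nn_integral_mono) (auto simp: ennreal_mult[symmetric] power_mult_distrib)
  then show ?thesis unfolding L2sq_def by (simp add: nn_integral_cmult)
qed

text \<open>
  The weighted form of $(a+b)^2 \le 2a^2+2b^2$, with a constant as close to \<open>1\<close> as desired on one side; it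
  replaces Minkowski's inequality.
\<close>

lemma norm_add_square_le:
  fixes a b :: "'a::real_normed_vector"
  assumes "\<delta> > 0"
  shows "(norm (a + b))\<^sup>2 \<le> (1 + \<delta>) * (norm a)\<^sup>2 + (1 + 1 / \<delta>) * (norm b)\<^sup>2"
proof -
  let ?a = "norm a" and ?b = "norm b"
  have "0 \<le> (\<delta> * ?a - ?b)\<^sup>2 / \<delta>" using assms by simp
  also have "(\<delta> * ?a - ?b)\<^sup>2 / \<delta> = \<delta> * ?a\<^sup>2 + ?b\<^sup>2 / \<delta> - 2 * ?a * ?b"
    using assms by (simp add: power2_eq_square field_simps)
  finally have "(?a + ?b)\<^sup>2 \<le> (1 + \<delta>) * ?a\<^sup>2 + (1 + 1 / \<delta>) * ?b\<^sup>2"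
    by (simp add: power2_eq_square algebra_simps)
  moreover have "(norm (a + b))\<^sup>2 \<le> (?a + ?b)\<^sup>2"
    by (intro power_mono norm_triangle_ineq) simp
  ultimately show ?thesis by linarith
qed

lemma L2sq_add_le:
  assumes [measurable]: "f \<in> borel_measurable borel" "g \<in> borel_measurable borel" and "\<delta> > 0"
  shows "L2sq (\<lambda>x. f x + g x) \<le> ennreal (1 + \<delta>) * L2sq f + ennreal (1 + 1 / \<delta>) * L2sq g"
proof -
  have "L2sq (\<lambda>x. f x + g x) \<le> (\<integral>\<^sup>+x. ennreal (1 + \<delta>) * ennreal ((norm (f x))\<^sup>2)
      + ennreal (1 + 1 / \<delta>) * ennreal ((norm (g x))\<^sup>2) \<partial>lborel)"
    unfolding L2sq_def using norm_add_square_le[OF \<open>\<delta> > 0\<close>] \<open>\<delta> > 0\<close>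
    by (intro nn_integral_mono) (auto simp: ennreal_mult[symmetric] ennreal_plus[symmetric] simp del: ennreal_plus)
  then show ?thesis
    unfolding L2sq_def by (simp add: nn_integral_add nn_integral_cmult)
qed

lemma L2sq_add_le2:
  assumes "f \<in> borel_measurable borel" "g \<in> borel_measurable borel"
  shows "L2sq (\<lambda>x. f x + g x) \<le> 2 * L2sq f + 2 * L2sq g"
  using L2sq_add_le[OF assms, of 1] by simp

lemma L2sq_minus: "L2sq (\<lambda>x. - f x) = L2sq f"
  by (simp add: L2sq_def)

lemma L2sq_minus_commute: "L2sq (\<lambda>x. f x - g x) = L2sq (\<lambda>x. g x - f x)"
  by (simp add: L2sq_def norm_minus_commute)

lemma L2sq_translate:
  assumes [measurable]: "f \<in> borel_measurable borel"
  shows "L2sq (\<lambda>x. f (x + y)) = L2sq f"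
  unfolding L2sq_def by (rule nn_integral_lborel_translate) simp

lemma L2sq_dominated_convergence:
  fixes f :: "nat \<Rightarrow> 'a::euclidean_space \<Rightarrow> 'b::euclidean_space"
  assumes [measurable]: "\<And>k. f k \<in> borel_measurable borel" "g \<in> borel_measurable borel"
    "w \<in> borel_measurable borel"
    and lim: "AE x in lborel. (\<lambda>k. f k x) \<longlonglongrightarrow> g x"
    and bound: "\<And>k x. norm (f k x - g x) \<le> norm (w x)"
    and fin: "L2sq w < \<infinity>"
  shows "(\<lambda>k. L2sq (\<lambda>x. f k x - g x)) \<longlonglongrightarrow> 0"
proof -
  have "(\<lambda>k. \<integral>\<^sup>+x. ennreal ((norm (f k x - g x))\<^sup>2) \<partial>lborel) \<longlonglongrightarrow> (\<integral>\<^sup>+x. 0 \<partial>(lborel :: 'a measure))"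
  proof (rule nn_integral_dominated_convergence[where w="\<lambda>x. ennreal ((norm (w x))\<^sup>2)"])
    show "AE x in lborel. (\<lambda>k. ennreal ((norm (f k x - g x))\<^sup>2)) \<longlonglongrightarrow> 0"
      using lim
    proof eventually_elim
      case (elim x)
      then have "(\<lambda>k. (norm (f k x - g x))\<^sup>2) \<longlonglongrightarrow> (norm (g x - g x))\<^sup>2"
        by (intro tendsto_intros)
      then have "(\<lambda>k. ennreal ((norm (f k x - g x))\<^sup>2)) \<longlonglongrightarrow> ennreal ((norm (g x - g x))\<^sup>2)"
        by (rule tendsto_ennrealI)
      then show ?case by simp
    qed
    show "AE x in lborel. ennreal ((norm (f k x - g x))\<^sup>2) \<le> ennreal ((norm (w x))\<^sup>2)" for k
      using bound by (intro AE_I2 ennreal_leI power_mono) auto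
  qed (use fin in \<open>auto simp: L2sq_def\<close>)
  then show ?thesis by (simp add: L2sq_def)
qed

lemma L2sq_indicator_cball: "L2sq (\<lambda>x::'a::euclidean_space. c * indicator (cball 0 r) x :: real) < \<infinity>"
proof -
  have "L2sq (\<lambda>x::'a. c * indicator (cball 0 r) x) = (\<integral>\<^sup>+x. ennreal (c\<^sup>2) * indicator (cball 0 r) (x::'a) \<partial>lborel)"
    unfolding L2sq_def by (intro nn_integral_cong) (auto simp: indicator_def)
  also have "\<dots> < \<infinity>"
    using emeasure_lborel_cball_finite[of "0::'a" r]
    by (subst nn_integral_cmult_indicator) (auto simp: ennreal_mult_less_top)
  finally show ?thesis .
qed

text \<open>
  Density of continuous functions of bounded support. A measurable function is an almost everywhere limit of
  continuous ones; projecting the values to a ball and cutting off in space turns this into dominated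
  convergence.
\<close>

lemma L2sq_approx_continuous:
  fixes G :: "'a::euclidean_space \<Rightarrow> 'b::euclidean_space"
  assumes [measurable]: "G \<in> borel_measurable borel" and fin: "L2sq G < \<infinity>" and "(e::real) > 0"
  obtains g R B where "continuous_on UNIV g" "\<And>x. norm x > R \<Longrightarrow> g x = 0" "\<And>x. norm (g x) \<le> B"
    "L2sq (\<lambda>x. G x - g x) \<le> ennreal e"
proof -
  have "G measurable_on UNIV"
    by (rule lebesgue_measurable_imp_measurable_on) (auto intro: measurable_completion)
  then obtain N :: "'a set" and g where N: "negligible N" and gc: "\<And>n. continuous_on UNIV (g n)"
    and gl: "\<And>x. x \<notin> N \<Longrightarrow> (\<lambda>n. g n x :: 'b) \<longlonglongrightarrow> G x"
    unfolding measurable_on_def by auto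
  then have AEl: "AE x in lborel. (\<lambda>n. g n x) \<longlonglongrightarrow> G x"
  proof -
    have "N \<in> null_sets lebesgue" using N negligible_iff_null_sets by blast
    then have "AE x in lebesgue. (\<lambda>n. g n x) \<longlonglongrightarrow> G x"
      using gl by (intro AE_I'[of N]) auto
    then show ?thesis by (simp add: AE_completion_iff)
  qed
  define c :: "nat \<Rightarrow> 'b \<Rightarrow> 'b" where "c m = closest_point (cball 0 (real m))" for m
  define cut :: "nat \<Rightarrow> 'a \<Rightarrow> real" where "cut m x = max 0 (min 1 (real m + 1 - norm x))" for m x
  have c_cont: "continuous_on UNIV (c m)" for m
    unfolding c_def by (intro continuous_on_closest_point) auto
  have c_norm: "norm (c m y) \<le> real m" for m y
    using closest_point_in_set[of "cball 0 (real m)" y] by (auto simp: c_def)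
  have c_self: "c m y = y" if "norm y \<le> real m" for m y
    using that by (simp add: c_def closest_point_self)
  have c_le: "norm (c m y) \<le> norm y" for m y
    using closest_point_lipschitz[of "cball 0 (real m)" y 0] c_self[of 0 m] by (simp add: c_def)
  have cut: "0 \<le> cut m x" "cut m x \<le> 1" "norm x > real m + 1 \<Longrightarrow> cut m x = 0" "norm x \<le> real m \<Longrightarrow> cut m x = 1" for m x
    by (auto simp: cut_def)
  have cut_cont: "continuous_on UNIV (cut m)" for m
    unfolding cut_def by (intro continuous_intros)
  have [measurable]: "c m \<in> borel_measurable borel" "cut m \<in> borel_measurable borel" "g n \<in> borel_measurable borel" for m n
    using c_cont cut_cont gc by (auto intro: borel_measurable_continuous_onI)
  let ?a = "\<lambda>m x. cut m x *\<^sub>R c m (G x)" and ?b = "\<lambda>m n x. cut m x *\<^sub>R c m (g n x)"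
  have "(\<lambda>m. L2sq (\<lambda>x. ?a m x - G x)) \<longlonglongrightarrow> 0"
  proof (rule L2sq_dominated_convergence[where w="\<lambda>x. 2 *\<^sub>R G x"])
    show "AE x in lborel. (\<lambda>m. ?a m x) \<longlonglongrightarrow> G x"
    proof (rule AE_I2, rule tendsto_eventually)
      fix x
      obtain M where "max (norm x) (norm (G x)) \<le> real M" using real_arch_simple by blast
      then show "\<forall>\<^sub>F m in sequentially. ?a m x = G x"
        by (intro eventually_sequentiallyI[of M]) (auto simp: c_self cut)
    qed
    show "norm (?a m x - G x) \<le> norm (2 *\<^sub>R G x)" for m x
      using norm_triangle_ineq4[of "?a m x" "G x"] mult_mono[OF cut(2)[of m x] c_le[of m "G x"]] cut(1)[of m x]
      by simp
    have "L2sq (\<lambda>x. 2 *\<^sub>R G x) \<le> ennreal (2\<^sup>2) * L2sq G"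
      by (rule L2sq_cmult_mono) auto
    also have "\<dots> < \<infinity>" using fin by (simp add: ennreal_mult_less_top)
    finally show "L2sq (\<lambda>x. 2 *\<^sub>R G x) < \<infinity>" .
  qed auto
  moreover have e4: "ennreal (e / 4) > 0" using \<open>e > 0\<close> by simp
  ultimately have "\<forall>\<^sub>F m in sequentially. L2sq (\<lambda>x. ?a m x - G x) < ennreal (e / 4)"
    by (rule order_tendstoD)
  then obtain m where m: "L2sq (\<lambda>x. ?a m x - G x) < ennreal (e / 4)"
    by (meson eventually_happens' sequentially_bot)
  have "(\<lambda>n. L2sq (\<lambda>x. ?b m n x - ?a m x)) \<longlonglongrightarrow> 0"
  proof (rule L2sq_dominated_convergence[where w="\<lambda>x. (2 * real m) * indicator (cball 0 (real m + 1)) x"])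
    show "AE x in lborel. (\<lambda>n. ?b m n x) \<longlonglongrightarrow> ?a m x"
      using AEl
    proof eventually_elim
      case (elim x)
      have "isCont (c m) (G x)" using c_cont continuous_on_eq_continuous_at by blast
      then have "(\<lambda>n. c m (g n x)) \<longlonglongrightarrow> c m (G x)" using elim by (rule isCont_tendsto_compose)
      then show ?case by (intro tendsto_intros)
    qed
    show "norm (?b m n x - ?a m x) \<le> norm ((2 * real m) * indicator (cball 0 (real m + 1)) x)" for n x
    proof (cases "norm x \<le> real m + 1")
      case True
      have "norm (?b m n x - ?a m x) = cut m x * norm (c m (g n x) - c m (G x))"
        using cut(1)[of m x] by (simp flip: scaleR_diff_right)
      also have "\<dots> \<le> 1 * (real m + real m)"
        using cut(1)[of m x] cut(2)[of m x] c_norm[of m "g n x"] c_norm[of m "G x"] norm_triangle_ineq4[of "c m (g n x)" "c m (G x)"]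
        by (intro mult_mono) (auto intro: order_trans add_mono)
      finally show ?thesis using True by simp
    qed (auto simp: cut(3))
    show "L2sq (\<lambda>x::'a. (2 * real m) * indicator (cball 0 (real m + 1)) x) < \<infinity>" by (rule L2sq_indicator_cball)
  qed auto
  from order_tendstoD(2)[OF this e4]
  obtain n where n: "L2sq (\<lambda>x. ?b m n x - ?a m x) < ennreal (e / 4)"
    by (meson eventually_happens' sequentially_bot)
  show thesis
  proof (rule that[of "?b m n" "real m + 1" "real m"])
    show "continuous_on UNIV (?b m n)"
      by (intro continuous_intros cut_cont continuous_on_compose2[OF c_cont gc]) auto
    show "?b m n x = 0" if "norm x > real m + 1" for x using cut(3)[OF that] by simp
    show "norm (?b m n x) \<le> real m" for x
      using mult_mono[OF cut(2)[of m x] c_norm[of m "g n x"]] cut(1)[of m x] by simp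
    have "L2sq (\<lambda>x. G x - ?b m n x) = L2sq (\<lambda>x. (?b m n x - ?a m x) + (?a m x - G x))"
      by (subst L2sq_minus_commute) simp
    also have "\<dots> \<le> 2 * L2sq (\<lambda>x. ?b m n x - ?a m x) + 2 * L2sq (\<lambda>x. ?a m x - G x)"
      by (rule L2sq_add_le2) auto
    also have "\<dots> \<le> 2 * ennreal (e / 4) + 2 * ennreal (e / 4)"
      using m n by (intro add_mono mult_left_mono) auto
    also have "\<dots> = ennreal (2 * (e / 4) + 2 * (e / 4))"
      using \<open>e > 0\<close> by (intro ennreal_double_add) auto
    also have "2 * (e / 4) + 2 * (e / 4) = e" by simp
    finally show "L2sq (\<lambda>x. G x - ?b m n x) \<le> ennreal e" .
  qed
qed

lemma L2sq_translation_continuous: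
  fixes G :: "'a::euclidean_space \<Rightarrow> 'b::euclidean_space"
  assumes [measurable]: "G \<in> borel_measurable borel" and fin: "L2sq G < \<infinity>" and y: "y \<longlonglongrightarrow> (0::'a)"
  shows "(\<lambda>k. L2sq (\<lambda>x. G (x + y k) - G x)) \<longlonglongrightarrow> 0"
proof (rule order_tendstoI)
  fix e' :: ennreal assume "0 < e'"
  then obtain z where z: "0 < z" "z < e'" using dense by blast
  then obtain e where ze: "z = ennreal e" "e > 0" by (cases z) auto
  have e10: "e / 10 > 0" using ze by simp
  then have e10': "ennreal (e / 10) > 0" by simp
  obtain g R B where g: "continuous_on UNIV g" "\<And>x. norm x > R \<Longrightarrow> g x = 0" "\<And>x. norm (g x) \<le> B"
    and gG: "L2sq (\<lambda>x. G x - g x) \<le> ennreal (e / 10)"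
    using L2sq_approx_continuous[OF assms(1) fin e10] by metis
  have [measurable]: "g \<in> borel_measurable borel" using g(1) by (rule borel_measurable_continuous_onI)
  obtain Y where Y: "\<And>k. norm (y k) \<le> Y"
    using convergent_imp_bounded[OF y] by (auto simp: bounded_iff)
  have "B \<ge> 0" using g(3)[of 0] norm_ge_zero order_trans by blast
  have "(\<lambda>k. L2sq (\<lambda>x. g (x + y k) - g x)) \<longlonglongrightarrow> 0"
  proof (rule L2sq_dominated_convergence[where w="\<lambda>x. (2 * B) * indicator (cball 0 (R + Y)) x"])
    show "AE x in lborel. (\<lambda>k. g (x + y k)) \<longlonglongrightarrow> g x"
    proof (rule AE_I2)
      fix x
      have "(\<lambda>k. x + y k) \<longlonglongrightarrow> x" using tendsto_add[OF tendsto_const y, of x] by simp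
      moreover have "isCont g x" using g(1) continuous_on_eq_continuous_at by blast
      ultimately show "(\<lambda>k. g (x + y k)) \<longlonglongrightarrow> g x" using isCont_tendsto_compose by blast
    qed
    show "norm (g (x + y k) - g x) \<le> norm ((2 * B) * indicator (cball 0 (R + Y)) x)" for k x
    proof (cases "norm x \<le> R + Y")
      case True
      then show ?thesis using norm_triangle_ineq4[of "g (x + y k)" "g x"] g(3)[of x] g(3)[of "x + y k"] by simp
    next
      case False
      moreover have "0 \<le> Y" using Y[of 0] norm_ge_zero order_trans by blast
      moreover have "norm (x + y k) \<ge> norm x - norm (y k)" using norm_triangle_ineq2[of x "- y k"] by simp
      ultimately have "norm x > R" "norm (x + y k) > R" using Y[of k] by linarith+
      then show ?thesis using g(2) by simp
    qed
    show "L2sq (\<lambda>x::'a. (2 * B) * indicator (cball 0 (R + Y)) x) < \<infinity>" by (rule L2sq_indicator_cball)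
  qed auto
  from order_tendstoD(2)[OF this e10']
  show "\<forall>\<^sub>F k in sequentially. L2sq (\<lambda>x. G (x + y k) - G x) < e'"
  proof eventually_elim
    case (elim k)
    let ?d = "\<lambda>x. G x - g x"
    have "L2sq (\<lambda>x. G (x + y k) - G x) = L2sq (\<lambda>x. (?d (x + y k) + (g (x + y k) - g x)) + - ?d x)"
      by simp
    also have "\<dots> \<le> 2 * L2sq (\<lambda>x. ?d (x + y k) + (g (x + y k) - g x)) + 2 * L2sq (\<lambda>x. - ?d x)"
      by (rule L2sq_add_le2) auto
    also have "\<dots> \<le> 2 * (2 * L2sq (\<lambda>x. ?d (x + y k)) + 2 * L2sq (\<lambda>x. g (x + y k) - g x)) + 2 * L2sq (\<lambda>x. - ?d x)"
      by (intro add_right_mono mult_left_mono L2sq_add_le2) auto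
    also have "\<dots> = 2 * (2 * L2sq ?d + 2 * L2sq (\<lambda>x. g (x + y k) - g x)) + 2 * L2sq ?d"
      unfolding L2sq_minus by (subst L2sq_translate[of ?d]) auto
    also have "\<dots> \<le> 2 * (2 * ennreal (e / 10) + 2 * ennreal (e / 10)) + 2 * ennreal (e / 10)"
      using gG elim by (intro add_mono mult_left_mono) auto
    also have "\<dots> = ennreal (2 * (2 * (e / 10) + 2 * (e / 10)) + 2 * (e / 10))"
      using ze(2) by (subst ennreal_double_add, simp, simp, subst ennreal_double_add) auto
    also have "2 * (2 * (e / 10) + 2 * (e / 10)) + 2 * (e / 10) = e" by simp
    also have "ennreal e < e'" using z ze by simp
    finally show ?case .
  qed
qed auto

lemma L2sq_linear_finite:
  assumes "linear A" and [measurable]: "g \<in> borel_measurable borel" and "L2sq g < \<infinity>"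
  shows "L2sq (\<lambda>x. A (g x)) < \<infinity>"
proof -
  obtain B where "B > 0" "\<And>x. norm (A x) \<le> B * norm x" using linear_bounded_pos[OF \<open>linear A\<close>] by blast
  then have "L2sq (\<lambda>x. A (g x)) \<le> ennreal (B\<^sup>2) * L2sq g"
    by (intro L2sq_cmult_mono) auto
  also have "\<dots> < \<infinity>" using assms(3) by (simp add: ennreal_mult_less_top)
  finally show ?thesis .
qed

text \<open>
  The inequality $c \|g\|^2 \le \|A g\|^2$ survives \<open>L\<^sup>2\<close> limits. The rank-one
  bound for gradients is transported along three such limits.
\<close>

lemma L2sq_lower_bound_closed:
  fixes g :: "'a::euclidean_space \<Rightarrow> 'b::euclidean_space" and A :: "'b \<Rightarrow> 'c::euclidean_space"
  assumes A: "linear A" and [measurable]: "\<And>k. f k \<in> borel_measurable borel" "g \<in> borel_measurable borel"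
    and fin: "L2sq g < \<infinity>" and c: "0 \<le> c"
    and le: "\<And>k. ennreal c * L2sq (f k) \<le> L2sq (\<lambda>x. A (f k x))"
    and lim: "(\<lambda>k. L2sq (\<lambda>x. f k x - g x)) \<longlonglongrightarrow> 0"
  shows "ennreal c * L2sq g \<le> L2sq (\<lambda>x. A (g x))"
proof -
  obtain B where B: "B > 0" "\<And>x. norm (A x) \<le> B * norm x" using linear_bounded_pos[OF A] by blast
  have [measurable]: "A \<in> borel_measurable borel"
    using A by (intro borel_measurable_continuous_onI linear_continuous_on) (simp add: linear_conv_bounded_linear)
  have main: "ennreal c * L2sq g \<le> ennreal ((1 + \<delta>)\<^sup>2) * L2sq (\<lambda>x. A (g x))" if \<delta>: "\<delta> > 0" for \<delta> :: real
  proof (rule LIMSEQ_le_const)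
    let ?d = "\<lambda>k. L2sq (\<lambda>x. f k x - g x)"
    let ?K = "(1 + \<delta>) * (1 + 1 / \<delta>) * B\<^sup>2 + c * (1 + 1 / \<delta>)"
    have "(\<lambda>k. ennreal ((1 + \<delta>)\<^sup>2) * L2sq (\<lambda>x. A (g x)) + ennreal ?K * ?d k)
        \<longlonglongrightarrow> ennreal ((1 + \<delta>)\<^sup>2) * L2sq (\<lambda>x. A (g x)) + ennreal ?K * 0"
      by (intro tendsto_add tendsto_const ennreal_tendsto_cmult lim) auto
    then show "(\<lambda>k. ennreal ((1 + \<delta>)\<^sup>2) * L2sq (\<lambda>x. A (g x)) + ennreal ?K * ?d k)
        \<longlonglongrightarrow> ennreal ((1 + \<delta>)\<^sup>2) * L2sq (\<lambda>x. A (g x))" by simp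
    have "ennreal c * L2sq g \<le> ennreal ((1 + \<delta>)\<^sup>2) * L2sq (\<lambda>x. A (g x)) + ennreal ?K * ?d k" for k
    proof -
      let ?e1 = "ennreal (1 + \<delta>)" and ?e2 = "ennreal (1 + 1 / \<delta>)"
      have K: "ennreal ?K = ?e1 * ?e2 * ennreal (B\<^sup>2) + ennreal c * ?e2"
      proof -
        have "ennreal ?K = ennreal ((1 + \<delta>) * (1 + 1 / \<delta>) * B\<^sup>2) + ennreal (c * (1 + 1 / \<delta>))"
          using \<delta> c by (intro ennreal_plus) auto
        also have "\<dots> = ?e1 * ?e2 * ennreal (B\<^sup>2) + ennreal c * ?e2"
          using \<delta> c ennreal_mult[of "(1 + \<delta>) * (1 + 1 / \<delta>)" "B\<^sup>2"]
            ennreal_mult[of "1 + \<delta>" "1 + 1 / \<delta>"] ennreal_mult[of c "1 + 1 / \<delta>"]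
          by (auto simp del: ennreal_plus)
        finally show ?thesis .
      qed
      have e1sq: "ennreal ((1 + \<delta>)\<^sup>2) = ?e1 * ?e1"
        unfolding power2_eq_square using \<delta> by (intro ennreal_mult) auto
      have "L2sq g = L2sq (\<lambda>x. f k x + (g x - f k x))" by simp
      also have "\<dots> \<le> ?e1 * L2sq (f k) + ?e2 * L2sq (\<lambda>x. g x - f k x)"
        by (rule L2sq_add_le) (use \<delta> in auto)
      finally have "ennreal c * L2sq g \<le> ennreal c * (?e1 * L2sq (f k) + ?e2 * ?d k)"
        unfolding L2sq_minus_commute[of g] by (rule mult_left_mono) simp
      also have "\<dots> = ?e1 * (ennreal c * L2sq (f k)) + ennreal c * (?e2 * ?d k)"
        by (simp add: distrib_left mult_ac)
      also have "\<dots> \<le> ?e1 * L2sq (\<lambda>x. A (f k x)) + ennreal c * (?e2 * ?d k)"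
        by (intro add_right_mono mult_left_mono le) auto
      also have "L2sq (\<lambda>x. A (f k x)) = L2sq (\<lambda>x. A (g x) + A (f k x - g x))"
        by (simp add: linear_diff[OF A])
      also have "\<dots> \<le> ?e1 * L2sq (\<lambda>x. A (g x)) + ?e2 * L2sq (\<lambda>x. A (f k x - g x))"
        by (rule L2sq_add_le) (use \<delta> in auto)
      also have "L2sq (\<lambda>x. A (f k x - g x)) \<le> ennreal (B\<^sup>2) * ?d k"
        by (rule L2sq_cmult_mono) (use B in auto)
      finally have "ennreal c * L2sq g \<le> ?e1 * (?e1 * L2sq (\<lambda>x. A (g x)) + ?e2 * (ennreal (B\<^sup>2) * ?d k)) + ennreal c * (?e2 * ?d k)"
        by (simp add: mult_left_mono add_right_mono)
      also have "\<dots> = ennreal ((1 + \<delta>)\<^sup>2) * L2sq (\<lambda>x. A (g x)) + ennreal ?K * ?d k"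
        unfolding K e1sq by (simp only: distrib_left distrib_right mult_ac add_ac)
      finally show ?thesis .
    qed
    then show "\<exists>N. \<forall>k\<ge>N. ennreal c * L2sq g \<le> ennreal ((1 + \<delta>)\<^sup>2) * L2sq (\<lambda>x. A (g x)) + ennreal ?K * ?d k"
      by blast
  qed
  have Afin: "L2sq (\<lambda>x. A (g x)) < \<infinity>" by (rule L2sq_linear_finite[OF A _ fin]) simp
  show ?thesis
  proof (rule LIMSEQ_le_const)
    have "(\<lambda>k. ennreal ((1 + inverse (real (Suc k)))\<^sup>2)) \<longlonglongrightarrow> ennreal ((1 + 0)\<^sup>2)"
      by (intro tendsto_ennrealI tendsto_intros LIMSEQ_inverse_real_of_nat)
    then have "(\<lambda>k. L2sq (\<lambda>x. A (g x)) * ennreal ((1 + inverse (real (Suc k)))\<^sup>2)) \<longlonglongrightarrow> L2sq (\<lambda>x. A (g x)) * ennreal ((1 + 0)\<^sup>2)"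
      using Afin by (intro ennreal_tendsto_cmult) auto
    then show "(\<lambda>k. ennreal ((1 + inverse (real (Suc k)))\<^sup>2) * L2sq (\<lambda>x. A (g x))) \<longlonglongrightarrow> L2sq (\<lambda>x. A (g x))"
      by (simp add: mult.commute)
    show "\<exists>N. \<forall>k\<ge>N. ennreal c * L2sq g \<le> ennreal ((1 + inverse (real (Suc k)))\<^sup>2) * L2sq (\<lambda>x. A (g x))"
      using main by simp
  qed
qed


section \<open>Finite Fourier analysis of lattice gradients\<close>

lemma prod_cis: "finite I \<Longrightarrow> (\<Prod>i\<in>I. cis (f i)) = cis (\<Sum>i\<in>I. f i)"
  by (induction I rule: finite_induct) (auto simp: cis_mult)

lemma sum_cis_roots:
  fixes w :: int and M :: nat
  assumes "\<bar>w\<bar> < int M"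
  shows "(\<Sum>k<M. cis (of_int w * (2 * pi * real k / real M))) = (if w = 0 then of_nat M else 0)"
proof (cases "w = 0")
  case False
  have M: "M > 0" using assms by linarith
  let ?x = "of_int w * (2 * pi / real M)"
  have "cis ?x \<noteq> 1"
  proof
    assume "cis ?x = 1"
    then have "cos ?x = 1" by (metis cis.sel(1) one_complex.sel(1))
    then obtain n :: int where "?x = of_int n * 2 * pi" by (auto simp: cos_one_2pi_int)
    then have "of_int w = (of_int (n * int M) :: real)"
      using M by (simp add: field_simps)
    then have "w = n * int M" by linarith
    then have "int M dvd w" by simp
    then show False using assms False zdvd_imp_le[of "int M" "\<bar>w\<bar>"] by force
  qed
  moreover have "(cis ?x) ^ M = 1"
  proof -
    have "(cis ?x) ^ M = cis (2 * pi * of_int w)"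
      using M by (simp add: Complex.DeMoivre mult_ac)
    also have "\<dots> = 1" by (simp add: complex_eq_iff)
    finally show ?thesis .
  qed
  ultimately have "(\<Sum>k<M. cis ?x ^ k) = 0" by (simp add: geometric_sum)
  then show ?thesis using False by (simp add: Complex.DeMoivre mult_ac)
qed simp

text \<open>
  Lattice points are kept as real vectors: they pair with frequencies through the inner product, and
  \<open>x + h *\<^sub>R z\<close> runs through the points of a grid.
\<close>

definition int_lattice :: "(real ^ 'n::finite) set" where
  "int_lattice = {z. \<forall>i. z $ i \<in> \<int>}"

definition lattice_box :: "nat \<Rightarrow> (real ^ 'n::finite) set" where
  "lattice_box m = {z \<in> int_lattice. \<forall>i. \<bar>z $ i\<bar> \<le> real m}"

definition frequency :: "nat \<Rightarrow> ('n::finite \<Rightarrow> nat) \<Rightarrow> real ^ 'n" where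
  "frequency M \<kappa> = (\<chi> i. 2 * pi * real (\<kappa> i) / real M)"

definition frequency_indices :: "nat \<Rightarrow> ('n::finite \<Rightarrow> nat) set" where
  "frequency_indices M = PiE UNIV (\<lambda>_. {..<M})"

lemma int_lattice_diff: "z \<in> int_lattice \<Longrightarrow> w \<in> int_lattice \<Longrightarrow> z - w \<in> int_lattice"
  by (auto simp: int_lattice_def)

lemma int_lattice_add: "z \<in> int_lattice \<Longrightarrow> w \<in> int_lattice \<Longrightarrow> z + w \<in> int_lattice"
  by (auto simp: int_lattice_def)

lemma axis_in_int_lattice: "axis j 1 \<in> int_lattice"
  by (auto simp: int_lattice_def axis_def)

lemma finite_lattice_box: "finite (lattice_box m :: (real ^ 'n::finite) set)"
proof (rule finite_subset)
  let ?f = "\<lambda>\<kappa>::'n \<Rightarrow> int. (\<chi> i. of_int (\<kappa> i)) :: real ^ 'n"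
  show "lattice_box m \<subseteq> ?f ` (PiE UNIV (\<lambda>_. {-int m..int m}))"
  proof
    fix z :: "real ^ 'n" assume z: "z \<in> lattice_box m"
    then obtain \<kappa> where \<kappa>: "\<And>i. z $ i = of_int (\<kappa> i)"
      unfolding lattice_box_def int_lattice_def Ints_def by (auto simp: image_iff) metis
    have "\<bar>real_of_int (\<kappa> i)\<bar> \<le> real m" for i using z \<kappa> by (auto simp: lattice_box_def)
    then have "\<kappa> i \<in> {-int m..int m}" for i by (simp add: abs_le_iff) (smt (verit) of_int_le_iff of_int_minus of_int_of_nat_eq)
    then show "z \<in> ?f ` (PiE UNIV (\<lambda>_. {-int m..int m}))"
      using \<kappa> by (intro image_eqI[of _ _ \<kappa>]) (auto simp: vec_eq_iff)
  qed
qed (intro finite_imageI finite_PiE, auto)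

text \<open>
  Orthogonality of the characters of the group $(\mathbb{Z}/M)^n$, in real form.
\<close>

lemma sum_cos_frequencies:
  fixes w :: "real ^ 'n::finite"
  assumes "w \<in> int_lattice" "\<And>i. \<bar>w $ i\<bar> < real M"
  shows "(\<Sum>\<kappa>\<in>frequency_indices M. cos (w \<bullet> frequency M \<kappa>)) = (if w = 0 then real M ^ CARD('n) else 0)"
proof -
  obtain k where k: "\<And>i. w $ i = of_int (k i)"
    using assms(1) unfolding int_lattice_def Ints_def by (auto simp: image_iff) metis
  have kM: "\<bar>k i\<bar> < int M" for i using assms(2)[of i] unfolding k by linarith
  have "cis (w \<bullet> frequency M \<kappa>) = (\<Prod>i\<in>UNIV. cis (of_int (k i) * (2 * pi * real (\<kappa> i) / real M)))" for \<kappa>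
    by (subst prod_cis) (auto simp: inner_vec_def frequency_def k)
  then have "(\<Sum>\<kappa>\<in>frequency_indices M. cis (w \<bullet> frequency M \<kappa>))
      = (\<Prod>i\<in>UNIV. \<Sum>l<M. cis (of_int (k i) * (2 * pi * real l / real M)))"
    unfolding frequency_indices_def by (simp add: prod_sum_PiE)
  also have "\<dots> = (\<Prod>i\<in>UNIV. if k i = 0 then of_nat M else 0)"
    by (intro prod.cong refl sum_cis_roots kM)
  also have "\<dots> = (if w = 0 then of_nat M ^ CARD('n) else 0)"
  proof (cases "w = 0")
    case True
    then have "k i = 0" for i using k[of i] by simp
    then show ?thesis using True by simp
  next
    case False
    then obtain i where "k i \<noteq> 0" using k by (metis of_int_0 vec_eq_iff zero_index)
    then show ?thesis using False by (auto intro!: prod_zero)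
  qed
  finally have "Re (\<Sum>\<kappa>\<in>frequency_indices M. cis (w \<bullet> frequency M \<kappa>)) = Re (if w = 0 then of_nat M ^ CARD('n) else 0)"
    by simp
  then show ?thesis by (simp flip: of_nat_power split: if_splits)
qed

lemma norm_sum_square:
  fixes g :: "'a \<Rightarrow> 'b::real_inner"
  shows "(norm (\<Sum>z\<in>Z. a z *\<^sub>R g z))\<^sup>2 = (\<Sum>z\<in>Z. \<Sum>z'\<in>Z. (a z * a z') * (g z' \<bullet> g z))"
  unfolding power2_norm_eq_inner inner_sum_left inner_sum_right
  by (intro sum.cong refl) (simp add: mult.assoc)

text \<open>
  A finitely supported function on the integer lattice is a trigonometric polynomial; sampling it at sufficiently
  many equispaced frequencies already gives its exact \<open>L\<^sup>2\<close> norm. Sine and cosine sums are kept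
  separate so that real linear maps can be applied to them.
\<close>

lemma finite_Parseval:
  fixes g :: "real ^ 'n::finite \<Rightarrow> 'b::real_inner"
  assumes "finite Z" "Z \<subseteq> int_lattice" and M: "\<And>z z' i. z \<in> Z \<Longrightarrow> z' \<in> Z \<Longrightarrow> \<bar>z $ i - z' $ i\<bar> < real M"
  shows "(\<Sum>\<kappa>\<in>frequency_indices M. (norm (\<Sum>z\<in>Z. cos (z \<bullet> frequency M \<kappa>) *\<^sub>R g z))\<^sup>2
           + (norm (\<Sum>z\<in>Z. sin (z \<bullet> frequency M \<kappa>) *\<^sub>R g z))\<^sup>2)
         = real M ^ CARD('n) * (\<Sum>z\<in>Z. (norm (g z))\<^sup>2)"
proof -
  let ?\<theta> = "frequency M"
  have "(\<Sum>\<kappa>\<in>frequency_indices M. (norm (\<Sum>z\<in>Z. cos (z \<bullet> ?\<theta> \<kappa>) *\<^sub>R g z))\<^sup>2 + (norm (\<Sum>z\<in>Z. sin (z \<bullet> ?\<theta> \<kappa>) *\<^sub>R g z))\<^sup>2)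
     = (\<Sum>\<kappa>\<in>frequency_indices M. \<Sum>z\<in>Z. \<Sum>z'\<in>Z. cos ((z - z') \<bullet> ?\<theta> \<kappa>) * (g z' \<bullet> g z))"
    unfolding norm_sum_square sum.distrib[symmetric]
    by (intro sum.cong refl) (simp add: inner_diff_left cos_diff distrib_right)
  also have "\<dots> = (\<Sum>z\<in>Z. \<Sum>\<kappa>\<in>frequency_indices M. \<Sum>z'\<in>Z. cos ((z - z') \<bullet> ?\<theta> \<kappa>) * (g z' \<bullet> g z))"
    by (rule sum.swap)
  also have "\<dots> = (\<Sum>z\<in>Z. \<Sum>z'\<in>Z. \<Sum>\<kappa>\<in>frequency_indices M. cos ((z - z') \<bullet> ?\<theta> \<kappa>) * (g z' \<bullet> g z))"
    by (intro sum.cong refl sum.swap)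
  also have "\<dots> = (\<Sum>z\<in>Z. \<Sum>z'\<in>Z. (if z = z' then real M ^ CARD('n) * (g z' \<bullet> g z) else 0))"
  proof (intro sum.cong refl)
    fix z z' assume z: "z \<in> Z" "z' \<in> Z"
    have "(\<Sum>\<kappa>\<in>frequency_indices M. cos ((z - z') \<bullet> ?\<theta> \<kappa>)) = (if z - z' = 0 then real M ^ CARD('n) else 0)"
      using z assms by (intro sum_cos_frequencies int_lattice_diff) auto
    then show "(\<Sum>\<kappa>\<in>frequency_indices M. cos ((z - z') \<bullet> ?\<theta> \<kappa>) * (g z' \<bullet> g z)) = (if z = z' then real M ^ CARD('n) * (g z' \<bullet> g z) else 0)"
      by (simp flip: sum_distrib_right)
  qed
  also have "\<dots> = real M ^ CARD('n) * (\<Sum>z\<in>Z. (norm (g z))\<^sup>2)"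
    using \<open>finite Z\<close> by (simp add: sum_distrib_left power2_norm_eq_inner)
  finally show ?thesis .
qed

text \<open>
  Summation over the lattice is translation invariant; the box larger by one unit contains all the
  shifted support.
\<close>

lemma sum_lattice_box_shift:
  fixes g :: "real ^ 'n::finite \<Rightarrow> 'b::comm_monoid_add"
  assumes "s \<in> int_lattice" "\<And>i. \<bar>s $ i\<bar> \<le> 1"
    and g: "\<And>z. z \<in> int_lattice \<Longrightarrow> z \<notin> lattice_box m \<Longrightarrow> g z = 0"
  shows "(\<Sum>z\<in>lattice_box (Suc m). g (z + s)) = (\<Sum>z\<in>lattice_box m. g z)"
proof -
  have "(\<Sum>z\<in>lattice_box (Suc m). g (z + s)) = (\<Sum>z\<in>(\<lambda>z. z - s) ` lattice_box m. g (z + s))"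
  proof (rule sum.mono_neutral_right)
    show "(\<lambda>z. z - s) ` lattice_box m \<subseteq> lattice_box (Suc m)"
    proof clarify
      fix z :: "real ^ 'n" assume z: "z \<in> lattice_box m"
      have "\<bar>z $ i - s $ i\<bar> \<le> real (Suc m)" for i
      proof -
        have "\<bar>z $ i\<bar> \<le> real m" using z by (simp add: lattice_box_def)
        then show ?thesis using assms(2)[of i] by simp
      qed
      then show "z - s \<in> lattice_box (Suc m)"
        using z int_lattice_diff[OF _ assms(1)] by (auto simp: lattice_box_def)
    qed
    show "\<forall>z\<in>lattice_box (Suc m) - (\<lambda>z. z - s) ` lattice_box m. g (z + s) = 0"
    proof (intro ballI g)
      fix z assume z: "z \<in> lattice_box (Suc m) - (\<lambda>z. z - s) ` lattice_box m"
      then show "z + s \<in> int_lattice" by (auto simp: lattice_box_def intro!: int_lattice_add assms)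
      show "z + s \<notin> lattice_box m"
        using z by (auto simp: image_iff)
    qed
  qed (rule finite_lattice_box)
  also have "\<dots> = (\<Sum>z\<in>lattice_box m. g z)"
    by (subst sum.reindex) (auto simp: inj_on_def)
  finally show ?thesis .
qed

text \<open>
  Central rather than one-sided differences: their Fourier symbol is \<open>\<i>\<close> times a real vector, as for the
  gradient, and this is what makes the transforms below rank-one matrices.
\<close>

definition central_diff :: "(real ^ 'n::finite \<Rightarrow> real ^ 'm::finite) \<Rightarrow> real ^ 'n \<Rightarrow> real ^ 'n ^ 'm" where
  "central_diff c z = (\<chi> \<alpha> j. c (z + axis j 1) $ \<alpha> - c (z - axis j 1) $ \<alpha>)"

text \<open>
  Summation by parts: differencing \<open>c\<close> multiplies its transform by the vector with entries
  \<open>2 * sin (\<theta> $ j)\<close> and exchanges sine and cosine sums.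
\<close>

lemma central_diff_transform:
  fixes c :: "real ^ 'n::finite \<Rightarrow> real ^ 'm::finite"
  assumes c: "\<And>z. z \<in> int_lattice \<Longrightarrow> z \<notin> lattice_box m \<Longrightarrow> c z = 0"
  shows "(\<Sum>z\<in>lattice_box (Suc m). cos (z \<bullet> \<theta>) *\<^sub>R central_diff c z)
      = tensor (\<Sum>z\<in>lattice_box m. sin (z \<bullet> \<theta>) *\<^sub>R c z) (\<chi> j. 2 * sin (\<theta> $ j))" (is ?cos)
    and "(\<Sum>z\<in>lattice_box (Suc m). sin (z \<bullet> \<theta>) *\<^sub>R central_diff c z)
      = tensor (\<Sum>z\<in>lattice_box m. cos (z \<bullet> \<theta>) *\<^sub>R c z) (\<chi> j. - 2 * sin (\<theta> $ j))" (is ?sin)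
proof -
  have diff: "(\<Sum>z\<in>lattice_box (Suc m). a z * (c (z + axis j 1) $ \<alpha> - c (z - axis j 1) $ \<alpha>))
      = (\<Sum>z\<in>lattice_box m. (a (z - axis j 1) - a (z + axis j 1)) * c z $ \<alpha>)" for a j \<alpha>
  proof -
    have ax: "\<bar>axis j 1 $ i :: real\<bar> \<le> 1" "\<bar>(- axis j 1) $ i :: real\<bar> \<le> 1" for i
      by (auto simp: axis_def)
    have "- axis j 1 \<in> int_lattice" using axis_in_int_lattice[of j] by (auto simp: int_lattice_def)
    note s = sum_lattice_box_shift[OF axis_in_int_lattice ax(1), where g="\<lambda>z. a (z - axis j 1) * c z $ \<alpha>"]
      sum_lattice_box_shift[OF this ax(2), where g="\<lambda>z. a (z + axis j 1) * c z $ \<alpha>"]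
    have "(\<Sum>z\<in>lattice_box (Suc m). a z * (c (z + axis j 1) $ \<alpha> - c (z - axis j 1) $ \<alpha>))
      = (\<Sum>z\<in>lattice_box (Suc m). a z * c (z + axis j 1) $ \<alpha>) - (\<Sum>z\<in>lattice_box (Suc m). a z * c (z - axis j 1) $ \<alpha>)"
      by (simp add: right_diff_distrib sum_subtractf)
    also have "(\<Sum>z\<in>lattice_box (Suc m). a z * c (z + axis j 1) $ \<alpha>) = (\<Sum>z\<in>lattice_box m. a (z - axis j 1) * c z $ \<alpha>)"
      using s(1)[of m] c by simp
    also have "(\<Sum>z\<in>lattice_box (Suc m). a z * c (z - axis j 1) $ \<alpha>) = (\<Sum>z\<in>lattice_box m. a (z + axis j 1) * c z $ \<alpha>)"
      using s(2)[of m] c by simp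
    finally show ?thesis by (simp add: left_diff_distrib sum_subtractf)
  qed
  have transform: "(\<Sum>z\<in>lattice_box (Suc m). a (z \<bullet> \<theta>) *\<^sub>R central_diff c z)
      = tensor (\<Sum>z\<in>lattice_box m. b (z \<bullet> \<theta>) *\<^sub>R c z) (\<chi> j. s (\<theta> $ j))"
    if a: "\<And>x y. a (x - y) - a (x + y) = b x * s y" for a b s :: "real \<Rightarrow> real"
    unfolding vec_eq_iff
  proof (intro allI)
    fix \<alpha> j
    have "(\<Sum>z\<in>lattice_box (Suc m). a (z \<bullet> \<theta>) *\<^sub>R central_diff c z) $ \<alpha> $ j
      = (\<Sum>z\<in>lattice_box (Suc m). a (z \<bullet> \<theta>) * (c (z + axis j 1) $ \<alpha> - c (z - axis j 1) $ \<alpha>))"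
      by (simp add: central_diff_def)
    also have "\<dots> = (\<Sum>z\<in>lattice_box m. (b (z \<bullet> \<theta>) * s (\<theta> $ j)) * c z $ \<alpha>)"
      by (subst diff) (simp add: inner_diff_left inner_add_left inner_axis' a)
    also have "\<dots> = tensor (\<Sum>z\<in>lattice_box m. b (z \<bullet> \<theta>) *\<^sub>R c z) (\<chi> j. s (\<theta> $ j)) $ \<alpha> $ j"
      by (simp add: tensor_def sum_distrib_left sum_distrib_right mult_ac)
    finally show "(\<Sum>z\<in>lattice_box (Suc m). a (z \<bullet> \<theta>) *\<^sub>R central_diff c z) $ \<alpha> $ j
      = tensor (\<Sum>z\<in>lattice_box m. b (z \<bullet> \<theta>) *\<^sub>R c z) (\<chi> j. s (\<theta> $ j)) $ \<alpha> $ j" .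
  qed
  show ?cos by (rule transform) (simp add: cos_diff cos_add)
  show ?sin by (rule transform) (simp add: sin_diff sin_add)
qed

text \<open>
  Every Fourier coefficient of a lattice gradient is a rank-one matrix, where the lower bound on \<open>A\<close> is
  available; Parseval carries it to the sum of squares.
\<close>

lemma rank_one_bound_lattice:
  fixes c :: "real ^ 'n::finite \<Rightarrow> real ^ 'm::finite" and A :: "real ^ 'n ^ 'm \<Rightarrow> 'b::real_inner"
  assumes A: "linear A" and \<nu>: "\<nu> \<ge> 0" "\<And>\<eta> a. \<nu> * norm (tensor \<eta> a) \<le> norm (A (tensor \<eta> a))"
    and c: "\<And>z. z \<in> int_lattice \<Longrightarrow> z \<notin> lattice_box m \<Longrightarrow> c z = 0"
  shows "\<nu>\<^sup>2 * (\<Sum>z\<in>lattice_box (Suc m). (norm (central_diff c z))\<^sup>2)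
    \<le> (\<Sum>z\<in>lattice_box (Suc m). (norm (A (central_diff c z)))\<^sup>2)"
proof -
  let ?Z = "lattice_box (Suc m) :: (real ^ 'n) set"
  \<comment> \<open>Coordinates in the box differ by at most \<open>2 * Suc m\<close>; one more sample separates them.\<close>
  let ?M = "2 * Suc m + 1"
  have Z: "finite ?Z" "?Z \<subseteq> int_lattice" by (rule finite_lattice_box) (auto simp: lattice_box_def)
  have M: "\<bar>z $ i - z' $ i\<bar> < real ?M" if "z \<in> ?Z" "z' \<in> ?Z" for z z' i
    using that abs_triangle_ineq4[of "z $ i" "z' $ i"] unfolding lattice_box_def by (force dest!: spec[of _ i])
  have sq: "\<nu>\<^sup>2 * (norm (tensor \<eta> a))\<^sup>2 \<le> (norm (A (tensor \<eta> a)))\<^sup>2" for \<eta> a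
    using power_mono[OF \<nu>(2), of \<eta> a 2] \<nu>(1) by (simp add: power_mult_distrib)
  have push: "(\<Sum>z\<in>?Z. f z *\<^sub>R A (central_diff c z)) = A (\<Sum>z\<in>?Z. f z *\<^sub>R central_diff c z)" for f
    by (simp add: linear_sum[OF A] linear_scale[OF A])
  have transform: "(\<Sum>z\<in>?Z. cos (z \<bullet> \<theta>) *\<^sub>R central_diff c z)
      = tensor (\<Sum>z\<in>lattice_box m. sin (z \<bullet> \<theta>) *\<^sub>R c z) (\<chi> j. 2 * sin (\<theta> $ j))"
    "(\<Sum>z\<in>?Z. sin (z \<bullet> \<theta>) *\<^sub>R central_diff c z)
      = tensor (\<Sum>z\<in>lattice_box m. cos (z \<bullet> \<theta>) *\<^sub>R c z) (\<chi> j. - 2 * sin (\<theta> $ j))" for \<theta>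
    using central_diff_transform c by blast+
  have Parseval: "real ?M ^ CARD('n) * (\<Sum>z\<in>?Z. (norm (g z))\<^sup>2)
      = (\<Sum>\<kappa>\<in>frequency_indices ?M. (norm (\<Sum>z\<in>?Z. cos (z \<bullet> frequency ?M \<kappa>) *\<^sub>R g z))\<^sup>2
           + (norm (\<Sum>z\<in>?Z. sin (z \<bullet> frequency ?M \<kappa>) *\<^sub>R g z))\<^sup>2)" for g :: "real ^ 'n \<Rightarrow> 'c::real_inner"
    by (rule finite_Parseval[OF Z, symmetric]) (rule M)
  have "real ?M ^ CARD('n) * (\<nu>\<^sup>2 * (\<Sum>z\<in>?Z. (norm (central_diff c z))\<^sup>2))
    = \<nu>\<^sup>2 * (real ?M ^ CARD('n) * (\<Sum>z\<in>?Z. (norm (central_diff c z))\<^sup>2))"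
    by (simp only: mult.left_commute)
  also have "\<dots> \<le> real ?M ^ CARD('n) * (\<Sum>z\<in>?Z. (norm (A (central_diff c z)))\<^sup>2)"
  unfolding Parseval
  proof -
    show "\<nu>\<^sup>2 * (\<Sum>\<kappa>\<in>frequency_indices ?M. (norm (\<Sum>z\<in>?Z. cos (z \<bullet> frequency ?M \<kappa>) *\<^sub>R central_diff c z))\<^sup>2
           + (norm (\<Sum>z\<in>?Z. sin (z \<bullet> frequency ?M \<kappa>) *\<^sub>R central_diff c z))\<^sup>2)
      \<le> (\<Sum>\<kappa>\<in>frequency_indices ?M. (norm (\<Sum>z\<in>?Z. cos (z \<bullet> frequency ?M \<kappa>) *\<^sub>R A (central_diff c z)))\<^sup>2
           + (norm (\<Sum>z\<in>?Z. sin (z \<bullet> frequency ?M \<kappa>) *\<^sub>R A (central_diff c z)))\<^sup>2)"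
      unfolding push transform sum_distrib_left
      by (intro sum_mono) (auto simp: distrib_left intro!: add_mono sq)
  qed
  finally show ?thesis by (simp del: of_nat_add of_nat_mult of_nat_Suc)
qed


section \<open>The rank-one bound for difference quotients\<close>

lemma borel_measurable_vec_nth [measurable (raw)]:
  fixes f :: "'a \<Rightarrow> 'b::euclidean_space ^ 'n::finite"
  assumes [measurable]: "f \<in> borel_measurable M"
  shows "(\<lambda>x. f x $ i) \<in> borel_measurable M"
proof -
  have "(\<lambda>v::'b ^ 'n. v $ i) \<in> borel_measurable borel"
    by (intro borel_measurable_continuous_onI continuous_intros)
  from measurable_compose[OF assms this] show ?thesis .
qed

lemma borel_measurable_vecI:
  fixes f :: "'a \<Rightarrow> 'b::euclidean_space ^ 'n::finite"
  assumes "\<And>i. (\<lambda>x. f x $ i) \<in> borel_measurable M"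
  shows "f \<in> borel_measurable M"
proof (subst borel_measurable_euclidean_space, rule ballI)
  fix b :: "'b ^ 'n" assume "b \<in> Basis"
  then obtain i c where b: "b = axis i c" by (auto simp: Basis_vec_def)
  have [measurable]: "(\<lambda>x. f x $ i) \<in> borel_measurable M" by (rule assms)
  show "(\<lambda>x. f x \<bullet> b) \<in> borel_measurable M" by (simp add: b inner_axis)
qed

lemma norm_vec_square: "(norm (x :: 'b::euclidean_space ^ 'n::finite))\<^sup>2 = (\<Sum>i\<in>UNIV. (norm (x $ i))\<^sup>2)"
  by (simp add: norm_vec_def L2_set_def sum_nonneg)

lemma norm_matrix_square_columns:
  fixes P :: "real ^ 'n::finite ^ 'm::finite"
  shows "(norm P)\<^sup>2 = (\<Sum>j\<in>UNIV. (norm (\<chi> \<alpha>. P $ \<alpha> $ j))\<^sup>2)"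
  unfolding norm_vec_square by simp (rule sum.swap)

definition grid_cell :: "real \<Rightarrow> (real ^ 'n::finite) set" where
  "grid_cell h = {x. \<forall>i. 0 \<le> x $ i \<and> x $ i < h}"

lemma grid_cell_borel [measurable]: "grid_cell h \<in> sets borel"
proof -
  have "grid_cell h = (\<Inter>i. {x \<in> space borel. 0 \<le> x $ i \<and> x $ i < h})" by (auto simp: grid_cell_def)
  also have "\<dots> \<in> sets borel" by measurable
  finally show ?thesis .
qed

text \<open>
  Integrating over space amounts to integrating lattice sums over one cell of side \<open>h\<close>.
\<close>

lemma nn_integral_tiling:
  fixes f :: "real ^ 'n::finite \<Rightarrow> ennreal"
  assumes [measurable]: "f \<in> borel_measurable borel" and h: "h > 0"
    and supp: "\<And>x i. f x \<noteq> 0 \<Longrightarrow> \<bar>x $ i\<bar> / h + 1 \<le> real m"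
  shows "(\<integral>\<^sup>+x. f x \<partial>lborel) =
    (\<integral>\<^sup>+x. (\<Sum>z\<in>lattice_box m. f (x + h *\<^sub>R z)) * indicator (grid_cell h) x \<partial>lborel)"
proof -
  let ?Q = "grid_cell h :: (real ^ 'n) set"
  have one: "(\<Sum>z\<in>lattice_box m. indicator ?Q (y - h *\<^sub>R z)) = (1::ennreal)" if y: "f y \<noteq> 0" for y
  proof -
    define z0 :: "real ^ 'n" where "z0 = (\<chi> i. of_int \<lfloor>y $ i / h\<rfloor>)"
    have Q_iff: "y - h *\<^sub>R z \<in> ?Q \<longleftrightarrow> z = z0" if z: "z \<in> int_lattice" for z
    proof -
      have "(0 \<le> y $ i - h * z $ i \<and> y $ i - h * z $ i < h) \<longleftrightarrow> z $ i = of_int \<lfloor>y $ i / h\<rfloor>" for i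
      proof -
        obtain k where k: "z $ i = of_int k" using z by (auto simp: int_lattice_def elim: Ints_cases)
        have "(0 \<le> y $ i - h * z $ i \<and> y $ i - h * z $ i < h) \<longleftrightarrow> of_int k \<le> y $ i / h \<and> y $ i / h < of_int k + 1"
          using h by (auto simp: k field_simps)
        also have "\<dots> \<longleftrightarrow> \<lfloor>y $ i / h\<rfloor> = k" by (rule floor_eq_iff[symmetric])
        finally show ?thesis by (auto simp: k)
      qed
      then show ?thesis by (simp add: grid_cell_def z0_def vec_eq_iff)
    qed
    have "\<bar>of_int \<lfloor>y $ i / h\<rfloor> :: real\<bar> \<le> real m" for i
    proof -
      have "\<bar>of_int \<lfloor>y $ i / h\<rfloor> :: real\<bar> \<le> \<bar>y $ i / h\<bar> + 1" by linarith
      also have "\<bar>y $ i / h\<bar> = \<bar>y $ i\<bar> / h" using h by simp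
      finally show ?thesis using supp[OF y, of i] by linarith
    qed
    then have z0: "z0 \<in> lattice_box m" by (simp add: lattice_box_def int_lattice_def z0_def)
    have "(\<Sum>z\<in>lattice_box m. indicator ?Q (y - h *\<^sub>R z)) = (\<Sum>z\<in>lattice_box m. if z = z0 then 1 else (0::ennreal))"
      using Q_iff by (intro sum.cong refl) (simp add: lattice_box_def indicator_def)
    also have "\<dots> = 1" using z0 by (simp add: finite_lattice_box)
    finally show ?thesis .
  qed
  have "(\<integral>\<^sup>+x. (\<Sum>z\<in>lattice_box m. f (x + h *\<^sub>R z)) * indicator ?Q x \<partial>lborel)
     = (\<Sum>z\<in>lattice_box m. \<integral>\<^sup>+x. f (x + h *\<^sub>R z) * indicator ?Q x \<partial>lborel)"
    unfolding sum_distrib_right by (rule nn_integral_sum) measurable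
  also have "\<dots> = (\<Sum>z\<in>lattice_box m. \<integral>\<^sup>+y. f y * indicator ?Q (y - h *\<^sub>R z) \<partial>lborel)"
  proof (rule sum.cong[OF refl])
    fix z :: "real ^ 'n"
    show "(\<integral>\<^sup>+x. f (x + h *\<^sub>R z) * indicator ?Q x \<partial>lborel) = (\<integral>\<^sup>+y. f y * indicator ?Q (y - h *\<^sub>R z) \<partial>lborel)"
      using nn_integral_lborel_translate[of "\<lambda>y. f y * indicator ?Q (y - h *\<^sub>R z)" "h *\<^sub>R z"] by simp
  qed
  also have "\<dots> = (\<integral>\<^sup>+y. (\<Sum>z\<in>lattice_box m. f y * indicator ?Q (y - h *\<^sub>R z)) \<partial>lborel)"
    by (rule nn_integral_sum[symmetric]) measurable
  also have "\<dots> = (\<integral>\<^sup>+y. f y \<partial>lborel)"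
  proof (rule nn_integral_cong)
    fix y
    show "(\<Sum>z\<in>lattice_box m. f y * indicator ?Q (y - h *\<^sub>R z)) = f y"
    proof (cases "f y = 0")
      case False
      show ?thesis by (simp only: sum_distrib_left[symmetric] one[OF False] mult_1_right)
    qed simp
  qed
  finally show ?thesis by simp
qed

definition diff_quot :: "real \<Rightarrow> (real ^ 'n::finite \<Rightarrow> real ^ 'm::finite) \<Rightarrow> real ^ 'n \<Rightarrow> real ^ 'n ^ 'm" where
  "diff_quot h u x = (\<chi> \<alpha> j. (u (x + h *\<^sub>R axis j 1) $ \<alpha> - u (x - h *\<^sub>R axis j 1) $ \<alpha>) / (2 * h))"

lemma borel_measurable_diff_quot [measurable]:
  assumes [measurable]: "u \<in> borel_measurable borel"
  shows "diff_quot h u \<in> borel_measurable borel"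
proof (intro borel_measurable_vecI)
  fix \<alpha> j show "(\<lambda>x. diff_quot h u x $ \<alpha> $ j) \<in> borel_measurable borel"
    by (simp add: diff_quot_def)
qed

lemma norm_diff_quot_square:
  assumes "h > 0"
  shows "(norm (diff_quot h u x))\<^sup>2 = (\<Sum>j\<in>UNIV. (norm (u (x + h *\<^sub>R axis j 1) - u (x - h *\<^sub>R axis j 1)))\<^sup>2 / (2 * h)\<^sup>2)"
proof -
  have "(\<chi> \<alpha>. diff_quot h u x $ \<alpha> $ j) = (1 / (2 * h)) *\<^sub>R (u (x + h *\<^sub>R axis j 1) - u (x - h *\<^sub>R axis j 1))" for j
    by (simp add: diff_quot_def vec_eq_iff)
  then show ?thesis
    unfolding norm_matrix_square_columns using assms by (simp add: power_divide)
qed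

lemma linear_borel_measurable:
  fixes A :: "'a::euclidean_space \<Rightarrow> 'b::euclidean_space"
  shows "linear A \<Longrightarrow> A \<in> borel_measurable borel"
  by (intro borel_measurable_continuous_onI linear_continuous_on) (simp add: linear_conv_bounded_linear)

text \<open>
  On each coset \<open>x + h *\<^sub>R z\<close> of the lattice the difference quotient is a lattice gradient, so the discrete
  bound holds for every \<open>x\<close> in the cell and can be integrated.
\<close>

lemma rank_one_bound_bounded_support:
  fixes v :: "real ^ 'n::finite \<Rightarrow> real ^ 'm::finite" and A :: "real ^ 'n ^ 'm \<Rightarrow> 'b::euclidean_space"
  assumes A: "linear A" and \<nu>: "\<nu> \<ge> 0" "\<And>\<eta> a. \<nu> * norm (tensor \<eta> a) \<le> norm (A (tensor \<eta> a))"
    and [measurable]: "v \<in> borel_measurable borel" and h: "h > 0" and R: "\<And>x. norm x > R \<Longrightarrow> v x = 0"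
  shows "ennreal (\<nu>\<^sup>2) * L2sq (diff_quot h v) \<le> L2sq (\<lambda>x. A (diff_quot h v x))"
proof -
  note [measurable] = linear_borel_measurable[OF A]
  let ?D = "diff_quot h v"
  let ?Q = "grid_cell h :: (real ^ 'n) set"
  \<comment> \<open>Room for the side of the cell, for the step of the difference, and for rounding.\<close>
  obtain m where m: "R / h + 3 \<le> real m" using real_arch_simple by blast
  let ?Z = "lattice_box (Suc m) :: (real ^ 'n) set"
  have D0: "\<bar>x $ i\<bar> / h + 1 \<le> real (Suc m)" if "?D x \<noteq> 0" for x i
  proof -
    have "norm x \<le> R + h"
    proof (rule ccontr)
      assume n: "\<not> norm x \<le> R + h"
      have "norm (x + h *\<^sub>R axis j 1) > R" "norm (x - h *\<^sub>R axis j 1) > R" for j :: 'n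
        using n norm_triangle_ineq2[of x "h *\<^sub>R axis j 1"] norm_triangle_ineq2[of x "- (h *\<^sub>R axis j 1)"] h by simp_all
      then have "?D x = 0" using R by (simp add: diff_quot_def vec_eq_iff)
      with that show False by simp
    qed
    then have "\<bar>x $ i\<bar> \<le> R + h" using component_le_norm_cart[of x i] by linarith
    then have "\<bar>x $ i\<bar> / h \<le> R / h + 1" using h by (simp add: field_simps)
    then show ?thesis using m by simp
  qed
  have A0: "A 0 = 0" by (rule linear_0[OF A])
  have tile1: "L2sq ?D = (\<integral>\<^sup>+x. (\<Sum>z\<in>?Z. ennreal ((norm (?D (x + h *\<^sub>R z)))\<^sup>2)) * indicator ?Q x \<partial>lborel)"
    unfolding L2sq_def using D0 by (intro nn_integral_tiling h) force+
  have tile2: "L2sq (\<lambda>x. A (?D x)) = (\<integral>\<^sup>+x. (\<Sum>z\<in>?Z. ennreal ((norm (A (?D (x + h *\<^sub>R z))))\<^sup>2)) * indicator ?Q x \<partial>lborel)"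
    unfolding L2sq_def using D0 A0 by (intro nn_integral_tiling h) force+
  have point: "\<nu>\<^sup>2 * (\<Sum>z\<in>?Z. (norm (?D (x + h *\<^sub>R z)))\<^sup>2) \<le> (\<Sum>z\<in>?Z. (norm (A (?D (x + h *\<^sub>R z))))\<^sup>2)"
    if x: "x \<in> ?Q" for x
  proof -
    define c where "c z = (1 / (2 * h)) *\<^sub>R v (x + h *\<^sub>R z)" for z
    have "central_diff c z = ?D (x + h *\<^sub>R z)" for z
      by (simp add: central_diff_def diff_quot_def c_def vec_eq_iff algebra_simps diff_divide_distrib)
    moreover have "c z = 0" if z: "z \<in> int_lattice" "z \<notin> lattice_box m" for z
    proof -
      obtain i where i: "\<bar>z $ i\<bar> > real m" using z by (auto simp: lattice_box_def not_le)
      have "h * \<bar>z $ i\<bar> > h * real m" using i h by simp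
      moreover have "h * real m \<ge> R + 3 * h" using m h by (simp add: field_simps)
      moreover have "\<bar>x $ i\<bar> < h" using x by (auto simp: grid_cell_def)
      moreover have "\<bar>(x + h *\<^sub>R z) $ i\<bar> \<ge> h * \<bar>z $ i\<bar> - \<bar>x $ i\<bar>"
        using h abs_triangle_ineq2[of "h * z $ i" "- x $ i"] by (simp add: abs_mult add.commute)
      ultimately have "norm (x + h *\<^sub>R z) > R" using component_le_norm_cart[of "x + h *\<^sub>R z" i] h by linarith
      then show ?thesis using R by (simp add: c_def)
    qed
    ultimately show ?thesis using rank_one_bound_lattice[OF A \<nu>, of m c] by simp
  qed
  have "ennreal (\<nu>\<^sup>2) * L2sq ?D = (\<integral>\<^sup>+x. ennreal (\<nu>\<^sup>2) * ((\<Sum>z\<in>?Z. ennreal ((norm (?D (x + h *\<^sub>R z)))\<^sup>2)) * indicator ?Q x) \<partial>lborel)"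
    unfolding tile1 by (rule nn_integral_cmult[symmetric]) measurable
  also have "\<dots> \<le> L2sq (\<lambda>x. A (?D x))"
    unfolding tile2
  proof (rule nn_integral_mono)
    fix x
    show "ennreal (\<nu>\<^sup>2) * ((\<Sum>z\<in>?Z. ennreal ((norm (?D (x + h *\<^sub>R z)))\<^sup>2)) * indicator ?Q x)
      \<le> (\<Sum>z\<in>?Z. ennreal ((norm (A (?D (x + h *\<^sub>R z))))\<^sup>2)) * indicator ?Q x"
      using point[of x] by (auto simp: indicator_def sum_ennreal ennreal_mult[symmetric] sum_nonneg intro!: ennreal_leI)
  qed
  finally show ?thesis .
qed

lemma L2sq_diff_quot_le:
  fixes u :: "real ^ 'n::finite \<Rightarrow> real ^ 'm::finite"
  assumes [measurable]: "u \<in> borel_measurable borel" and h: "h > 0"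
    and le: "\<And>j. L2sq (\<lambda>x. u (x + (2 * h) *\<^sub>R axis j 1) - u x) \<le> ennreal ((2 * h)\<^sup>2) * K"
  shows "L2sq (diff_quot h u) \<le> of_nat CARD('n) * K"
proof -
  let ?d = "\<lambda>j x. u (x + h *\<^sub>R axis j 1) - u (x - h *\<^sub>R axis j 1)"
  have "L2sq (diff_quot h u) = (\<integral>\<^sup>+x. (\<Sum>j\<in>UNIV. ennreal (1 / (2 * h)\<^sup>2) * ennreal ((norm (?d j x))\<^sup>2)) \<partial>lborel)"
    unfolding L2sq_def norm_diff_quot_square[OF h]
    by (intro nn_integral_cong) (simp add: sum_ennreal ennreal_mult'[symmetric])
  also have "\<dots> = (\<Sum>j\<in>UNIV. ennreal (1 / (2 * h)\<^sup>2) * L2sq (?d j))"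
    unfolding L2sq_def by (simp add: nn_integral_sum nn_integral_cmult)
  also have "\<dots> \<le> (\<Sum>j\<in>(UNIV::'n set). K)"
  proof (rule sum_mono)
    fix j :: 'n
    have "L2sq (?d j) = L2sq (\<lambda>x. u (x + (2 * h) *\<^sub>R axis j 1) - u x)"
      using L2sq_translate[of "?d j" "h *\<^sub>R axis j 1"]
      by (simp add: add.assoc scaleR_add_left[symmetric])
    then have "ennreal (1 / (2 * h)\<^sup>2) * L2sq (?d j)
        \<le> ennreal (1 / (2 * h)\<^sup>2) * (ennreal ((2 * h)\<^sup>2) * K)"
      using le[of j] by (simp add: mult_left_mono)
    also have "\<dots> = ennreal (1 / (2 * h)\<^sup>2 * (2 * h)\<^sup>2) * K"
      by (subst ennreal_mult) (simp_all only: mult.assoc zero_le_divide_1_iff zero_le_power2)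
    also have "1 / (2 * h)\<^sup>2 * (2 * h)\<^sup>2 = 1" using h by simp
    finally show "ennreal (1 / (2 * h)\<^sup>2) * L2sq (?d j) \<le> K" by simp
  qed
  finally show ?thesis by simp
qed

lemma diff_quot_diff: "diff_quot h (\<lambda>x. u x - v x) x = diff_quot h u x - diff_quot h v x"
  by (simp add: diff_quot_def vec_eq_iff diff_divide_distrib)

text \<open>
  For fixed \<open>h\<close> the difference quotient is bounded on \<open>L\<^sup>2\<close>, so a sharp cut-off to large balls suffices.
\<close>

lemma rank_one_bound_diff_quot_L2:
  fixes v :: "real ^ 'n::finite \<Rightarrow> real ^ 'm::finite" and A :: "real ^ 'n ^ 'm \<Rightarrow> 'b::euclidean_space"
  assumes A: "linear A" and \<nu>: "\<nu> \<ge> 0" "\<And>\<eta> a. \<nu> * norm (tensor \<eta> a) \<le> norm (A (tensor \<eta> a))"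
    and [measurable]: "v \<in> borel_measurable borel" and h: "h > 0" and fin: "L2sq v < \<infinity>"
  shows "ennreal (\<nu>\<^sup>2) * L2sq (diff_quot h v) \<le> L2sq (\<lambda>x. A (diff_quot h v x))"
proof -
  have bound: "L2sq (diff_quot h w) \<le> of_nat CARD('n) * (ennreal (1 / h\<^sup>2) * L2sq w)"
    if [measurable]: "w \<in> borel_measurable borel" for w :: "real ^ 'n \<Rightarrow> real ^ 'm"
  proof (rule L2sq_diff_quot_le[OF that h])
    fix j :: 'n
    have "L2sq (\<lambda>x. w (x + (2 * h) *\<^sub>R axis j 1) + - w x) \<le> 2 * L2sq (\<lambda>x. w (x + (2 * h) *\<^sub>R axis j 1)) + 2 * L2sq (\<lambda>x. - w x)"
      by (rule L2sq_add_le2) auto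
    also have "\<dots> = 4 * L2sq w"
      unfolding L2sq_minus L2sq_translate[OF that] by (simp flip: distrib_right)
    also have "\<dots> = ennreal ((2 * h)\<^sup>2 * (1 / h\<^sup>2)) * L2sq w" using h by (simp add: power_mult_distrib)
    also have "\<dots> = ennreal ((2 * h)\<^sup>2) * (ennreal (1 / h\<^sup>2) * L2sq w)"
      by (subst ennreal_mult) (auto simp: mult.assoc)
    finally show "L2sq (\<lambda>x. w (x + (2 * h) *\<^sub>R axis j 1) - w x) \<le> ennreal ((2 * h)\<^sup>2) * (ennreal (1 / h\<^sup>2) * L2sq w)" by simp
  qed
  define vk where "vk k x = indicator (cball 0 (real k)) x *\<^sub>R v x" for k :: nat and x
  have [measurable]: "vk k \<in> borel_measurable borel" for k unfolding vk_def[abs_def] by measurable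
  have vk: "(\<lambda>k. L2sq (\<lambda>x. vk k x - v x)) \<longlonglongrightarrow> 0"
  proof (rule L2sq_dominated_convergence[where w=v])
    show "AE x in lborel. (\<lambda>k. vk k x) \<longlonglongrightarrow> v x"
    proof (rule AE_I2, rule tendsto_eventually)
      fix x :: "real ^ 'n"
      obtain K where "norm x \<le> real K" using real_arch_simple by blast
      then show "\<forall>\<^sub>F k in sequentially. vk k x = v x"
        by (intro eventually_sequentiallyI[of K]) (auto simp: vk_def)
    qed
  qed (use fin in \<open>auto simp: vk_def indicator_def\<close>)
  show ?thesis
  proof (rule L2sq_lower_bound_closed[OF A, where f="\<lambda>k. diff_quot h (vk k)"])
    have "of_nat CARD('n) * (ennreal (1 / h\<^sup>2) * L2sq v) < \<infinity>"
      using fin by (simp add: ennreal_mult_less_top of_nat_less_top)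
    then show "L2sq (diff_quot h v) < \<infinity>" using bound[of v] by (auto intro: le_less_trans)
    show "ennreal (\<nu>\<^sup>2) * L2sq (diff_quot h (vk k)) \<le> L2sq (\<lambda>x. A (diff_quot h (vk k) x))" for k
      by (rule rank_one_bound_bounded_support[OF A \<nu> _ h, where R="real k"]) (auto simp: vk_def)
    show "(\<lambda>k. L2sq (\<lambda>x. diff_quot h (vk k) x - diff_quot h v x)) \<longlonglongrightarrow> 0"
    proof (rule tendsto_sandwich[OF _ _ tendsto_const])
      show "\<forall>\<^sub>F k in sequentially. L2sq (\<lambda>x. diff_quot h (vk k) x - diff_quot h v x)
          \<le> of_nat CARD('n) * (ennreal (1 / h\<^sup>2) * L2sq (\<lambda>x. vk k x - v x))"
        unfolding diff_quot_diff[symmetric] using bound by (intro always_eventually allI) auto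
      have "(\<lambda>k. of_nat CARD('n) * (ennreal (1 / h\<^sup>2) * L2sq (\<lambda>x. vk k x - v x))) \<longlonglongrightarrow> of_nat CARD('n) * (ennreal (1 / h\<^sup>2) * 0)"
        by (intro ennreal_tendsto_cmult vk) (auto simp: of_nat_less_top)
      then show "(\<lambda>k. of_nat CARD('n) * (ennreal (1 / h\<^sup>2) * L2sq (\<lambda>x. vk k x - v x))) \<longlonglongrightarrow> 0" by simp
    qed auto
  qed auto
qed

text \<open>
  Moves the values towards the origin by up to \<open>\<epsilon>\<close>. A map in some \<open>L\<^sup>p\<close> need not be square
  integrable where it is small; shrinking removes that part, and being Lipschitz in the values it
  respects difference quotients. This takes the place of a spatial cut-off, which would produce an error term
  with the derivative of the cut-off function.
\<close>

definition shrink :: "real \<Rightarrow> 'a::euclidean_space \<Rightarrow> 'a" where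
  "shrink \<epsilon> a = a - closest_point (cball 0 \<epsilon>) a"

lemma shrink_lipschitz: "\<epsilon> > 0 \<Longrightarrow> norm (shrink \<epsilon> a - shrink \<epsilon> b) \<le> 2 * norm (a - b)"
proof -
  assume "\<epsilon> > 0"
  then have "norm (closest_point (cball 0 \<epsilon>) a - closest_point (cball 0 \<epsilon>) b) \<le> norm (a - b)"
    using closest_point_lipschitz[of "cball 0 \<epsilon>" a b] by (simp add: dist_norm)
  then show ?thesis
    using norm_triangle_ineq4[of "a - b" "closest_point (cball 0 \<epsilon>) a - closest_point (cball 0 \<epsilon>) b"]
    by (simp add: shrink_def algebra_simps)
qed

lemma shrink_eq_0: "norm a \<le> \<epsilon> \<Longrightarrow> shrink \<epsilon> a = 0"
  by (simp add: shrink_def closest_point_self)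

lemma norm_shrink_diff: "\<epsilon> > 0 \<Longrightarrow> norm (shrink \<epsilon> a - a) \<le> \<epsilon>"
  using closest_point_in_set[of "cball 0 \<epsilon>" a] by (auto simp: shrink_def)

lemma norm_shrink_le:
  fixes a :: "'a::euclidean_space"
  shows "\<epsilon> > 0 \<Longrightarrow> norm (shrink \<epsilon> a) \<le> 2 * norm a"
  using shrink_lipschitz[of \<epsilon> a 0] shrink_eq_0[of "0::'a" \<epsilon>] by simp

lemma borel_measurable_shrink [measurable]: "\<epsilon> > 0 \<Longrightarrow> shrink \<epsilon> \<in> borel_measurable borel"
  unfolding shrink_def[abs_def]
  by (intro borel_measurable_continuous_onI continuous_intros continuous_on_closest_point) auto

text \<open>
  The quotients of the shrunk maps are dominated by those of \<open>u\<close> and converge pointwise as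
  \<open>\<epsilon>\<close> tends to \<open>0\<close>.
\<close>

lemma rank_one_bound_diff_quot:
  fixes u :: "real ^ 'n::finite \<Rightarrow> real ^ 'm::finite" and A :: "real ^ 'n ^ 'm \<Rightarrow> 'b::euclidean_space"
  assumes A: "linear A" and \<nu>: "\<nu> \<ge> 0" "\<And>\<eta> a. \<nu> * norm (tensor \<eta> a) \<le> norm (A (tensor \<eta> a))"
    and [measurable]: "u \<in> borel_measurable borel" and h: "h > 0"
    and fin: "L2sq (diff_quot h u) < \<infinity>"
    and shr: "\<And>\<epsilon>. \<epsilon> > 0 \<Longrightarrow> L2sq (\<lambda>x. shrink \<epsilon> (u x)) < \<infinity>"
  shows "ennreal (\<nu>\<^sup>2) * L2sq (diff_quot h u) \<le> L2sq (\<lambda>x. A (diff_quot h u x))"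
proof -
  define \<epsilon> where "\<epsilon> k = inverse (real (Suc k))" for k
  have \<epsilon>: "\<epsilon> k > 0" for k by (simp add: \<epsilon>_def)
  have \<epsilon>0: "\<epsilon> \<longlonglongrightarrow> 0" unfolding \<epsilon>_def by (rule LIMSEQ_inverse_real_of_nat)
  define uk where "uk k x = shrink (\<epsilon> k) (u x)" for k x
  have ukm[measurable]: "uk k \<in> borel_measurable borel" for k
    unfolding uk_def[abs_def] using measurable_compose[OF _ borel_measurable_shrink[OF \<epsilon>]] assms(4) by blast
  show ?thesis
  proof (rule L2sq_lower_bound_closed[OF A, where f="\<lambda>k. diff_quot h (uk k)"])
    show "ennreal (\<nu>\<^sup>2) * L2sq (diff_quot h (uk k)) \<le> L2sq (\<lambda>x. A (diff_quot h (uk k) x))" for k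
      by (rule rank_one_bound_diff_quot_L2[OF A \<nu> _ h]) (use shr[OF \<epsilon>] ukm in \<open>auto simp: uk_def[abs_def]\<close>)
    show "(\<lambda>k. L2sq (\<lambda>x. diff_quot h (uk k) x - diff_quot h u x)) \<longlonglongrightarrow> 0"
    proof (rule L2sq_dominated_convergence[where w="\<lambda>x. 3 *\<^sub>R diff_quot h u x"])
      have ukl: "(\<lambda>k. uk k x) \<longlonglongrightarrow> u x" for x
      proof (rule Lim_null[THEN iffD2], rule Lim_null_comparison[OF _ \<epsilon>0])
        show "\<forall>\<^sub>F k in sequentially. norm (uk k x - u x) \<le> \<epsilon> k"
          unfolding uk_def by (intro always_eventually allI norm_shrink_diff \<epsilon>)
      qed
      show "AE x in lborel. (\<lambda>k. diff_quot h (uk k) x) \<longlonglongrightarrow> diff_quot h u x"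
        unfolding diff_quot_def using h by (intro AE_I2 tendsto_intros ukl) auto
      show "norm (diff_quot h (uk k) x - diff_quot h u x) \<le> norm (3 *\<^sub>R diff_quot h u x)" for k x
      proof -
        have "(norm (diff_quot h (uk k) x))\<^sup>2 \<le> (2 * norm (diff_quot h u x))\<^sup>2"
          unfolding power_mult_distrib[of 2] norm_diff_quot_square[OF h] sum_distrib_left
        proof (rule sum_mono)
          fix j
          let ?a = "x + h *\<^sub>R axis j 1" and ?b = "x - h *\<^sub>R axis j 1"
          have "(norm (uk k ?a - uk k ?b))\<^sup>2 \<le> (2 * norm (u ?a - u ?b))\<^sup>2"
            unfolding uk_def by (intro power_mono shrink_lipschitz \<epsilon>) auto
          then have "(norm (uk k ?a - uk k ?b))\<^sup>2 / (2 * h)\<^sup>2 \<le> (2 * norm (u ?a - u ?b))\<^sup>2 / (2 * h)\<^sup>2"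
            by (intro divide_right_mono) auto
          then show "(norm (uk k ?a - uk k ?b))\<^sup>2 / (2\<^sup>2 * h\<^sup>2) \<le> 2\<^sup>2 * ((norm (u ?a - u ?b))\<^sup>2 / (2\<^sup>2 * h\<^sup>2))"
            by (simp add: power_mult_distrib)
        qed
        then have "norm (diff_quot h (uk k) x) \<le> 2 * norm (diff_quot h u x)"
          by (rule power2_le_imp_le) simp
        then show ?thesis using norm_triangle_ineq4[of "diff_quot h (uk k) x" "diff_quot h u x"] by simp
      qed
      have "L2sq (\<lambda>x. 3 *\<^sub>R diff_quot h u x) \<le> ennreal (3\<^sup>2) * L2sq (diff_quot h u)"
        by (rule L2sq_cmult_mono) auto
      also have "\<dots> < \<infinity>" using fin by (simp add: ennreal_mult_less_top)
      finally show "L2sq (\<lambda>x. 3 *\<^sub>R diff_quot h u x) < \<infinity>" .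
    qed auto
  qed (use fin in auto)
qed


section \<open>From difference quotients to weak gradients\<close>

lemma Jensen_unit_interval:
  fixes f :: "real \<Rightarrow> real"
  assumes [measurable]: "f \<in> borel_measurable borel"
  shows "ennreal ((\<integral>t. f t \<partial>unit_interval)\<^sup>2) \<le> (\<integral>\<^sup>+t. ennreal ((f t)\<^sup>2) \<partial>unit_interval)"
proof (cases "integrable unit_interval f")
  case True
  have "ennreal ((\<integral>t. f t \<partial>unit_interval)\<^sup>2) = (ennreal \<bar>\<integral>t. f t \<partial>unit_interval\<bar>)\<^sup>2"
    by (simp add: ennreal_power)
  also have "\<dots> \<le> (\<integral>\<^sup>+t. ennreal \<bar>f t\<bar> * 1 \<partial>unit_interval)\<^sup>2"
    using integral_norm_bound_ennreal[OF True] by (intro power_mono) auto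
  also have "\<dots> \<le> (\<integral>\<^sup>+t. (ennreal \<bar>f t\<bar>)\<^sup>2 \<partial>unit_interval) * (\<integral>\<^sup>+t. 1\<^sup>2 \<partial>unit_interval)"
    by (rule Cauchy_Schwarz_nn_integral) auto
  also have "\<dots> = (\<integral>\<^sup>+t. ennreal ((f t)\<^sup>2) \<partial>unit_interval)"
    by (simp add: ennreal_power unit_interval.emeasure_space_1)
  finally show ?thesis .
qed (simp add: not_integrable_integral_eq)

definition vector_weak_gradient :: "(real ^ 'n::finite \<Rightarrow> real ^ 'm::finite) \<Rightarrow> (real ^ 'n \<Rightarrow> real ^ 'n ^ 'm) \<Rightarrow> bool" where
  "vector_weak_gradient u G \<longleftrightarrow> (\<forall>\<alpha>. borel_weak_gradient (\<lambda>x. u x $ \<alpha>) (\<lambda>x. G x $ \<alpha>))"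

lemma vector_weak_gradient_measurable:
  assumes "vector_weak_gradient u G"
  shows "u \<in> borel_measurable borel" "G \<in> borel_measurable borel"
proof -
  have "borel_weak_gradient (\<lambda>x. u x $ \<alpha>) (\<lambda>x. G x $ \<alpha>)" for \<alpha>
    using assms by (simp add: vector_weak_gradient_def)
  then have m: "(\<lambda>x. u x $ \<alpha>) \<in> borel_measurable borel" "(\<lambda>x. G x $ \<alpha>) \<in> borel_measurable borel" for \<alpha>
    unfolding borel_weak_gradient_def by blast+
  show "u \<in> borel_measurable borel" by (rule borel_measurable_vecI) (rule m)
  show "G \<in> borel_measurable borel" by (rule borel_measurable_vecI) (rule m)
qed

lemma L2sq_components:
  fixes f :: "'a::euclidean_space \<Rightarrow> 'b::euclidean_space ^ 'n::finite"
  assumes [measurable]: "f \<in> borel_measurable borel"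
  shows "L2sq f = (\<Sum>i\<in>UNIV. L2sq (\<lambda>x. f x $ i))"
proof -
  have "L2sq f = (\<integral>\<^sup>+x. (\<Sum>i\<in>UNIV. ennreal ((norm (f x $ i))\<^sup>2)) \<partial>lborel)"
    unfolding L2sq_def norm_vec_square by (simp add: sum_ennreal)
  also have "\<dots> = (\<Sum>i\<in>UNIV. L2sq (\<lambda>x. f x $ i))"
    unfolding L2sq_def by (rule nn_integral_sum) measurable
  finally show ?thesis .
qed

text \<open>
  Jensen's inequality for the average along the segment, followed by Tonelli. This is the form in which the
  gradient enters the Sobolev inequality.
\<close>

lemma weak_gradient_translation_bound:
  assumes wg: "vector_weak_gradient u G"
  shows "L2sq (\<lambda>x. u (x + y) - u x) \<le> ennreal ((norm y)\<^sup>2) * L2sq G"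
proof -
  note [measurable] = vector_weak_gradient_measurable[OF wg]
  have comp: "L2sq (\<lambda>x. (u (x + y) - u x) $ \<alpha>) \<le> ennreal ((norm y)\<^sup>2) * L2sq (\<lambda>x. G x $ \<alpha>)" for \<alpha>
  proof -
    let ?I = "\<lambda>x t. ennreal ((norm y)\<^sup>2) * ennreal ((norm (G (x + t *\<^sub>R y) $ \<alpha>))\<^sup>2)"
    have "L2sq (\<lambda>x. (u (x + y) - u x) $ \<alpha>)
      \<le> (\<integral>\<^sup>+x. (\<integral>\<^sup>+t. ?I x t \<partial>unit_interval) \<partial>lborel)"
      unfolding L2sq_def
    proof (rule nn_integral_mono_AE)
      show "AE x in lborel. ennreal ((norm ((u (x + y) - u x) $ \<alpha>))\<^sup>2)
        \<le> (\<integral>\<^sup>+t. ?I x t \<partial>unit_interval)"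
        using weak_gradient_segment[OF wg[unfolded vector_weak_gradient_def, rule_format, of \<alpha>], of y]
      proof eventually_elim
        case (elim x)
        have "ennreal ((norm ((u (x + y) - u x) $ \<alpha>))\<^sup>2) = ennreal ((\<integral>t. G (x + t *\<^sub>R y) $ \<alpha> \<bullet> y \<partial>unit_interval)\<^sup>2)"
          using elim by simp
        also have "\<dots> \<le> (\<integral>\<^sup>+t. ennreal ((G (x + t *\<^sub>R y) $ \<alpha> \<bullet> y)\<^sup>2) \<partial>unit_interval)"
          by (rule Jensen_unit_interval) measurable
        also have "\<dots> \<le> (\<integral>\<^sup>+t. ?I x t \<partial>unit_interval)"
        proof (rule nn_integral_mono)
          fix t
          have "(G (x + t *\<^sub>R y) $ \<alpha> \<bullet> y)\<^sup>2 \<le> (norm (G (x + t *\<^sub>R y) $ \<alpha>) * norm y)\<^sup>2"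
            by (rule abs_le_square_iff[THEN iffD1]) (simp add: Cauchy_Schwarz_ineq2)
          then show "ennreal ((G (x + t *\<^sub>R y) $ \<alpha> \<bullet> y)\<^sup>2) \<le> ?I x t"
            by (simp add: power_mult_distrib mult.commute flip: ennreal_mult)
        qed
        finally show ?case .
      qed
    qed
    also have "\<dots> = (\<integral>\<^sup>+t. (\<integral>\<^sup>+x. ?I x t \<partial>lborel) \<partial>unit_interval)"
      by (rule lborel_unit.Fubini'[symmetric]) measurable
    also have "\<dots> = (\<integral>\<^sup>+t. ennreal ((norm y)\<^sup>2) * L2sq (\<lambda>x. G x $ \<alpha>) \<partial>unit_interval)"
    proof (rule nn_integral_cong)
      fix t
      have "(\<integral>\<^sup>+x. ?I x t \<partial>lborel)
         = ennreal ((norm y)\<^sup>2) * L2sq (\<lambda>x. G (x + t *\<^sub>R y) $ \<alpha>)"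
        unfolding L2sq_def by (rule nn_integral_cmult) measurable
      also have "L2sq (\<lambda>x. G (x + t *\<^sub>R y) $ \<alpha>) = L2sq (\<lambda>x. G x $ \<alpha>)"
        by (rule L2sq_translate[of "\<lambda>x. G x $ \<alpha>"]) measurable
      finally show "(\<integral>\<^sup>+x. ?I x t \<partial>lborel)
         = ennreal ((norm y)\<^sup>2) * L2sq (\<lambda>x. G x $ \<alpha>)" .
    qed
    also have "\<dots> = ennreal ((norm y)\<^sup>2) * L2sq (\<lambda>x. G x $ \<alpha>)"
      by (simp add: unit_interval.emeasure_space_1)
    finally show ?thesis .
  qed
  have "L2sq (\<lambda>x. u (x + y) - u x) = (\<Sum>\<alpha>\<in>UNIV. L2sq (\<lambda>x. (u (x + y) - u x) $ \<alpha>))"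
    by (rule L2sq_components) measurable
  also have "\<dots> \<le> (\<Sum>\<alpha>\<in>UNIV. ennreal ((norm y)\<^sup>2) * L2sq (\<lambda>x. G x $ \<alpha>))"
    by (intro sum_mono comp)
  also have "\<dots> = ennreal ((norm y)\<^sup>2) * L2sq G"
    by (subst L2sq_components[of G]) (auto simp: sum_distrib_left)
  finally show ?thesis .
qed

text \<open>
  A difference quotient minus the gradient is an average of translation errors of the gradient, which vanish by
  continuity of translations in \<open>L\<^sup>2\<close>.
\<close>

lemma diff_quot_tendsto_weak_gradient:
  assumes wg: "vector_weak_gradient u G" and fin: "L2sq G < \<infinity>"
    and h: "\<And>k. h k > 0" "h \<longlonglongrightarrow> 0"
  shows "(\<lambda>k. L2sq (\<lambda>x. diff_quot (h k) u x - G x)) \<longlonglongrightarrow> 0"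
proof -
  note [measurable] = vector_weak_gradient_measurable[OF wg]
  let ?D = "\<lambda>k x \<alpha> j. (diff_quot (h k) u x - G x) $ \<alpha> $ j"
  have entry: "(\<lambda>k. L2sq (\<lambda>x. ?D k x \<alpha> j)) \<longlonglongrightarrow> 0" for \<alpha> j
  proof -
    define g where "g x = G x $ \<alpha> $ j" for x
    have [measurable]: "g \<in> borel_measurable borel" unfolding g_def[abs_def] by measurable
    have gfin: "L2sq g < \<infinity>"
    proof -
      have "L2sq g \<le> L2sq G"
        using component_le_norm_cart[of "G _ $ \<alpha>" j] Finite_Cartesian_Product.norm_nth_le[of "G _" \<alpha>]
        by (intro L2sq_mono) (auto simp: g_def intro: order_trans)
      then show ?thesis using fin by (rule le_less_trans)
    qed
    let ?\<tau> = "\<lambda>k t. L2sq (\<lambda>x. g (x + ((2 * t - 1) * h k) *\<^sub>R axis j 1) - g x)"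
    have bound: "L2sq (\<lambda>x. ?D k x \<alpha> j) \<le> (\<integral>\<^sup>+t. ?\<tau> k t \<partial>unit_interval)" for k
    proof -
      let ?e = "h k *\<^sub>R axis j 1 :: real ^ 'a" and ?y = "(2 * h k) *\<^sub>R axis j 1 :: real ^ 'a"
      let ?I = "\<lambda>x t. ennreal ((g (x + t *\<^sub>R ?y) - g (x + ?e))\<^sup>2)"
      have "L2sq (\<lambda>x. ?D k x \<alpha> j) = L2sq (\<lambda>x. ?D k (x + ?e) \<alpha> j)"
        by (rule L2sq_translate[of "\<lambda>x. ?D k x \<alpha> j", symmetric]) measurable
      also have "\<dots> \<le> (\<integral>\<^sup>+x. (\<integral>\<^sup>+t. ?I x t \<partial>unit_interval) \<partial>lborel)"
        unfolding L2sq_def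
      proof (rule nn_integral_mono_AE)
        show "AE x in lborel. ennreal ((norm (?D k (x + ?e) \<alpha> j))\<^sup>2)
          \<le> (\<integral>\<^sup>+t. ?I x t \<partial>unit_interval)"
          using weak_gradient_segment[OF wg[unfolded vector_weak_gradient_def, rule_format, of \<alpha>], of ?y]
        proof eventually_elim
          case (elim x)
          have gy: "G (x + t *\<^sub>R ?y) $ \<alpha> \<bullet> ?y = (2 * h k) * g (x + t *\<^sub>R ?y)" for t
            by (simp add: g_def inner_axis)
          have int: "integrable unit_interval (\<lambda>t. g (x + t *\<^sub>R ?y))"
            using elim[THEN conjunct1] h(1)[of k] unfolding gy by simp
          have "(diff_quot (h k) u (x + ?e)) $ \<alpha> $ j = (u (x + ?y) $ \<alpha> - u x $ \<alpha>) / (2 * h k)"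
            by (simp add: diff_quot_def add.assoc scaleR_add_left[symmetric])
          also have "\<dots> = (\<integral>t. g (x + t *\<^sub>R ?y) \<partial>unit_interval)"
            using elim[THEN conjunct2] h(1)[of k] unfolding gy by simp
          finally have "?D k (x + ?e) \<alpha> j = (\<integral>t. g (x + t *\<^sub>R ?y) - g (x + ?e) \<partial>unit_interval)"
            using int unit_interval.prob_space by (simp add: g_def)
          then have "ennreal ((norm (?D k (x + ?e) \<alpha> j))\<^sup>2)
            = ennreal ((\<integral>t. g (x + t *\<^sub>R ?y) - g (x + ?e) \<partial>unit_interval)\<^sup>2)" by simp
          also have "\<dots> \<le> (\<integral>\<^sup>+t. ?I x t \<partial>unit_interval)"
            by (rule Jensen_unit_interval) measurable
          finally show ?case .
        qed
      qed
      also have "\<dots> = (\<integral>\<^sup>+t. (\<integral>\<^sup>+x. ?I x t \<partial>lborel) \<partial>unit_interval)"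
        by (rule lborel_unit.Fubini'[symmetric]) measurable
      also have "\<dots> = (\<integral>\<^sup>+t. ?\<tau> k t \<partial>unit_interval)"
      proof (rule nn_integral_cong)
        fix t
        have "?\<tau> k t = L2sq (\<lambda>x. g ((x + ?e) + ((2 * t - 1) * h k) *\<^sub>R axis j 1) - g (x + ?e))"
          by (rule L2sq_translate[of "\<lambda>x. g (x + ((2 * t - 1) * h k) *\<^sub>R axis j 1) - g x", symmetric]) measurable
        also have "(\<lambda>x. (x + ?e) + ((2 * t - 1) * h k) *\<^sub>R axis j 1) = (\<lambda>x. x + t *\<^sub>R ?y)"
          by (simp add: algebra_simps)
        then have "(\<lambda>x. g ((x + ?e) + ((2 * t - 1) * h k) *\<^sub>R axis j 1) - g (x + ?e)) = (\<lambda>x. g (x + t *\<^sub>R ?y) - g (x + ?e))"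
          by metis
        finally show "(\<integral>\<^sup>+x. ?I x t \<partial>lborel) = ?\<tau> k t"
          by (simp add: L2sq_def)
      qed
      finally show ?thesis .
    qed
    have "(\<lambda>k. \<integral>\<^sup>+t. ?\<tau> k t \<partial>unit_interval) \<longlonglongrightarrow> (\<integral>\<^sup>+t. 0 \<partial>unit_interval)"
    proof (rule nn_integral_dominated_convergence[where w="\<lambda>_. 4 * L2sq g"])
      show "?\<tau> k \<in> borel_measurable unit_interval" for k unfolding L2sq_def by measurable
      have "?\<tau> k t \<le> 4 * L2sq g" for k t
      proof -
        have "?\<tau> k t \<le> 2 * L2sq (\<lambda>x. g (x + ((2 * t - 1) * h k) *\<^sub>R axis j 1)) + 2 * L2sq (\<lambda>x. - g x)"
          using L2sq_add_le2[of "\<lambda>x. g (x + ((2 * t - 1) * h k) *\<^sub>R axis j 1)" "\<lambda>x. - g x"] by simp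
        also have "\<dots> = 4 * L2sq g"
          by (subst L2sq_translate) (simp_all add: L2sq_minus flip: distrib_right)
        finally show ?thesis .
      qed
      then show "AE t in unit_interval. ?\<tau> k t \<le> 4 * L2sq g" for k by simp
      show "(\<integral>\<^sup>+t. 4 * L2sq g \<partial>unit_interval) < \<infinity>"
        using gfin by (simp add: unit_interval.emeasure_space_1 ennreal_mult_less_top)
      show "AE t in unit_interval. (\<lambda>k. ?\<tau> k t) \<longlonglongrightarrow> 0"
      proof (rule AE_I2, rule L2sq_translation_continuous)
        fix t
        have "(\<lambda>k. ((2 * t - 1) * h k) *\<^sub>R axis j 1) \<longlonglongrightarrow> ((2 * t - 1) * 0) *\<^sub>R (axis j 1 :: real ^ 'a)"
          by (intro tendsto_intros h)
        then show "(\<lambda>k. ((2 * t - 1) * h k) *\<^sub>R axis j 1) \<longlonglongrightarrow> (0 :: real ^ 'a)" by simp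
      qed (use gfin in auto)
    qed auto
    then have "(\<lambda>k. \<integral>\<^sup>+t. ?\<tau> k t \<partial>unit_interval) \<longlonglongrightarrow> 0" by simp
    then show ?thesis
      by (rule tendsto_sandwich[OF _ _ tendsto_const, rotated 2]) (use bound in auto)
  qed
  have "(\<lambda>k. \<Sum>\<alpha>\<in>UNIV. \<Sum>j\<in>UNIV. L2sq (\<lambda>x. ?D k x \<alpha> j)) \<longlonglongrightarrow> (\<Sum>\<alpha>\<in>(UNIV::'b set). \<Sum>j\<in>(UNIV::'a set). 0)"
    by (intro tendsto_sum entry)
  moreover have "L2sq (\<lambda>x. diff_quot (h k) u x - G x) = (\<Sum>\<alpha>\<in>UNIV. \<Sum>j\<in>UNIV. L2sq (\<lambda>x. ?D k x \<alpha> j))" for k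
  proof -
    have "L2sq (\<lambda>x. diff_quot (h k) u x - G x) = (\<Sum>\<alpha>\<in>UNIV. L2sq (\<lambda>x. (diff_quot (h k) u x - G x) $ \<alpha>))"
      by (rule L2sq_components) measurable
    also have "\<dots> = (\<Sum>\<alpha>\<in>UNIV. \<Sum>j\<in>UNIV. L2sq (\<lambda>x. ?D k x \<alpha> j))"
      by (intro sum.cong refl L2sq_components) measurable
    finally show ?thesis .
  qed
  ultimately show ?thesis by simp
qed

text \<open>
  The limit \<open>h \<rightarrow> 0\<close> in the bound for difference quotients. The condition on \<open>shrink\<close> is the form in which
  membership of \<open>u\<close> in some \<open>L\<^sup>p\<close> enters.
\<close>

lemma rank_one_bound_weak_gradient:
  fixes u :: "real ^ 'n::finite \<Rightarrow> real ^ 'm::finite" and A :: "real ^ 'n ^ 'm \<Rightarrow> 'b::euclidean_space"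
  assumes A: "linear A" and \<nu>: "\<nu> \<ge> 0" "\<And>\<eta> a. \<nu> * norm (tensor \<eta> a) \<le> norm (A (tensor \<eta> a))"
    and wg: "vector_weak_gradient u G" and fin: "L2sq G < \<infinity>"
    and shr: "\<And>\<epsilon>. \<epsilon> > 0 \<Longrightarrow> L2sq (\<lambda>x. shrink \<epsilon> (u x)) < \<infinity>"
  shows "ennreal (\<nu>\<^sup>2) * L2sq G \<le> L2sq (\<lambda>x. A (G x))"
proof -
  note [measurable] = vector_weak_gradient_measurable[OF wg]
  define h where "h k = inverse (real (Suc k))" for k
  have h: "h k > 0" for k by (simp add: h_def)
  show ?thesis
  proof (rule L2sq_lower_bound_closed[OF A, where f="\<lambda>k. diff_quot (h k) u"])
    show "(\<lambda>k. L2sq (\<lambda>x. diff_quot (h k) u x - G x)) \<longlonglongrightarrow> 0"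
      by (rule diff_quot_tendsto_weak_gradient[OF wg fin h]) (unfold h_def, rule LIMSEQ_inverse_real_of_nat)
    have "L2sq (diff_quot (h k) u) < \<infinity>" for k
    proof -
      have "L2sq (diff_quot (h k) u) \<le> of_nat CARD('n) * L2sq G"
      proof (rule L2sq_diff_quot_le)
        show "L2sq (\<lambda>x. u (x + (2 * h k) *\<^sub>R axis j 1) - u x) \<le> ennreal ((2 * h k)\<^sup>2) * L2sq G" for j
          using weak_gradient_translation_bound[OF wg, of "(2 * h k) *\<^sub>R axis j 1"] h[of k] by simp
      qed (use h in auto)
      also have "\<dots> < \<infinity>" using fin by (simp add: ennreal_mult_less_top of_nat_less_top)
      finally show ?thesis .
    qed
    then show "ennreal (\<nu>\<^sup>2) * L2sq (diff_quot (h k) u) \<le> L2sq (\<lambda>x. A (diff_quot (h k) u x))" for k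
      by (intro rank_one_bound_diff_quot[OF A \<nu>] h shr) auto
  qed (use fin in auto)
qed


section \<open>The Sobolev inequality by dyadic layers\<close>

abbreviation Lp_integral :: "real \<Rightarrow> ('a::euclidean_space \<Rightarrow> 'b::euclidean_space) \<Rightarrow> ennreal" where
  "Lp_integral p f \<equiv> \<integral>\<^sup>+x. ennreal (norm (f x) powr p) \<partial>lborel"

definition translation_energy :: "('a::euclidean_space \<Rightarrow> real) \<Rightarrow> 'a \<Rightarrow> ennreal" where
  "translation_energy g y = L2sq (\<lambda>x. g (x + y) - g x)"

text \<open>
  Translation energies averaged over a cube of side \<open>r\<close>. Working with these instead of gradients avoids a chain
  rule for truncations: truncations act on differences pointwise.
\<close>

definition mean_energy :: "('a::euclidean_space \<Rightarrow> real) \<Rightarrow> real \<Rightarrow> ennreal" where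
  "mean_energy g r = (\<integral>\<^sup>+y. translation_energy g (r *\<^sub>R y) * indicator (cbox 0 One) y \<partial>lborel)"

lemma borel_measurable_translation_energy [measurable]:
  assumes [measurable]: "g \<in> borel_measurable borel"
  shows "(\<lambda>y. translation_energy g (r *\<^sub>R y)) \<in> borel_measurable borel"
  unfolding translation_energy_def L2sq_def by measurable

lemma cbox_borel [measurable]: "cbox a b \<in> sets (borel :: 'a::euclidean_space measure)"
  by simp

lemma emeasure_unit_cube: "emeasure lborel (cbox 0 One :: 'a::euclidean_space set) = 1"
  by (subst emeasure_lborel_cbox) auto

lemma nn_integral_lborel_affine:
  fixes f :: "'a::euclidean_space \<Rightarrow> ennreal"
  assumes [measurable]: "f \<in> borel_measurable borel" and r: "r > 0"
  shows "(\<integral>\<^sup>+x. f x \<partial>lborel) = ennreal (r ^ DIM('a)) * (\<integral>\<^sup>+y. f (x + r *\<^sub>R y) \<partial>lborel)"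
proof -
  have "(\<integral>\<^sup>+x. f x \<partial>lborel) = (\<integral>\<^sup>+y. f y \<partial>density (distr lborel borel (\<lambda>y. x + r *\<^sub>R y)) (\<lambda>_. \<bar>r\<bar> ^ DIM('a)))"
    using lborel_affine[of r x] r by simp
  also have "\<dots> = (\<integral>\<^sup>+y. ennreal (r ^ DIM('a)) * f (x + r *\<^sub>R y) \<partial>lborel)"
    using r by (simp add: nn_integral_density nn_integral_distr)
  also have "\<dots> = ennreal (r ^ DIM('a)) * (\<integral>\<^sup>+y. f (x + r *\<^sub>R y) \<partial>lborel)"
    by (rule nn_integral_cmult) measurable
  finally show ?thesis .
qed

text \<open>
  If the support of \<open>g\<close> fills at most half of a cube of side \<open>r\<close>, then from every point at least half of the
  translations in that cube lead to a zero of \<open>g\<close>, and each of them contributes \<open>(g x)\<^sup>2\<close> to the energy.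
\<close>

lemma Faber_Krahn:
  fixes g :: "'a::euclidean_space \<Rightarrow> real"
  assumes [measurable]: "g \<in> borel_measurable borel"
    and V: "emeasure lborel {x. g x \<noteq> 0} \<le> ennreal V" and r: "r > 0" "2 * V \<le> r ^ DIM('a)"
  shows "L2sq g \<le> 2 * mean_energy g r"
proof -
  let ?Q = "cbox 0 One :: 'a set"
  let ?z = "\<lambda>x y. indicator ?Q y * (if g (x + r *\<^sub>R y) = 0 then 1 else 0)"
  let ?d = "\<lambda>x y. ennreal ((norm (g (x + r *\<^sub>R y) - g x))\<^sup>2) * indicator ?Q y"
  have S[measurable]: "{x. g x \<noteq> 0} \<in> sets borel"
  proof -
    have "{x \<in> space borel. g x \<noteq> 0} \<in> sets borel" by measurable
    then show ?thesis by simp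
  qed
  have half: "ennreal (1/2) \<le> (\<integral>\<^sup>+y. ?z x y \<partial>lborel)" for x
  proof -
    let ?J = "\<integral>\<^sup>+y. indicator {x. g x \<noteq> 0} (x + r *\<^sub>R y) \<partial>lborel"
    let ?I = "\<integral>\<^sup>+y. ?z x y \<partial>lborel"
    have "ennreal (r ^ DIM('a)) * ?J = (\<integral>\<^sup>+y. indicator {x. g x \<noteq> 0} y \<partial>lborel)"
      by (rule nn_integral_lborel_affine[symmetric]) (use r in auto)
    also have "\<dots> = emeasure lborel {x. g x \<noteq> 0}" by simp
    also have "\<dots> \<le> ennreal (r ^ DIM('a) * (1/2))"
      using V r by (elim order_trans) (auto intro!: ennreal_leI)
    also have "\<dots> = ennreal (r ^ DIM('a)) * ennreal (1/2)"
      using r by (intro ennreal_mult) auto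
    finally have J: "?J \<le> ennreal (1/2)"
      using r by (subst (asm) ennreal_mult_le_mult_iff) auto
    have "1 = (\<integral>\<^sup>+y. indicator ?Q y \<partial>lborel)" by (simp add: emeasure_unit_cube)
    also have "\<dots> \<le> (\<integral>\<^sup>+y. ?z x y + indicator {x. g x \<noteq> 0} (x + r *\<^sub>R y) \<partial>lborel)"
      by (intro nn_integral_mono) (auto simp: indicator_def)
    also have "\<dots> = ?I + ?J" by (rule nn_integral_add) measurable
    also have "\<dots> \<le> ?I + ennreal (1/2)" using J by (rule add_left_mono)
    finally have I: "1 \<le> ?I + ennreal (1/2)" .
    show ?thesis
    proof (cases ?I)
      case (real i)
      then have "ennreal 1 \<le> ennreal (i + 1/2)" using I by (subst ennreal_plus) auto
      then have "1 \<le> i + 1/2" using real(1) by (subst (asm) ennreal_le_iff) auto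
      then have "ennreal (1/2) \<le> ennreal i" by (intro ennreal_leI) simp
      then show ?thesis by (simp only: real(2))
    qed (simp only: top_greatest)
  qed
  have "mean_energy g r = (\<integral>\<^sup>+y. (\<integral>\<^sup>+x. ?d x y \<partial>lborel) \<partial>lborel)"
    unfolding mean_energy_def translation_energy_def L2sq_def
    by (intro nn_integral_cong nn_integral_multc[symmetric]) measurable
  also have "\<dots> = (\<integral>\<^sup>+x. (\<integral>\<^sup>+y. ?d x y \<partial>lborel) \<partial>lborel)"
    by (rule lborel_pair.Fubini') measurable
  finally have m: "mean_energy g r = (\<integral>\<^sup>+x. (\<integral>\<^sup>+y. ?d x y \<partial>lborel) \<partial>lborel)" .
  have "ennreal (1/2) * L2sq g = (\<integral>\<^sup>+x. ennreal ((norm (g x))\<^sup>2) * ennreal (1/2) \<partial>lborel)"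
    unfolding L2sq_def by (subst nn_integral_multc) (auto simp: mult.commute)
  also have "\<dots> \<le> mean_energy g r"
    unfolding m
  proof (rule nn_integral_mono)
    fix x
    have "ennreal ((norm (g x))\<^sup>2) * ennreal (1/2)
      \<le> ennreal ((norm (g x))\<^sup>2) * (\<integral>\<^sup>+y. ?z x y \<partial>lborel)"
      by (intro mult_left_mono half) auto
    also have "\<dots> = (\<integral>\<^sup>+y. ennreal ((norm (g x))\<^sup>2) * (?z x y) \<partial>lborel)"
      by (rule nn_integral_cmult[symmetric]) measurable
    also have "\<dots> \<le> (\<integral>\<^sup>+y. ?d x y \<partial>lborel)"
      by (intro nn_integral_mono) (auto simp: indicator_def)
    finally show "ennreal ((norm (g x))\<^sup>2) * ennreal (1/2)
      \<le> (\<integral>\<^sup>+y. ?d x y \<partial>lborel)" .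
  qed
  finally have "2 * (ennreal (1/2) * L2sq g) \<le> 2 * mean_energy g r" by (rule mult_left_mono) simp
  moreover have "2 * (ennreal (1/2) * L2sq g) = L2sq g"
  proof -
    have "2 * (ennreal (1/2) * L2sq g) = ennreal (2 * (1/2)) * L2sq g"
      by (subst ennreal_mult) (auto simp: mult.assoc)
    then show ?thesis by simp
  qed
  ultimately show ?thesis by simp
qed

lemma translation_energy_multiple:
  fixes g :: "'a::euclidean_space \<Rightarrow> real"
  assumes [measurable]: "g \<in> borel_measurable borel"
  shows "translation_energy g (real M *\<^sub>R y) \<le> ennreal ((real M)\<^sup>2) * translation_energy g y"
proof -
  let ?d = "\<lambda>x. g (x + y) - g x"
  have point: "(norm (g (x + real M *\<^sub>R y) - g x))\<^sup>2 \<le> (\<Sum>i<M. real M * (norm (?d (x + real i *\<^sub>R y)))\<^sup>2)" for x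
  proof -
    have "g (x + real M *\<^sub>R y) - g x = (\<Sum>i<M. g (x + real (Suc i) *\<^sub>R y) - g (x + real i *\<^sub>R y))"
      using sum_lessThan_telescope[of "\<lambda>i. g (x + real i *\<^sub>R y)" M] by simp
    also have "\<dots> = (\<Sum>i<M. ?d (x + real i *\<^sub>R y))"
      by (intro sum.cong refl) (simp add: algebra_simps)
    finally have "(g (x + real M *\<^sub>R y) - g x)\<^sup>2 \<le> (\<Sum>i<M. (?d (x + real i *\<^sub>R y))\<^sup>2) * real (card {..<M})"
      using sum_squared_le_sum_of_squares[of "\<lambda>i. ?d (x + real i *\<^sub>R y)" "{..<M}"] by simp
    then show ?thesis by (simp add: sum_distrib_right sum_distrib_left mult.commute)
  qed
  have "translation_energy g (real M *\<^sub>R y) \<le> (\<integral>\<^sup>+x. (\<Sum>i<M. ennreal (real M) * ennreal ((norm (?d (x + real i *\<^sub>R y)))\<^sup>2)) \<partial>lborel)"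
    unfolding translation_energy_def L2sq_def
    using point by (intro nn_integral_mono) (simp add: sum_ennreal ennreal_leI flip: ennreal_mult)
  also have "\<dots> = (\<Sum>i<M. ennreal (real M) * L2sq (\<lambda>x. ?d (x + real i *\<^sub>R y)))"
    unfolding L2sq_def by (simp add: nn_integral_sum nn_integral_cmult)
  also have "\<dots> = (\<Sum>i<M. ennreal (real M) * translation_energy g y)"
    unfolding translation_energy_def by (subst L2sq_translate[of ?d]) auto
  also have "\<dots> = ennreal ((real M)\<^sup>2) * translation_energy g y"
    by (simp add: power2_eq_square ennreal_mult mult.assoc ennreal_of_nat_eq_real_of_nat)
  finally show ?thesis .
qed

lemma mean_energy_multiple:
  fixes g :: "'a::euclidean_space \<Rightarrow> real"
  assumes [measurable]: "g \<in> borel_measurable borel"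
  shows "mean_energy g (real M * \<rho>) \<le> ennreal ((real M)\<^sup>2) * mean_energy g \<rho>"
proof -
  have "mean_energy g (real M * \<rho>) \<le> (\<integral>\<^sup>+y. ennreal ((real M)\<^sup>2) * (translation_energy g (\<rho> *\<^sub>R y) * indicator (cbox 0 One) y) \<partial>lborel)"
    unfolding mean_energy_def
  proof (rule nn_integral_mono)
    fix y :: 'a
    show "translation_energy g ((real M * \<rho>) *\<^sub>R y) * indicator (cbox 0 One) y
      \<le> ennreal ((real M)\<^sup>2) * (translation_energy g (\<rho> *\<^sub>R y) * indicator (cbox 0 One) y)"
      using translation_energy_multiple[OF assms, of M "\<rho> *\<^sub>R y"]
      by (simp add: mult.assoc[symmetric] mult_right_mono)
  qed
  also have "\<dots> = ennreal ((real M)\<^sup>2) * mean_energy g \<rho>"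
    unfolding mean_energy_def by (rule nn_integral_cmult) measurable
  finally show ?thesis .
qed

lemma mean_energy_le:
  fixes g :: "'a::euclidean_space \<Rightarrow> real"
  assumes le: "\<And>y. translation_energy g y \<le> ennreal ((norm y)\<^sup>2 * E)" and E: "0 \<le> E"
  shows "mean_energy g \<rho> \<le> ennreal (real DIM('a) * \<rho>\<^sup>2 * E)"
proof -
  have "mean_energy g \<rho> \<le> (\<integral>\<^sup>+y. ennreal (real DIM('a) * \<rho>\<^sup>2 * E) * indicator (cbox 0 One :: 'a set) y \<partial>lborel)"
    unfolding mean_energy_def
  proof (rule nn_integral_mono)
    fix y :: 'a
    have "(norm (\<rho> *\<^sub>R y))\<^sup>2 * E \<le> real DIM('a) * \<rho>\<^sup>2 * E" if y: "y \<in> cbox 0 One"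
    proof -
      have "(norm y)\<^sup>2 = (\<Sum>b\<in>Basis. (y \<bullet> b)\<^sup>2)"
        by (subst power2_norm_eq_inner, subst euclidean_inner) (simp add: power2_eq_square)
      also have "\<dots> \<le> (\<Sum>b\<in>(Basis::'a set). 1)"
        using y by (intro sum_mono) (auto simp: mem_box power_le_one)
      finally have "(norm y)\<^sup>2 \<le> real DIM('a)" by simp
      then have "(\<rho>\<^sup>2 * (norm y)\<^sup>2) * E \<le> (\<rho>\<^sup>2 * real DIM('a)) * E"
        using E by (intro mult_right_mono mult_left_mono) auto
      then show ?thesis by (simp add: power_mult_distrib mult_ac)
    qed
    then show "translation_energy g (\<rho> *\<^sub>R y) * indicator (cbox 0 One) y \<le> ennreal (real DIM('a) * \<rho>\<^sup>2 * E) * indicator (cbox 0 One) y"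
      using order_trans[OF le[of "\<rho> *\<^sub>R y"] ennreal_leI] by (auto simp: indicator_def)
  qed
  also have "\<dots> = ennreal (real DIM('a) * \<rho>\<^sup>2 * E)"
    by (subst nn_integral_cmult_indicator) (auto simp: emeasure_unit_cube)
  finally show ?thesis .
qed

text \<open>
  The part of \<open>t\<close> between the levels $L/2^{k+1}$ and $L/2^k$.
\<close>

definition layer :: "real \<Rightarrow> nat \<Rightarrow> real \<Rightarrow> real" where
  "layer L k t = max (t - L / 2 ^ Suc k) 0 - max (t - L / 2 ^ k) 0"

lemma layer_mono: "L > 0 \<Longrightarrow> a \<le> b \<Longrightarrow> layer L k a \<le> layer L k b"
proof -
  assume "L > 0" "a \<le> b"
  moreover from this have "L / 2 ^ Suc k \<le> L / 2 ^ k" by (simp add: field_simps)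
  ultimately show ?thesis by (simp add: layer_def max_def)
qed

lemma sum_layer: "(\<Sum>k<K. layer L k t) = max (t - L / 2 ^ K) 0 - max (t - L) 0"
  unfolding layer_def using sum_lessThan_telescope[of "\<lambda>k. max (t - L / 2 ^ k) 0" K] by simp

text \<open>
  The layers are monotone functions whose sum is \<open>1\<close>-Lipschitz, so already the absolute differences add up to
  at most \<open>\<bar>a - b\<bar>\<close>.
\<close>

lemma sum_layer_diff_square:
  assumes "L > 0"
  shows "(\<Sum>k<K. (layer L k a - layer L k b)\<^sup>2) \<le> (a - b)\<^sup>2"
proof -
  have main: "(\<Sum>k<K. (layer L k a - layer L k b)\<^sup>2) \<le> (a - b)\<^sup>2" if "b \<le> a" for a b
  proof -
    let ?d = "\<lambda>k. layer L k a - layer L k b"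
    have d: "0 \<le> ?d k" for k using layer_mono[OF assms that, of k] by simp
    have s: "(\<Sum>k<K. ?d k) \<le> a - b"
    proof -
      have "L / 2 ^ K \<le> L" using assms by (simp add: divide_le_eq)
      then show ?thesis using that by (auto simp: sum_subtractf sum_layer max_def)
    qed
    have "(\<Sum>k<K. (?d k)\<^sup>2) \<le> (\<Sum>k<K. ?d k * (\<Sum>k<K. ?d k))"
      unfolding power2_eq_square using d by (intro sum_mono mult_left_mono member_le_sum) auto
    also have "\<dots> = (\<Sum>k<K. ?d k)\<^sup>2" by (simp add: power2_eq_square sum_distrib_right)
    also have "\<dots> \<le> (a - b)\<^sup>2" using s d by (intro power_mono sum_nonneg) auto
    finally show ?thesis .
  qed
  show ?thesis
  proof (cases "b \<le> a")
    case False
    then show ?thesis using main[of a b] by (simp add: power2_commute)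
  qed (rule main)
qed

lemma sum_mean_energy_layer:
  fixes f :: "'a::euclidean_space \<Rightarrow> real"
  assumes [measurable]: "f \<in> borel_measurable borel" and L: "L > 0"
  shows "(\<Sum>k<K. mean_energy (\<lambda>x. layer L k (f x)) \<rho>) \<le> mean_energy f \<rho>"
proof -
  have [measurable]: "layer L k \<in> borel_measurable borel" for k
    unfolding layer_def[abs_def] by measurable
  have te: "(\<Sum>k<K. translation_energy (\<lambda>x. layer L k (f x)) y) \<le> translation_energy f y" for y
  proof -
    have "(\<Sum>k<K. translation_energy (\<lambda>x. layer L k (f x)) y)
       = (\<integral>\<^sup>+x. (\<Sum>k<K. ennreal ((norm (layer L k (f (x + y)) - layer L k (f x)))\<^sup>2)) \<partial>lborel)"
      unfolding translation_energy_def L2sq_def by (rule nn_integral_sum[symmetric]) measurable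
    also have "\<dots> \<le> translation_energy f y"
      unfolding translation_energy_def L2sq_def
      using sum_layer_diff_square[OF L] by (intro nn_integral_mono) (simp add: sum_ennreal ennreal_leI)
    finally show ?thesis .
  qed
  have "(\<Sum>k<K. mean_energy (\<lambda>x. layer L k (f x)) \<rho>)
    = (\<integral>\<^sup>+y. (\<Sum>k<K. translation_energy (\<lambda>x. layer L k (f x)) (\<rho> *\<^sub>R y) * indicator (cbox 0 One) y) \<partial>lborel)"
    unfolding mean_energy_def by (rule nn_integral_sum[symmetric]) measurable
  also have "\<dots> \<le> mean_energy f \<rho>"
    unfolding mean_energy_def sum_distrib_right[symmetric]
    by (intro nn_integral_mono mult_right_mono te) auto
  finally show ?thesis .
qed


text \<open>
  With \<open>V k\<close> the measure of the superlevel set at level $s_k = L/2^k$, applying \<open>Faber_Krahn\<close> to the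
  \<open>k\<close>-th layer bounds $s_k^p V_k$ by a constant times $(s_{k+1}^p V_{k+1})^{2/n} E_k$, where $E_k$ is
  the energy of the layer; this is where the value of \<open>p\<close> enters. Estimating the first factor by Markov's
  inequality and summing the energies gives $I \le C I^{2/n} E$ for the integral \<open>I\<close> of $f^p$, which can be
  divided since \<open>I\<close> is finite.
\<close>

lemma Sobolev_bounded:
  fixes f :: "'a::euclidean_space \<Rightarrow> real" and p L I E :: real
  assumes n: "DIM('a) \<ge> 3" and p: "p = 2 * real DIM('a) / (real DIM('a) - 2)"
    and [measurable]: "f \<in> borel_measurable borel" and f: "\<And>x. 0 \<le> f x" "\<And>x. f x \<le> L" and L: "L > 0"
    and I: "(\<integral>\<^sup>+x. ennreal (f x powr p) \<partial>lborel) = ennreal I" "0 \<le> I"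
    and E: "0 \<le> E" and le: "\<And>y. translation_energy f y \<le> ennreal ((norm y)\<^sup>2 * E)"
  shows "I powr (2 / p) \<le> 16 * 4 powr p * real DIM('a) * E"
proof -
  let ?n = "real DIM('a)"
  have p0: "p > 2" using n by (simp add: p field_simps)
  have pn: "p * (2 / ?n) = p - 2" and pn': "1 - 2 / ?n = 2 / p" using n by (simp_all add: p field_simps)
  define s where "s k = L / 2 ^ k" for k :: nat
  have s: "s k > 0" "s k = 2 * s (Suc k)" for k using L by (simp_all add: s_def)
  define g where "g k x = layer L k (f x)" for k x
  have [measurable]: "layer L k \<in> borel_measurable borel" for k
    unfolding layer_def[abs_def] by measurable
  have gm[measurable]: "g k \<in> borel_measurable borel" for k unfolding g_def[abs_def] by measurable
  have Sm[measurable]: "{x. s k < f x} \<in> sets borel" for k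
  proof -
    have "{x \<in> space borel. s k < f x} \<in> sets borel" by measurable
    then show ?thesis by simp
  qed
  define V where "V k = measure lborel {x. s k < f x}" for k
  let ?V = "\<lambda>k. emeasure lborel {x. s k < f x}"
  have Markov: "ennreal (s k powr p) * ?V k \<le> ennreal I" for k
  proof -
    have "ennreal (s k powr p) * ?V k = (\<integral>\<^sup>+x. ennreal (s k powr p) * indicator {x. s k < f x} x \<partial>lborel)"
      by (subst nn_integral_cmult_indicator) auto
    also have "\<dots> \<le> (\<integral>\<^sup>+x. ennreal (f x powr p) \<partial>lborel)"
      using s(1)[of k] p0 by (intro nn_integral_mono) (auto simp: indicator_def intro!: ennreal_leI powr_mono2)
    finally show ?thesis by (simp add: I)
  qed
  have Vfin: "?V k = ennreal (V k)" for k
  proof -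
    have "?V k \<noteq> \<infinity>"
    proof
      assume "?V k = \<infinity>"
      then show False using Markov[of k] s(1)[of k] by (simp add: ennreal_mult_top top_unique)
    qed
    then show ?thesis unfolding V_def by (intro emeasure_eq_ennreal_measure) auto
  qed
  have V0: "0 \<le> V k" for k by (simp add: V_def)
  have aI: "s k powr p * V k \<le> I" for k
    using Markov[of k] V0[of k] I(2) by (simp add: Vfin flip: ennreal_mult)
  have Vmono: "V k \<le> V (Suc k)" for k
  proof -
    have "?V k \<le> emeasure lborel {x. s (Suc k) < f x}"
      using s(2)[of k] s(1)[of "Suc k"] by (intro emeasure_mono) auto
    then show ?thesis using V0 by (simp add: Vfin)
  qed
  have g_supp: "emeasure lborel {x. g k x \<noteq> 0} \<le> ennreal (V (Suc k))" for k
  proof -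
    have "{x. g k x \<noteq> 0} \<subseteq> {x. s (Suc k) < f x}"
      using s[of k] s(1)[of "Suc k"] by (auto simp: g_def layer_def s_def[symmetric] max_def simp del: power_Suc split: if_splits)
    then show ?thesis unfolding Vfin[symmetric] by (intro emeasure_mono) auto
  qed
  have g_lower: "ennreal ((s (Suc k))\<^sup>2 * V k) \<le> L2sq (g k)" for k
  proof -
    have "ennreal ((s (Suc k))\<^sup>2 * V k) = (\<integral>\<^sup>+x. ennreal ((s (Suc k))\<^sup>2) * indicator {x. s k < f x} x \<partial>lborel)"
      using V0 by (subst nn_integral_cmult_indicator) (auto simp: Vfin ennreal_mult)
    also have "\<dots> \<le> L2sq (g k)"
      unfolding L2sq_def
    proof (rule nn_integral_mono)
      fix x
      have "g k x = s (Suc k)" if "s k < f x"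
        using that s[of k] s(1)[of "Suc k"] by (simp add: g_def layer_def s_def[symmetric] max_def del: power_Suc)
      then show "ennreal ((s (Suc k))\<^sup>2) * indicator {x. s k < f x} x \<le> ennreal ((norm (g k x))\<^sup>2)"
        by (auto simp: indicator_def)
    qed
    finally show ?thesis .
  qed
  let ?B = "8 * 2 powr p * (2 * I) powr (2 / ?n) * (?n * E)"
  have partial: "(\<Sum>k<K. s k powr p * V k) \<le> ?B" for K
  proof -
    \<comment> \<open>The side of the cube whose volume is twice that of the superlevel set carrying the layer.\<close>
    define b where "b k = (2 * V (Suc k)) powr (1 / ?n)" for k
    \<comment> \<open>One step size for all layers, so that their energies can be summed; the side of the cube is rounded to a multiple of it.\<close>
    define \<rho> where "\<rho> = Min (insert 1 ((\<lambda>k. if V (Suc k) > 0 then b k else 1) ` {..<K}))"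
    have \<rho>: "\<rho> > 0" "\<And>k. k < K \<Longrightarrow> V (Suc k) > 0 \<Longrightarrow> \<rho> \<le> b k"
    proof -
      show "\<rho> > 0" unfolding \<rho>_def by (subst Min_gr_iff) (auto simp: b_def)
      show "\<rho> \<le> b k" if "k < K" "V (Suc k) > 0" for k
        unfolding \<rho>_def by (rule Min_le) (use that in auto)
    qed
    define e where "e k = enn2real (mean_energy (g k) \<rho>) / \<rho>\<^sup>2" for k
    have total: "(\<Sum>k<K. mean_energy (g k) \<rho>) \<le> ennreal (?n * \<rho>\<^sup>2 * E)"
      using sum_mean_energy_layer[of f L \<rho> K] mean_energy_le[OF le E, of \<rho>] L by (simp add: g_def[abs_def])
    have mfin: "mean_energy (g k) \<rho> = ennreal (\<rho>\<^sup>2 * e k)" if "k < K" for k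
    proof -
      have "mean_energy (g k) \<rho> \<le> (\<Sum>k<K. mean_energy (g k) \<rho>)"
        using that by (intro member_le_sum) auto
      also have "\<dots> < \<infinity>" using total by (rule le_less_trans) simp
      finally show ?thesis using \<rho>(1) by (simp add: e_def)
    qed
    have e0: "0 \<le> e k" for k by (simp add: e_def)
    have sum_e: "(\<Sum>k<K. e k) \<le> ?n * E"
    proof -
      have "(\<Sum>k<K. mean_energy (g k) \<rho>) = ennreal (\<Sum>k<K. \<rho>\<^sup>2 * e k)"
        using mfin e0 by (simp add: sum_ennreal)
      then have "(\<Sum>k<K. \<rho>\<^sup>2 * e k) \<le> ?n * \<rho>\<^sup>2 * E"
        using total E by (simp add: ennreal_le_iff)
      then have "\<rho>\<^sup>2 * (\<Sum>k<K. e k) \<le> \<rho>\<^sup>2 * (?n * E)"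
        by (simp add: sum_distrib_left sum_distrib_right mult_ac)
      then show ?thesis using \<rho>(1) by simp
    qed
    have step: "s k powr p * V k \<le> 8 * 2 powr p * (2 * I) powr (2 / ?n) * e k" if k: "k < K" for k
    proof (cases "V (Suc k) > 0")
      case False
      then have "V k = 0" using Vmono[of k] V0[of k] by linarith
      then show ?thesis using e0[of k] by simp
    next
      case True
      then have b0: "b k > 0" by (simp add: b_def)
      define M where "M = nat \<lceil>b k / \<rho>\<rceil>"
      have "b k / \<rho> > 0" using b0 \<rho>(1) by simp
      then have M1: "b k / \<rho> \<le> real M" "real M < b k / \<rho> + 1" unfolding M_def by linarith+
      have M: "b k \<le> real M * \<rho>" "real M * \<rho> \<le> 2 * b k"
      proof -
        show "b k \<le> real M * \<rho>" using M1(1) \<rho>(1) by (simp add: field_simps)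
        have "real M * \<rho> \<le> (b k / \<rho> + 1) * \<rho>" using M1(2) \<rho>(1) by (intro mult_right_mono) auto
        also have "\<dots> = b k + \<rho>" using \<rho>(1) by (simp add: field_simps)
        finally show "real M * \<rho> \<le> 2 * b k" using \<rho>(2)[OF k True] by linarith
      qed
      have bn: "b k ^ DIM('a) = 2 * V (Suc k)" "(b k)\<^sup>2 = (2 * V (Suc k)) powr (2 / ?n)"
        using True n by (simp_all add: b_def powr_powr powr_realpow[symmetric] flip: powr_numeral)
      have r: "real M * \<rho> > 0" "2 * V (Suc k) \<le> (real M * \<rho>) ^ DIM('a)"
      proof -
        show "real M * \<rho> > 0" using M(1) b0 by linarith
        show "2 * V (Suc k) \<le> (real M * \<rho>) ^ DIM('a)"
          unfolding bn(1)[symmetric] using M(1) b0 by (intro power_mono) auto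
      qed
      have "ennreal ((s (Suc k))\<^sup>2 * V k) \<le> 2 * mean_energy (g k) (real M * \<rho>)"
        using g_lower[of k] Faber_Krahn[OF gm g_supp r] by (rule order_trans)
      also have "\<dots> \<le> 2 * (ennreal ((real M)\<^sup>2) * mean_energy (g k) \<rho>)"
        by (intro mult_left_mono mean_energy_multiple) auto
      also have "\<dots> = 2 * (ennreal ((real M)\<^sup>2 * (\<rho>\<^sup>2 * e k)))"
        unfolding mfin[OF k] using e0 by (simp add: ennreal_mult)
      also have "\<dots> = ennreal (2 * ((real M)\<^sup>2 * (\<rho>\<^sup>2 * e k)))"
        using e0 by (subst (2) ennreal_mult) auto
      finally have "(s (Suc k))\<^sup>2 * V k \<le> 2 * ((real M)\<^sup>2 * (\<rho>\<^sup>2 * e k))"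
        using e0 by (subst (asm) ennreal_le_iff) auto
      also have "\<dots> = 2 * (real M * \<rho>)\<^sup>2 * e k" by (simp add: power_mult_distrib)
      also have "\<dots> \<le> 2 * (2 * b k)\<^sup>2 * e k"
        using M r e0 by (intro mult_right_mono mult_left_mono power_mono) auto
      also have "\<dots> = 8 * (2 * V (Suc k)) powr (2 / ?n) * e k" by (simp add: power_mult_distrib bn)
      finally have key: "(s (Suc k))\<^sup>2 * V k \<le> 8 * (2 * V (Suc k)) powr (2 / ?n) * e k" .
      have "s k powr p * V k = 2 powr p * s (Suc k) powr (p - 2) * ((s (Suc k))\<^sup>2 * V k)"
        using s(1)[of "Suc k"] by (subst s(2)) (simp add: powr_mult powr_diff field_simps)
      also have "\<dots> \<le> 2 powr p * s (Suc k) powr (p - 2) * (8 * (2 * V (Suc k)) powr (2 / ?n) * e k)"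
        by (intro mult_left_mono key) auto
      also have "s (Suc k) powr (p - 2) = (s (Suc k) powr p) powr (2 / ?n)"
        by (simp only: powr_powr pn)
      also have "2 powr p * (s (Suc k) powr p) powr (2 / ?n) * (8 * (2 * V (Suc k)) powr (2 / ?n) * e k)
         = 8 * 2 powr p * (2 * (s (Suc k) powr p * V (Suc k))) powr (2 / ?n) * e k"
        using V0[of "Suc k"] by (simp add: powr_mult mult_ac)
      also have "\<dots> \<le> 8 * 2 powr p * (2 * I) powr (2 / ?n) * e k"
        using aI[of "Suc k"] V0 e0[of k] by (intro mult_right_mono mult_left_mono powr_mono2) auto
      finally show ?thesis .
    qed
    have "(\<Sum>k<K. s k powr p * V k) \<le> (\<Sum>k<K. 8 * 2 powr p * (2 * I) powr (2 / ?n) * e k)"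
      by (intro sum_mono step) auto
    also have "\<dots> = 8 * 2 powr p * (2 * I) powr (2 / ?n) * (\<Sum>k<K. e k)" by (simp add: sum_distrib_left)
    also have "\<dots> \<le> ?B" by (intro mult_left_mono sum_e) auto
    finally show ?thesis .
  qed
  have B0: "0 \<le> ?B" using E by simp
  have "I \<le> 2 powr p * ?B"
  proof -
    let ?h = "\<lambda>k x. ennreal (2 powr p) * (ennreal (s k powr p) * indicator {x. s k < f x} x)"
    have "ennreal I = (\<integral>\<^sup>+x. ennreal (f x powr p) \<partial>lborel)" by (simp add: I)
    also have "\<dots> \<le> (\<integral>\<^sup>+x. (\<Sum>k. ?h k x) \<partial>lborel)"
    proof (rule nn_integral_mono)
      fix x
      show "ennreal (f x powr p) \<le> (\<Sum>k. ?h k x)"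
      proof (cases "f x = 0")
        case False
        then have fx: "f x > 0" using f(1)[of x] by simp
        have "\<exists>k. s k < f x"
        proof -
          obtain k where "L / f x < 2 ^ k" using real_arch_pow[of 2 "L / f x"] by auto
          then show ?thesis using fx by (intro exI[of _ k]) (simp add: s_def field_simps)
        qed
        \<comment> \<open>The first level below \<open>f x\<close>; it is at least half of \<open>f x\<close>.\<close>
        define k where "k = (LEAST k. s k < f x)"
        have k: "s k < f x" unfolding k_def by (rule LeastI_ex) fact
        have "k \<noteq> 0" using k f(2)[of x] by (auto simp: s_def intro: ccontr)
        then obtain j where j: "k = Suc j" using not0_implies_Suc by blast
        have "\<not> s j < f x" using not_less_Least[of j "\<lambda>k. s k < f x"] j by (simp add: k_def)
        then have "f x \<le> 2 * s k" using s(2)[of j] j by simp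
        then have "ennreal (f x powr p) \<le> ennreal ((2 * s k) powr p)"
          using f(1) p0 by (intro ennreal_leI powr_mono2) auto
        also have "\<dots> = ?h k x"
          using k s(1)[of k] by (simp add: powr_mult ennreal_mult)
        also have "\<dots> \<le> (\<Sum>k. ?h k x)"
          using sum_le_suminf[of "\<lambda>k. ?h k x" "{k}"] by simp
        finally show ?thesis .
      qed simp
    qed
    also have "\<dots> = (\<Sum>k. \<integral>\<^sup>+x. ?h k x \<partial>lborel)"
      by (rule nn_integral_suminf) measurable
    also have "\<dots> = (\<Sum>k. ennreal (2 powr p * (s k powr p * V k)))"
    proof (rule suminf_cong)
      fix k
      have "(\<integral>\<^sup>+x. ?h k x \<partial>lborel) = ennreal (2 powr p) * (ennreal (s k powr p) * ?V k)"
        by (simp add: nn_integral_cmult nn_integral_cmult_indicator)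
      then show "(\<integral>\<^sup>+x. ?h k x \<partial>lborel) = ennreal (2 powr p * (s k powr p * V k))"
        using V0 by (simp add: Vfin ennreal_mult)
    qed
    also have "\<dots> \<le> ennreal (2 powr p * ?B)"
    proof (rule suminf_le_const)
      fix K
      have "(\<Sum>k<K. ennreal (2 powr p * (s k powr p * V k))) = ennreal (2 powr p * (\<Sum>k<K. s k powr p * V k))"
        using V0 by (simp add: sum_ennreal sum_distrib_left)
      also have "\<dots> \<le> ennreal (2 powr p * ?B)"
        by (intro ennreal_leI mult_left_mono partial) auto
      finally show "(\<Sum>k<K. ennreal (2 powr p * (s k powr p * V k))) \<le> ennreal (2 powr p * ?B)" .
    qed simp
    finally show ?thesis using B0 by (subst (asm) ennreal_le_iff) auto
  qed
  also have "2 powr p * ?B = 8 * (2 powr p * 2 powr p) * 2 powr (2 / ?n) * I powr (2 / ?n) * (?n * E)"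
    using I(2) by (simp add: powr_mult)
  also have "2 powr p * 2 powr p = (4::real) powr p"
    by (simp flip: powr_mult)
  also have "8 * 4 powr p * 2 powr (2 / ?n) * I powr (2 / ?n) * (?n * E) \<le> 8 * 4 powr p * 2 powr 1 * I powr (2 / ?n) * (?n * E)"
    using n E by (intro mult_right_mono mult_left_mono powr_mono) auto
  finally have fin: "I \<le> (16 * 4 powr p * ?n * E) * I powr (2 / ?n)" by (simp add: mult_ac)
  show ?thesis
  proof (cases "I = 0")
    case True
    then show ?thesis using E by simp
  next
    case False
    then have I0: "I > 0" using I(2) by simp
    have "I powr (2 / p) = I / I powr (2 / ?n)"
      unfolding pn'[symmetric] using I0 by (simp add: powr_diff)
    also have "\<dots> \<le> 16 * 4 powr p * ?n * E"
      using fin I0 by (simp add: divide_le_eq)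
    finally show ?thesis .
  qed
qed


text \<open>
  Truncating \<open>norm (u x)\<close> from above does not increase differences, and the constant does not depend on the
  level of truncation.
\<close>

lemma Sobolev_inequality:
  fixes u :: "'a::euclidean_space \<Rightarrow> 'b::euclidean_space" and p E :: real
  assumes n: "DIM('a) \<ge> 3" and p: "p = 2 * real DIM('a) / (real DIM('a) - 2)"
    and [measurable]: "u \<in> borel_measurable borel"
    and fin: "Lp_integral p u < \<infinity>"
    and E: "0 \<le> E" and le: "\<And>y. L2sq (\<lambda>x. u (x + y) - u x) \<le> ennreal ((norm y)\<^sup>2 * E)"
  shows "Lp_integral p u \<le> ennreal ((16 * 4 powr p * real DIM('a) * E) powr (p / 2))"
proof -
  let ?C = "16 * 4 powr p * real DIM('a) * E"
  have p0: "p > 0" using n by (simp add: p)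
  define f where "f k x = min (norm (u x)) (real (Suc k))" for k :: nat and x
  have [measurable]: "f k \<in> borel_measurable borel" for k unfolding f_def[abs_def] by measurable
  have f0: "0 \<le> f k x" for k x by (simp add: f_def)
  have bound: "(\<integral>\<^sup>+x. ennreal (f k x powr p) \<partial>lborel) \<le> ennreal (?C powr (p / 2))" for k
  proof -
    define I where "I = enn2real (\<integral>\<^sup>+x. ennreal (f k x powr p) \<partial>lborel)"
    have "(\<integral>\<^sup>+x. ennreal (f k x powr p) \<partial>lborel) \<le> Lp_integral p u"
      using p0 f0 by (intro nn_integral_mono ennreal_leI powr_mono2) (auto simp: f_def)
    then have I: "(\<integral>\<^sup>+x. ennreal (f k x powr p) \<partial>lborel) = ennreal I"
      using fin by (simp add: I_def)
    have I0: "0 \<le> I" by (simp add: I_def)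
    have "I powr (2 / p) \<le> ?C"
    proof (rule Sobolev_bounded[OF n p _ f0 _ _ I I0 E])
      show "translation_energy (f k) y \<le> ennreal ((norm y)\<^sup>2 * E)" for y
      proof -
        have "norm (f k (x + y) - f k x) \<le> norm (u (x + y) - u x)" for x
          using norm_triangle_ineq3[of "u (x + y)" "u x"] by (auto simp: f_def min_def)
        then have "translation_energy (f k) y \<le> L2sq (\<lambda>x. u (x + y) - u x)"
          unfolding translation_energy_def by (rule L2sq_mono)
        then show ?thesis using le[of y] by (rule order_trans)
      qed
      show "f k x \<le> real (Suc k)" for x by (simp add: f_def)
    qed auto
    then have "(I powr (2 / p)) powr (p / 2) \<le> ?C powr (p / 2)"
      using p0 by (intro powr_mono2) auto
    then have "I \<le> ?C powr (p / 2)" using p0 I0 by (simp add: powr_powr)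
    then show ?thesis unfolding I by (rule ennreal_leI)
  qed
  have inc: "incseq (\<lambda>k x. ennreal (f k x powr p))"
    unfolding incseq_def le_fun_def using f0 p0
    by (auto intro!: ennreal_leI powr_mono2 simp: f_def)
  have "Lp_integral p u \<le> (\<integral>\<^sup>+x. (SUP k. ennreal (f k x powr p)) \<partial>lborel)"
  proof (rule nn_integral_mono)
    fix x
    obtain k where "norm (u x) \<le> real k" using real_arch_simple by blast
    then have "ennreal (norm (u x) powr p) = ennreal (f k x powr p)" by (simp add: f_def)
    also have "\<dots> \<le> (SUP k. ennreal (f k x powr p))" by (rule SUP_upper) simp
    finally show "ennreal (norm (u x) powr p) \<le> (SUP k. ennreal (f k x powr p))" .
  qed
  also have "\<dots> = (SUP k. \<integral>\<^sup>+x. ennreal (f k x powr p) \<partial>lborel)"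
    by (rule nn_integral_monotone_convergence_SUP[OF inc]) measurable
  also have "\<dots> \<le> ennreal (?C powr (p / 2))" by (rule SUP_least) (rule bound)
  finally show ?thesis .
qed


section \<open>The estimate for strictly elliptic systems\<close>

lemma ex_borel_version:
  fixes f :: "'a::euclidean_space \<Rightarrow> 'b::euclidean_space"
  assumes [measurable]: "f \<in> borel_measurable lebesgue"
  obtains g where "g \<in> borel_measurable borel" "AE x in lborel. f x = g x"
proof -
  have "\<forall>b\<in>Basis. \<exists>g\<in>borel_measurable lborel. AE x in lborel. f x \<bullet> b = g x"
    by (intro ballI completion_ex_borel_measurable_real) measurable
  then obtain g where g: "\<And>b. b \<in> Basis \<Longrightarrow> g b \<in> borel_measurable lborel"
    "\<And>b. b \<in> Basis \<Longrightarrow> AE x in lborel. f x \<bullet> b = g b x" by metis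
  have "AE x in lborel. \<forall>b\<in>Basis. f x \<bullet> b = g b x"
    using g(2) by (intro AE_finite_allI) auto
  then have "AE x in lborel. f x = (\<Sum>b\<in>Basis. g b x *\<^sub>R b)"
  proof eventually_elim
    case (elim x)
    have "(\<Sum>b\<in>Basis. g b x *\<^sub>R b) = (\<Sum>b\<in>Basis. (f x \<bullet> b) *\<^sub>R b)"
      using elim by (intro sum.cong) auto
    then show ?case by (simp add: euclidean_representation)
  qed
  moreover have "(\<lambda>x. \<Sum>b\<in>Basis. g b x *\<^sub>R b) \<in> borel_measurable borel"
    using g(1) by (intro borel_measurable_sum borel_measurable_scaleR) auto
  ultimately show thesis using that by blast
qed

lemma locally_integrable_measurable:
  assumes "locally_integrable f"
  shows "f \<in> borel_measurable lebesgue"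
proof (rule borel_measurable_LIMSEQ_metric)
  fix i :: nat
  have "set_integrable lebesgue (cball 0 (real i)) f"
    using assms by (auto simp: locally_integrable_def)
  then show "(\<lambda>x. indicator (cball 0 (real i)) x *\<^sub>R f x) \<in> borel_measurable lebesgue"
    unfolding set_integrable_def by (rule borel_measurable_integrable)
next
  fix x :: 'a
  obtain K where "norm x \<le> real K" using real_arch_simple by blast
  then show "(\<lambda>i. indicator (cball 0 (real i)) x *\<^sub>R f x) \<longlonglongrightarrow> f x"
    by (intro tendsto_eventually eventually_sequentiallyI[of K]) auto
qed

lemma locally_integrable_diff:
  "locally_integrable f \<Longrightarrow> locally_integrable g \<Longrightarrow> locally_integrable (\<lambda>x. f x - g x)"
  by (auto simp: locally_integrable_def)

lemma locally_integrable_times: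
  fixes f :: "'a::euclidean_space \<Rightarrow> 'b::euclidean_space" and T :: "'b \<Rightarrow> real"
  assumes f: "locally_integrable f" and T: "bounded_linear T"
    and g: "g \<in> borel_measurable borel" "\<And>x. \<bar>g x\<bar> \<le> B" "\<And>x. norm x > R \<Longrightarrow> g x = 0"
  shows "integrable lebesgue (\<lambda>x. T (f x) * g x)"
proof -
  have [measurable]: "f \<in> borel_measurable lebesgue" by (rule locally_integrable_measurable[OF f])
  have [measurable]: "T \<in> borel_measurable borel"
    by (intro borel_measurable_continuous_onI linear_continuous_on T)
  have [measurable]: "g \<in> borel_measurable lebesgue" using g(1) by (intro measurable_completion) simp
  have "integrable lebesgue (\<lambda>x. indicator (cball 0 R) x *\<^sub>R f x)"
    using f by (auto simp: locally_integrable_def set_integrable_def)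
  then have "integrable lebesgue (\<lambda>x. T (indicator (cball 0 R) x *\<^sub>R f x))"
    by (rule integrable_bounded_linear[OF T])
  then have i: "integrable lebesgue (\<lambda>x. T (f x) * indicator (cball 0 R) x)"
    by (simp add: linear_scale[OF bounded_linear.linear[OF T]] mult.commute)
  show ?thesis
    by (rule integrable_mult_bounded_support[OF i _ _ g(2)]) (use g(3) in auto)
qed

lemma test_function_measurable_bounds:
  assumes "test_function \<phi>"
  obtains R B where "\<phi> \<in> borel_measurable borel" "\<And>i. partial_deriv i \<phi> \<in> borel_measurable borel"
    "\<And>x. norm x > R \<Longrightarrow> \<phi> x = 0" "\<And>x i. norm x > R \<Longrightarrow> partial_deriv i \<phi> x = 0"
    "\<And>x. \<bar>\<phi> x\<bar> \<le> B" "\<And>x i. \<bar>partial_deriv i \<phi> x\<bar> \<le> B"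
proof -
  have "continuous_on UNIV \<phi>" "continuous_on UNIV (partial_deriv i \<phi>)" for i
    using test_function_continuous[OF assms] by auto
  then have "\<phi> \<in> borel_measurable borel" "\<And>i. partial_deriv i \<phi> \<in> borel_measurable borel"
    by (auto intro: borel_measurable_continuous_onI)
  with test_function_bounds[OF assms] that show thesis by metis
qed

lemma bounded_linear_matrix_entry: "bounded_linear (\<lambda>P::real ^ 'n::finite ^ 'm::finite. P $ \<alpha> $ i)"
  by (rule bounded_linear_compose[OF bounded_linear_vec_nth bounded_linear_vec_nth])

lemma weak_gradient_integrable:
  assumes wg: "has_weak_gradient u Du" and \<phi>: "test_function \<phi>"
  shows "integrable lebesgue (\<lambda>x. u x $ \<alpha> * partial_deriv i \<phi> x)" "integrable lebesgue (\<lambda>x. Du x $ \<alpha> $ i * \<phi> x)"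
proof -
  obtain R B where t: "\<phi> \<in> borel_measurable borel" "\<And>i. partial_deriv i \<phi> \<in> borel_measurable borel"
    "\<And>x. norm x > R \<Longrightarrow> \<phi> x = 0" "\<And>x i. norm x > R \<Longrightarrow> partial_deriv i \<phi> x = 0"
    "\<And>x. \<bar>\<phi> x\<bar> \<le> B" "\<And>x i. \<bar>partial_deriv i \<phi> x\<bar> \<le> B"
    using test_function_measurable_bounds[OF \<phi>] by blast
  have l: "locally_integrable u" "locally_integrable Du" using wg by (auto simp: has_weak_gradient_def)
  show "integrable lebesgue (\<lambda>x. u x $ \<alpha> * partial_deriv i \<phi> x)"
    by (rule locally_integrable_times[OF l(1) bounded_linear_vec_nth]) (use t in auto)
  show "integrable lebesgue (\<lambda>x. Du x $ \<alpha> $ i * \<phi> x)"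
    by (rule locally_integrable_times[OF l(2) bounded_linear_matrix_entry]) (use t in auto)
qed

lemma has_weak_gradient_diff:
  assumes "has_weak_gradient u Du" "has_weak_gradient v Dv"
  shows "has_weak_gradient (\<lambda>x. u x - v x) (\<lambda>x. Du x - Dv x)"
  unfolding has_weak_gradient_def
proof (intro conjI allI impI locally_integrable_diff)
  fix \<phi> :: "real ^ 'a \<Rightarrow> real" and \<alpha> i
  assume \<phi>: "test_function \<phi>"
  note i = weak_gradient_integrable[OF assms(1) \<phi>] weak_gradient_integrable[OF assms(2) \<phi>]
  have e: "(\<integral>x. u x $ \<alpha> * partial_deriv i \<phi> x \<partial>lebesgue) = - (\<integral>x. Du x $ \<alpha> $ i * \<phi> x \<partial>lebesgue)"
    "(\<integral>x. v x $ \<alpha> * partial_deriv i \<phi> x \<partial>lebesgue) = - (\<integral>x. Dv x $ \<alpha> $ i * \<phi> x \<partial>lebesgue)"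
    using assms \<phi> by (auto simp: has_weak_gradient_def)
  have "(\<integral>x. (u x - v x) $ \<alpha> * partial_deriv i \<phi> x \<partial>lebesgue)
      = (\<integral>x. u x $ \<alpha> * partial_deriv i \<phi> x \<partial>lebesgue) - (\<integral>x. v x $ \<alpha> * partial_deriv i \<phi> x \<partial>lebesgue)"
    using i by (simp add: left_diff_distrib)
  also have "\<dots> = - ((\<integral>x. Du x $ \<alpha> $ i * \<phi> x \<partial>lebesgue) - (\<integral>x. Dv x $ \<alpha> $ i * \<phi> x \<partial>lebesgue))"
    by (simp add: e)
  also have "\<dots> = - (\<integral>x. (Du x - Dv x) $ \<alpha> $ i * \<phi> x \<partial>lebesgue)"
    using i by (simp add: left_diff_distrib)
  finally show "(\<integral>x. (u x - v x) $ \<alpha> * partial_deriv i \<phi> x \<partial>lebesgue) = - (\<integral>x. (Du x - Dv x) $ \<alpha> $ i * \<phi> x \<partial>lebesgue)" .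
qed (use assms in \<open>auto simp: has_weak_gradient_def\<close>)

text \<open>
  Passage from Lebesgue measurable maps to Borel representatives, where the preceding results apply.
\<close>

lemma weak_gradient_borel_version:
  assumes wg: "has_weak_gradient u Du"
  obtains u' G where "vector_weak_gradient u' G" "AE x in lborel. u x = u' x" "AE x in lborel. Du x = G x"
proof -
  have l: "locally_integrable u" "locally_integrable Du" using wg by (auto simp: has_weak_gradient_def)
  note [measurable] = locally_integrable_measurable[OF l(1)] locally_integrable_measurable[OF l(2)]
  obtain u' where u'[measurable]: "u' \<in> borel_measurable borel" and ae_u: "AE x in lborel. u x = u' x"
    using ex_borel_version[of u] by auto
  obtain G where G[measurable]: "G \<in> borel_measurable borel" and ae_G: "AE x in lborel. Du x = G x"
    using ex_borel_version[of Du] by auto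
  have [measurable]: "(\<lambda>x. u' x $ \<alpha>) \<in> borel_measurable borel" "(\<lambda>x. G x $ \<alpha>) \<in> borel_measurable borel"
    "(\<lambda>x. G x $ \<alpha> $ i) \<in> borel_measurable borel" for \<alpha> i
    by measurable
  have transfer: "integrable lborel (\<lambda>x. f' x * g x)" "(\<integral>x. f x * g x \<partial>lebesgue) = (LBINT x. f' x * g x)"
    if i: "integrable lebesgue (\<lambda>x. f x * g x)" and ae: "AE x in lborel. f x = f' x"
      and m[measurable]: "f' \<in> borel_measurable borel" "g \<in> borel_measurable borel" for f f' g :: "real ^ 'a \<Rightarrow> real"
  proof -
    have l: "(\<lambda>x. f' x * g x) \<in> borel_measurable lebesgue" by (rule measurable_completion) measurable
    have ae': "AE x in lebesgue. f x * g x = f' x * g x"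
      using ae by (auto simp: AE_completion_iff elim!: eventually_mono)
    have "integrable lebesgue (\<lambda>x. f' x * g x)" by (rule integrable_cong_AE_imp[OF i l ae'])
    then show "integrable lborel (\<lambda>x. f' x * g x)" by (simp add: integrable_completion)
    show "(\<integral>x. f x * g x \<partial>lebesgue) = (LBINT x. f' x * g x)"
      using integral_cong_AE[OF borel_measurable_integrable[OF i] l ae'] by (simp add: integral_completion)
  qed
  have ae: "AE x in lborel. u x $ \<alpha> = u' x $ \<alpha>" "AE x in lborel. Du x $ \<alpha> $ i = G x $ \<alpha> $ i" for \<alpha> i
    by (rule eventually_mono[OF ae_u], simp) (rule eventually_mono[OF ae_G], simp)
  have "vector_weak_gradient u' G"
    unfolding vector_weak_gradient_def borel_weak_gradient_def
  proof (intro allI conjI impI)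
    fix \<alpha> i and K :: "(real ^ 'a) set" assume K: "compact K"
    obtain R where R: "\<forall>x\<in>K. norm x \<le> R"
      using compact_imp_bounded[OF K] unfolding bounded_iff by blast
    have Km: "(indicator K :: _ \<Rightarrow> real) \<in> borel_measurable (borel :: (real ^ 'a) measure)"
      by (intro borel_measurable_indicator borel_compact K)
    have z: "\<bar>indicator K x :: real\<bar> \<le> 1" "norm x > R \<Longrightarrow> indicator K x = (0::real)" for x
      using R by (auto simp: indicator_def)
    show "integrable lborel (\<lambda>x. u' x $ \<alpha> * indicator K x)"
      by (rule transfer(1)[OF locally_integrable_times[OF l(1) bounded_linear_vec_nth Km z] ae(1) _ Km]) measurable
    show "integrable lborel (\<lambda>x. G x $ \<alpha> $ i * indicator K x)"
      by (rule transfer(1)[OF locally_integrable_times[OF l(2) bounded_linear_matrix_entry Km z] ae(2) _ Km]) measurable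
  next
    fix \<alpha> i and \<phi> :: "real ^ 'a \<Rightarrow> real" assume \<phi>: "test_function \<phi>"
    obtain R B where [measurable]: "\<phi> \<in> borel_measurable borel" "\<And>i. partial_deriv i \<phi> \<in> borel_measurable borel"
      using test_function_measurable_bounds[OF \<phi>] by metis
    have eqs: "(\<integral>x. u x $ \<alpha> * partial_deriv i \<phi> x \<partial>lebesgue) = (LBINT x. u' x $ \<alpha> * partial_deriv i \<phi> x)"
      "(\<integral>x. Du x $ \<alpha> $ i * \<phi> x \<partial>lebesgue) = (LBINT x. G x $ \<alpha> $ i * \<phi> x)"
      by (rule transfer(2)[OF weak_gradient_integrable(1)[OF wg \<phi>] ae(1)]; measurable)
         (rule transfer(2)[OF weak_gradient_integrable(2)[OF wg \<phi>] ae(2)]; measurable)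
    have "(\<integral>x. u x $ \<alpha> * partial_deriv i \<phi> x \<partial>lebesgue) = - (\<integral>x. Du x $ \<alpha> $ i * \<phi> x \<partial>lebesgue)"
      using wg \<phi> by (auto simp: has_weak_gradient_def)
    then show "(LBINT x. u' x $ \<alpha> * partial_deriv i \<phi> x) = - (LBINT x. G x $ \<alpha> $ i * \<phi> x)"
      using eqs by simp
  qed measurable
  then show thesis using ae_u ae_G that by blast
qed

lemma weak_gradient_unique:
  assumes "has_weak_gradient u D1" "has_weak_gradient u D2"
  shows "AE x in lborel. D1 x = D2 x"
proof -
  have "has_weak_gradient (\<lambda>x. u x - u x) (\<lambda>x. D1 x - D2 x)" by (rule has_weak_gradient_diff[OF assms])
  then obtain u' G where wg: "vector_weak_gradient u' G" and u': "AE x in lborel. u x - u x = u' x"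
    and G: "AE x in lborel. D1 x - D2 x = G x"
    using weak_gradient_borel_version by blast
  note [measurable] = vector_weak_gradient_measurable[OF wg]
  have "AE x in lborel. G x $ \<alpha> $ i = 0" for \<alpha> i
  proof (rule AE_eq_0_if_test_integrals_eq_0)
    show "integrable lborel (\<lambda>x. G x $ \<alpha> $ i * indicator K x)" if "compact K" for K
      using wg that by (auto simp: vector_weak_gradient_def borel_weak_gradient_def)
    show "(LBINT x. G x $ \<alpha> $ i * \<phi> x) = 0" if \<phi>: "test_function \<phi>" for \<phi>
    proof -
      obtain R B where [measurable]: "partial_deriv i \<phi> \<in> borel_measurable borel"
        using test_function_measurable_bounds[OF \<phi>] by metis
      have "(LBINT x. u' x $ \<alpha> * partial_deriv i \<phi> x) = - (LBINT x. G x $ \<alpha> $ i * \<phi> x)"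
        using wg \<phi> by (auto simp: vector_weak_gradient_def borel_weak_gradient_def)
      moreover have "(LBINT x. u' x $ \<alpha> * partial_deriv i \<phi> x) = 0"
      proof (rule integral_eq_zero_AE)
        show "AE x in lborel. u' x $ \<alpha> * partial_deriv i \<phi> x = 0" using u' by eventually_elim simp
      qed
      ultimately show ?thesis by simp
    qed
  qed measurable
  then have "AE x in lborel. \<forall>\<alpha>\<in>UNIV. \<forall>i\<in>UNIV. G x $ \<alpha> $ i = 0"
    by (intro AE_finite_allI) auto
  with G show ?thesis by eventually_elim (simp add: vec_eq_iff)
qed

lemma norm_tensor: "norm (tensor \<eta> a) = norm \<eta> * norm a"
proof -
  have "(norm (tensor \<eta> a))\<^sup>2 = (norm \<eta> * norm a)\<^sup>2"
    by (simp add: norm_vec_square tensor_def power_mult_distrib sum_product)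
  then show ?thesis by (metis norm_ge_zero power2_eq_imp_eq mult_nonneg_nonneg)
qed

lemma ellipticity_const_tensor_bound:
  fixes A :: "real ^ 'n::finite ^ 'm::finite \<Rightarrow> real ^ 'm"
  assumes A: "linear A"
  shows "ellipticity_const A * norm (tensor \<eta> a) \<le> norm (A (tensor \<eta> a))"
proof (cases "\<eta> = 0 \<or> a = 0")
  case True
  then show ?thesis by (auto simp: norm_tensor)
next
  case False
  let ?\<eta> = "(1 / norm \<eta>) *\<^sub>R \<eta>" and ?a = "(1 / norm a) *\<^sub>R a"
  have "tensor \<eta> a = (norm \<eta> * norm a) *\<^sub>R tensor ?\<eta> ?a"
    using False by (simp add: tensor_def vec_eq_iff)
  then have "norm (A (tensor \<eta> a)) = (norm \<eta> * norm a) * norm (A (tensor ?\<eta> ?a))"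
    by (simp add: linear_scale[OF A])
  moreover have "ellipticity_const A \<le> norm (A (tensor ?\<eta> ?a))"
    by (rule ellipticity_const_is_minimum(2)[OF A]) (use False in auto)
  ultimately show ?thesis by (simp add: norm_tensor mult.commute[of "ellipticity_const A"] mult_left_mono)
qed

text \<open>
  Where the shrunk map does not vanish, \<open>norm (u x)\<close> exceeds \<open>\<epsilon>\<close>, so its square is controlled by its
  \<open>p\<close>-th power.
\<close>

lemma shrink_L2:
  fixes u :: "'a::euclidean_space \<Rightarrow> 'b::euclidean_space"
  assumes [measurable]: "u \<in> borel_measurable borel" and p: "p \<ge> 2" and \<epsilon>: "\<epsilon> > 0"
    and fin: "Lp_integral p u < \<infinity>"
  shows "L2sq (\<lambda>x. shrink \<epsilon> (u x)) < \<infinity>"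
proof -
  let ?c = "4 * \<epsilon> powr (2 - p)"
  have "(norm (shrink \<epsilon> a))\<^sup>2 \<le> ?c * norm a powr p" for a :: 'b
  proof (cases "norm a \<le> \<epsilon>")
    case True then show ?thesis by (simp add: shrink_eq_0)
  next
    case False
    then have a: "norm a > \<epsilon>" "norm a > 0" using \<epsilon> by auto
    have "(norm (shrink \<epsilon> a))\<^sup>2 \<le> (2 * norm a)\<^sup>2"
      by (intro power_mono norm_shrink_le \<epsilon>) simp
    also have "\<dots> = 4 * (norm a powr (2 - p) * norm a powr p)"
      using a by (simp add: power_mult_distrib flip: powr_add)
    also have "\<dots> \<le> 4 * (\<epsilon> powr (2 - p) * norm a powr p)"
      using a \<epsilon> p by (intro mult_left_mono mult_right_mono powr_mono2') auto
    finally show ?thesis by simp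
  qed
  then have "L2sq (\<lambda>x. shrink \<epsilon> (u x)) \<le> (\<integral>\<^sup>+x. ennreal ?c * ennreal (norm (u x) powr p) \<partial>lborel)"
    unfolding L2sq_def by (intro nn_integral_mono) (simp add: ennreal_leI flip: ennreal_mult)
  also have "\<dots> = ennreal ?c * Lp_integral p u"
    by (rule nn_integral_cmult) measurable
  also have "\<dots> < \<infinity>" using fin by (simp add: ennreal_mult_less_top)
  finally show ?thesis .
qed


text \<open>
  Absorption: for \<open>K < \<kappa>\<close> one has $(m + K t)^2 \le \kappa^2 t^2 + c m^2$, and the first term is absorbed by the
  lower bound with \<open>\<nu> > \<kappa>\<close>. Here \<open>d\<close> is an arbitrary function, so its square is
  compared pointwise with the Borel function \<open>q\<close>, and only \<open>q\<close> is integrated further.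
\<close>

lemma rank_one_perturbation_bound:
  fixes G :: "real ^ 'n::finite \<Rightarrow> real ^ 'n ^ 'm::finite"
  assumes A: "linear A" and [measurable]: "G \<in> borel_measurable borel" and fin: "L2sq G < \<infinity>"
    and low: "ennreal (\<nu>\<^sup>2) * L2sq G \<le> L2sq (\<lambda>x. A (G x))"
    and K: "0 \<le> K" "K < \<kappa>" "\<kappa> < \<nu>"
    and le: "AE x in lborel. norm (A (G x)) \<le> d x + K * norm (G x)" and d: "\<And>x. 0 \<le> d x"
    and j: "(\<integral>\<^sup>+x. ennreal ((d x)\<^sup>2) \<partial>lborel) = ennreal j" "0 \<le> j"
  shows "enn2real (L2sq G) \<le> (\<kappa> / (\<kappa> - K))\<^sup>2 / (\<nu>\<^sup>2 - \<kappa>\<^sup>2) * j"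
proof -
  note [measurable] = linear_borel_measurable[OF A]
  let ?c = "(\<kappa> / (\<kappa> - K))\<^sup>2"
  define q where "q x = max 0 ((norm (A (G x)))\<^sup>2 - \<kappa>\<^sup>2 * (norm (G x))\<^sup>2) / ?c" for x
  have c: "?c > 0" using K by simp
  have [measurable]: "q \<in> borel_measurable borel" unfolding q_def[abs_def] by measurable
  have "AE x in lborel. q x \<le> (d x)\<^sup>2"
    using le
  proof eventually_elim
    case (elim x)
    let ?g = "norm (G x)" and ?m = "d x"
    have "(norm (A (G x)))\<^sup>2 \<le> (?m + K * ?g)\<^sup>2" using elim by (intro power_mono) auto
    also have "\<dots> \<le> \<kappa>\<^sup>2 * ?g\<^sup>2 + ?c * ?m\<^sup>2"
    proof (cases "?m \<le> (\<kappa> - K) * ?g")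
      case True
      then have "(?m + K * ?g)\<^sup>2 \<le> (\<kappa> * ?g)\<^sup>2" using K d[of x] by (intro power_mono) (auto simp: algebra_simps)
      then show ?thesis using c by (simp add: power_mult_distrib add_increasing2)
    next
      case False
      then have "?g \<le> ?m / (\<kappa> - K)" using K by (simp add: field_simps)
      then have "?m + K * ?g \<le> ?m + K * (?m / (\<kappa> - K))" using K by (intro add_left_mono mult_left_mono) auto
      also have "\<dots> = \<kappa> / (\<kappa> - K) * ?m" using K by (simp add: field_simps)
      finally have "(?m + K * ?g)\<^sup>2 \<le> (\<kappa> / (\<kappa> - K) * ?m)\<^sup>2" using K d[of x] by (intro power_mono) auto
      then show ?thesis by (simp only: power_mult_distrib) (simp add: add_increasing)
    qed
    finally have "max 0 ((norm (A (G x)))\<^sup>2 - \<kappa>\<^sup>2 * ?g\<^sup>2) \<le> ?c * ?m\<^sup>2" by simp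
    then show ?case unfolding q_def using c by (subst pos_divide_le_eq) (auto simp: mult.commute)
  qed
  then have "(\<integral>\<^sup>+x. ennreal (q x) \<partial>lborel) \<le> ennreal j"
    unfolding j(1)[symmetric] by (intro nn_integral_mono_AE) (auto elim!: eventually_mono intro: ennreal_leI)
  then obtain Q where Q: "(\<integral>\<^sup>+x. ennreal (q x) \<partial>lborel) = ennreal Q" "0 \<le> Q" "Q \<le> j"
    using j(2) by (cases "\<integral>\<^sup>+x. ennreal (q x) \<partial>lborel") (auto simp: top_unique)
  obtain g where g: "L2sq G = ennreal g" "0 \<le> g" using fin by (cases "L2sq G") auto
  have "ennreal (\<nu>\<^sup>2) * L2sq G \<le> (\<integral>\<^sup>+x. ennreal (\<kappa>\<^sup>2) * ennreal ((norm (G x))\<^sup>2) + ennreal ?c * ennreal (q x) \<partial>lborel)"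
  proof (rule order_trans[OF low], unfold L2sq_def, rule nn_integral_mono)
    fix x
    have "(norm (A (G x)))\<^sup>2 \<le> \<kappa>\<^sup>2 * (norm (G x))\<^sup>2 + ?c * q x"
      using c by (simp add: q_def)
    then show "ennreal ((norm (A (G x)))\<^sup>2) \<le> ennreal (\<kappa>\<^sup>2) * ennreal ((norm (G x))\<^sup>2) + ennreal ?c * ennreal (q x)"
      by (subst ennreal_mult[symmetric], simp, simp, subst ennreal_mult[symmetric])
         (auto simp: q_def ennreal_leI simp flip: ennreal_plus)
  qed
  also have "\<dots> = ennreal (\<kappa>\<^sup>2) * L2sq G + ennreal ?c * (\<integral>\<^sup>+x. ennreal (q x) \<partial>lborel)"
    unfolding L2sq_def by (subst nn_integral_add, measurable, simp add: nn_integral_cmult)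
  also have "\<dots> = ennreal (\<kappa>\<^sup>2 * g + ?c * Q)"
    unfolding g Q(1) using g Q c by (subst ennreal_plus) (auto simp: ennreal_mult)
  also have "ennreal (\<nu>\<^sup>2) * L2sq G = ennreal (\<nu>\<^sup>2 * g)" unfolding g using g(2) by (simp add: ennreal_mult)
  finally have "\<nu>\<^sup>2 * g \<le> \<kappa>\<^sup>2 * g + ?c * Q" using g Q c by (subst (asm) ennreal_le_iff) auto
  moreover have "?c * Q \<le> ?c * j" by (intro mult_left_mono Q) simp
  ultimately have "(\<nu>\<^sup>2 - \<kappa>\<^sup>2) * g \<le> ?c * j" unfolding left_diff_distrib by linarith
  moreover have "\<nu>\<^sup>2 - \<kappa>\<^sup>2 > 0" using K by (simp add: power_strict_mono)
  ultimately have "g \<le> ?c * j / (\<nu>\<^sup>2 - \<kappa>\<^sup>2)"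
    by (simp only: pos_le_divide_eq mult.commute[of g])
  then show ?thesis using g by simp
qed

lemma Lp_norm_finite: "Lp_norm p f < \<infinity> \<longleftrightarrow> (\<integral>\<^sup>+x. ennreal (norm (f x) powr p) \<partial>lebesgue) < \<infinity>"
  by (simp add: Lp_norm_def Let_def less_top)

lemma Lp_norm_eq:
  assumes "AE x in lborel. f x = g x" "Lp_integral p g = ennreal I" "0 \<le> I"
  shows "Lp_norm p f = ennreal (I powr (1 / p))"
proof -
  have "(\<integral>\<^sup>+x. ennreal (norm (f x) powr p) \<partial>lebesgue) = Lp_integral p f"
    by (rule nn_integral_completion)
  also have "\<dots> = Lp_integral p g"
    by (rule nn_integral_cong_AE) (use assms(1) in \<open>auto elim!: eventually_mono\<close>)
  finally show ?thesis using assms(2,3) by (simp add: Lp_norm_def)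
qed

lemma Lp_norm_AE_eq:
  assumes "AE x in lborel. f x = g x" shows "Lp_norm p f = Lp_norm p g"
proof -
  have "(\<integral>\<^sup>+x. ennreal (norm (f x) powr p) \<partial>lebesgue) = (\<integral>\<^sup>+x. ennreal (norm (g x) powr p) \<partial>lebesgue)"
    unfolding nn_integral_completion
    by (rule nn_integral_cong_AE) (use assms in \<open>auto elim!: eventually_mono\<close>)
  then show ?thesis by (simp add: Lp_norm_def)
qed

lemma Lp_norm_diff_finite:
  fixes f g :: "'a::euclidean_space \<Rightarrow> 'b::euclidean_space"
  assumes "f \<in> Lp_space p" "g \<in> Lp_space p" "p > 0"
  shows "Lp_norm p (\<lambda>x. f x - g x) < \<infinity>"
proof -
  have [measurable]: "f \<in> borel_measurable lebesgue" "g \<in> borel_measurable lebesgue"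
    and fin: "(\<integral>\<^sup>+x. ennreal (norm (f x) powr p) \<partial>lebesgue) < \<infinity>" "(\<integral>\<^sup>+x. ennreal (norm (g x) powr p) \<partial>lebesgue) < \<infinity>"
    using assms unfolding Lp_space_def mem_Collect_eq Lp_norm_finite by blast+
  have point: "norm (a - b) powr p \<le> 2 powr p * norm a powr p + 2 powr p * norm b powr p" for a b :: 'b
  proof -
    have "norm (a - b) \<le> 2 * max (norm a) (norm b)" using norm_triangle_ineq4[of a b] by linarith
    then have "norm (a - b) powr p \<le> (2 * max (norm a) (norm b)) powr p"
      using assms(3) by (intro powr_mono2) auto
    also have "\<dots> = 2 powr p * max (norm a) (norm b) powr p" by (simp add: powr_mult)
    also have "\<dots> \<le> 2 powr p * norm a powr p + 2 powr p * norm b powr p"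
      by (auto simp: max_def)
    finally show ?thesis .
  qed
  have "(\<integral>\<^sup>+x. ennreal (norm (f x - g x) powr p) \<partial>lebesgue)
    \<le> (\<integral>\<^sup>+x. ennreal (2 powr p) * ennreal (norm (f x) powr p) + ennreal (2 powr p) * ennreal (norm (g x) powr p) \<partial>lebesgue)"
    using point by (intro nn_integral_mono) (simp add: ennreal_leI flip: ennreal_mult ennreal_plus)
  also have "\<dots> = ennreal (2 powr p) * (\<integral>\<^sup>+x. ennreal (norm (f x) powr p) \<partial>lebesgue) + ennreal (2 powr p) * (\<integral>\<^sup>+x. ennreal (norm (g x) powr p) \<partial>lebesgue)"
    by (subst nn_integral_add, measurable, simp add: nn_integral_cmult)
  also have "\<dots> < \<infinity>" using fin by (simp add: ennreal_mult_less_top)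
  finally show ?thesis by (simp only: Lp_norm_finite)
qed

text \<open>
  Strict ellipticity says that, at almost every point, \<open>F\<close> differs from \<open>A\<close> by a map with Lipschitz constant \<open>K < \<nu>\<close> in the matrix
  variable, so that the rank-one bound for \<open>D(w - v)\<close> passes from \<open>A\<close> to \<open>F\<close>; the Sobolev inequality
  then bounds \<open>w - v\<close>.
\<close>

lemma strictly_elliptic_estimate:
  fixes F :: "real ^ 'n::finite \<Rightarrow> real ^ 'n ^ 'm::finite \<Rightarrow> real ^ 'm"
  assumes n: "CARD('n) \<ge> 3" and F: "strictly_elliptic F"
  shows "\<exists>C>0. \<forall>w \<in> sobolev_space (sobolev_exponent CARD('n)) 2.
            \<forall>v \<in> sobolev_space (sobolev_exponent CARD('n)) 2.
            \<forall>Dw Dv. has_weak_gradient w Dw \<longrightarrow> has_weak_gradient v Dv \<longrightarrow>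
              Lp_norm (sobolev_exponent CARD('n)) (\<lambda>x. w x - v x) + Lp_norm 2 (\<lambda>x. Dw x - Dv x)
                \<le> ennreal C * Lp_norm 2 (\<lambda>x. F x (Dw x) - F x (Dv x))"
proof -
  define p where "p = sobolev_exponent CARD('n)"
  have p: "p = 2 * real DIM(real ^ 'n) / (real DIM(real ^ 'n) - 2)" by (simp add: p_def sobolev_exponent_def)
  have nD: "DIM(real ^ 'n) \<ge> 3" using n by simp
  have p2: "p \<ge> 2" using n by (simp add: p_def sobolev_exponent_def field_simps)
  obtain A where A: "linear A"
    and lt: "esssup lebesgue (ellipticity_deviation F A) < ennreal (ellipticity_const A)"
    using F by (auto simp: strictly_elliptic_def)
  let ?\<nu> = "ellipticity_const A"
  obtain K where K: "esssup lebesgue (ellipticity_deviation F A) = ennreal K" "0 \<le> K"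
    using lt by (cases "esssup lebesgue (ellipticity_deviation F A)") auto
  have K\<nu>: "K < ?\<nu>" using lt K by (simp add: ennreal_less_iff)
  define \<kappa> where "\<kappa> = (K + ?\<nu>) / 2"
  have \<kappa>: "K < \<kappa>" "\<kappa> < ?\<nu>" using K\<nu> by (auto simp: \<kappa>_def)
  have "AE x in lebesgue. ellipticity_deviation F A x \<le> ennreal K"
    unfolding K(1)[symmetric] by (rule esssup_AE)
  then have dev: "AE x in lborel. ellipticity_deviation F A x \<le> ennreal K" by (simp add: AE_completion_iff)
  have pert: "norm (A (P - Q)) \<le> norm (F x P - F x Q) + K * norm (P - Q)"
    if x: "ellipticity_deviation F A x \<le> ennreal K" for x P Q
  proof (cases "P = Q")
    case False
    have "ennreal (norm (F x (Q + (P - Q)) - F x Q - A (P - Q)) / norm (P - Q)) \<le> ellipticity_deviation F A x"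
      unfolding ellipticity_deviation_def case_prod_beta
      by (rule SUP_upper2[of "(Q, P - Q)"]) (use False in auto)
    also note x
    finally have "norm (F x P - F x Q - A (P - Q)) \<le> K * norm (P - Q)"
      using False K(2) by (simp add: divide_le_eq)
    then show ?thesis
      using norm_triangle_ineq4[of "F x P - F x Q" "F x P - F x Q - A (P - Q)"] by simp
  qed (simp add: linear_0[OF A])
  define C0 where "C0 = 16 * 4 powr p * real DIM(real ^ 'n)"
  define c1 where "c1 = (\<kappa> / (\<kappa> - K))\<^sup>2 / (?\<nu>\<^sup>2 - \<kappa>\<^sup>2)"
  have C0: "C0 > 0" using n by (simp add: C0_def)
  have "\<kappa> > 0" using K \<kappa> by linarith
  moreover have "\<kappa>\<^sup>2 < ?\<nu>\<^sup>2" using K \<kappa> by (intro power_strict_mono) auto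
  ultimately have c1: "c1 > 0" using \<kappa> by (simp add: c1_def)
  define C where "C = (sqrt C0 + 1) * sqrt c1"
  have C: "C > 0" using C0 c1 by (simp add: C_def add_pos_pos)
  have "Lp_norm p (\<lambda>x. w x - v x) + Lp_norm 2 (\<lambda>x. Dw x - Dv x) \<le> ennreal C * Lp_norm 2 (\<lambda>x. F x (Dw x) - F x (Dv x))"
    if w: "w \<in> sobolev_space p 2" and v: "v \<in> sobolev_space p 2"
      and Dw: "has_weak_gradient w Dw" and Dv: "has_weak_gradient v Dv" for w v Dw Dv
  proof -
    have wp: "w \<in> Lp_space p" "v \<in> Lp_space p" using w v by (auto simp: sobolev_space_def)
    obtain Dw' Dv' where D': "Dw' \<in> Lp_space 2" "has_weak_gradient w Dw'" "Dv' \<in> Lp_space 2" "has_weak_gradient v Dv'"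
      using w v by (auto simp: sobolev_space_def)
    have "AE x in lborel. Dw x - Dv x = Dw' x - Dv' x"
      using weak_gradient_unique[OF Dw D'(2)] weak_gradient_unique[OF Dv D'(4)] by eventually_elim simp
    then have finD: "Lp_norm 2 (\<lambda>x. Dw x - Dv x) < \<infinity>"
      using Lp_norm_diff_finite[OF D'(1,3)] by (simp add: Lp_norm_AE_eq)
    have finu: "Lp_norm p (\<lambda>x. w x - v x) < \<infinity>" using Lp_norm_diff_finite[OF wp] p2 by simp
    obtain u G where wg: "vector_weak_gradient u G" and u: "AE x in lborel. w x - v x = u x"
      and G: "AE x in lborel. Dw x - Dv x = G x"
      using weak_gradient_borel_version[OF has_weak_gradient_diff[OF Dw Dv]] by blast
    note [measurable] = vector_weak_gradient_measurable[OF wg]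
    have L2: "Lp_integral 2 G = L2sq G" by (simp add: L2sq_def)
    have finG: "L2sq G < \<infinity>"
      using finD unfolding Lp_norm_AE_eq[OF G] Lp_norm_finite nn_integral_completion L2 .
    then obtain g where g: "L2sq G = ennreal g" "0 \<le> g" by (cases "L2sq G") auto
    have finU: "Lp_integral p u < \<infinity>"
      using finu unfolding Lp_norm_AE_eq[OF u] Lp_norm_finite nn_integral_completion .
    then obtain I where I: "Lp_integral p u = ennreal I" "0 \<le> I"
      by (cases "Lp_integral p u") auto
    have "ennreal I \<le> ennreal ((C0 * g) powr (p / 2))"
      unfolding I(1)[symmetric] C0_def
    proof (rule Sobolev_inequality[OF nD p _ finU g(2)])
      show "L2sq (\<lambda>x. u (x + y) - u x) \<le> ennreal ((norm y)\<^sup>2 * g)" for y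
        using weak_gradient_translation_bound[OF wg, of y] g by (simp add: ennreal_mult)
    qed measurable
    then have "I \<le> (C0 * g) powr (p / 2)" by (simp add: ennreal_le_iff)
    then have "I powr (1 / p) \<le> ((C0 * g) powr (p / 2)) powr (1 / p)"
      using I(2) p2 by (intro powr_mono2) auto
    also have "\<dots> = sqrt (C0 * g)" using p2 C0 g(2) by (simp add: powr_powr powr_half_sqrt)
    finally have Iu: "I powr (1 / p) \<le> sqrt (C0 * g)" .
    have low: "ennreal (?\<nu>\<^sup>2) * L2sq G \<le> L2sq (\<lambda>x. A (G x))"
    proof (rule rank_one_bound_weak_gradient[OF A _ ellipticity_const_tensor_bound[OF A] wg finG])
      show "0 \<le> ?\<nu>" using K K\<nu> by linarith
      show "L2sq (\<lambda>x. shrink \<epsilon> (u x)) < \<infinity>" if "\<epsilon> > 0" for \<epsilon>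
        by (rule shrink_L2[OF _ p2 that finU]) measurable
    qed
    let ?d = "\<lambda>x. norm (F x (Dw x) - F x (Dv x))"
    show ?thesis
    proof (cases "(\<integral>\<^sup>+x. ennreal ((?d x)\<^sup>2) \<partial>lborel)")
      case top
      then have "Lp_norm 2 (\<lambda>x. F x (Dw x) - F x (Dv x)) = \<infinity>"
        by (simp add: Lp_norm_def nn_integral_completion)
      then show ?thesis using C by (simp add: ennreal_mult_top)
    next
      case (real j)
      have "AE x in lborel. norm (A (G x)) \<le> ?d x + K * norm (G x)"
        using G dev
      proof eventually_elim
        case (elim x)
        then show ?case using pert[of x "Dw x" "Dv x"] by simp
      qed
      from rank_one_perturbation_bound[OF A _ finG low K(2) \<kappa> this _ real(2,1)]
      have gj: "g \<le> c1 * j" using g by (simp add: c1_def)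
      have nu: "Lp_norm p (\<lambda>x. w x - v x) = ennreal (I powr (1 / p))" by (rule Lp_norm_eq[OF u I])
      have nG: "Lp_norm 2 (\<lambda>x. Dw x - Dv x) = ennreal (sqrt g)"
        using Lp_norm_eq[OF G, of 2 g] g L2 by (simp add: powr_half_sqrt)
      have nF: "Lp_norm 2 (\<lambda>x. F x (Dw x) - F x (Dv x)) = ennreal (sqrt j)"
        using Lp_norm_eq[of "\<lambda>x. F x (Dw x) - F x (Dv x)" "\<lambda>x. F x (Dw x) - F x (Dv x)" 2 j] real
        by (simp add: powr_half_sqrt)
      have "I powr (1 / p) + sqrt g \<le> (sqrt C0 + 1) * sqrt g" using Iu by (simp add: real_sqrt_mult distrib_right)
      also have "\<dots> \<le> (sqrt C0 + 1) * sqrt (c1 * j)"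
        using gj C0 by (intro mult_left_mono) auto
      also have "\<dots> = C * sqrt j" by (simp add: C_def real_sqrt_mult)
      finally have "ennreal (I powr (1 / p) + sqrt g) \<le> ennreal (C * sqrt j)" by (rule ennreal_leI)
      then show ?thesis
        unfolding nu nG nF using C g real by (simp add: ennreal_mult)
    qed
  qed
  then show ?thesis unfolding p_def[symmetric] using C by blast
qed

theorem corollary10:
  fixes F :: "real ^ 'n::finite \<Rightarrow> real ^ 'n ^ 'm::finite \<Rightarrow> real ^ 'm"
  assumes "CARD('n) \<ge> 3" and "CARD('m) \<ge> 2"
    and "caratheodory F" and "strictly_elliptic F"
  shows
    "(\<exists>C>0. \<forall>w \<in> sobolev_space (sobolev_exponent CARD('n)) 2.
            \<forall>v \<in> sobolev_space (sobolev_exponent CARD('n)) 2.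
            \<forall>Dw Dv. has_weak_gradient w Dw \<longrightarrow> has_weak_gradient v Dv \<longrightarrow>
              Lp_norm (sobolev_exponent CARD('n)) (\<lambda>x. w x - v x) + Lp_norm 2 (\<lambda>x. Dw x - Dv x)
                \<le> ennreal C * Lp_norm 2 (\<lambda>x. F x (Dw x) - F x (Dv x))) \<and>
     (\<forall>f \<in> Lp_space 2.
        \<forall>u1 \<in> sobolev_space (sobolev_exponent CARD('n)) 2.
        \<forall>u2 \<in> sobolev_space (sobolev_exponent CARD('n)) 2.
          strong_solution F f u1 \<longrightarrow> strong_solution F f u2 \<longrightarrow> (AE x in lebesgue. u1 x = u2 x))"
proof (rule conjI[OF strictly_elliptic_estimate[OF assms(1,4)]], intro ballI impI)
  fix f u1 u2
  let ?p = "sobolev_exponent CARD('n)"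
  assume u: "u1 \<in> sobolev_space ?p 2" "u2 \<in> sobolev_space ?p 2"
    and sol: "strong_solution F f u1" "strong_solution F f u2"
  obtain D1 D2 where D1: "has_weak_gradient u1 D1" "AE x in lebesgue. F x (D1 x) = f x"
    and D2: "has_weak_gradient u2 D2" "AE x in lebesgue. F x (D2 x) = f x"
    using sol by (auto simp: strong_solution_def)
  have "AE x in lebesgue. F x (D1 x) - F x (D2 x) = 0"
    using D1(2) D2(2) by eventually_elim simp
  then have "AE x in lborel. F x (D1 x) - F x (D2 x) = 0" by (simp add: AE_completion_iff)
  then have "Lp_norm 2 (\<lambda>x. F x (D1 x) - F x (D2 x)) = ennreal (0 powr (1 / 2))"
    by (rule Lp_norm_eq) auto
  then have "Lp_norm 2 (\<lambda>x. F x (D1 x) - F x (D2 x)) = 0" by simp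
  then have "Lp_norm ?p (\<lambda>x. u1 x - u2 x) = 0"
    using strictly_elliptic_estimate[OF assms(1,4)] u D1(1) D2(1) by fastforce
  then have "(\<integral>\<^sup>+x. ennreal (norm (u1 x - u2 x) powr ?p) \<partial>lebesgue) = 0"
    by (auto simp: Lp_norm_def Let_def enn2real_eq_0_iff split: if_splits)
  moreover have [measurable]: "u1 \<in> borel_measurable lebesgue" "u2 \<in> borel_measurable lebesgue"
    using u by (auto simp: sobolev_space_def Lp_space_def)
  ultimately have "AE x in lebesgue. ennreal (norm (u1 x - u2 x) powr ?p) = 0"
    by (subst (asm) nn_integral_0_iff_AE) auto
  then show "AE x in lebesgue. u1 x = u2 x"
    by eventually_elim simp
qed

end
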